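(* Concept satisfiability (and subsumption) for the description logic that extends $\mathcal{ALCQ}(\circ)$ (i.e. $\mathcal{ALC}$ with qualified number restrictions $(\ge n\,S.C)$, $(\le n\,S.C)$ on role chains $S=R_1\circ\cdots\circ R_m$ of atomic roles) with unions/intersections of role chains of the same length is decidable, and a tableau algorithm is an effective decision procedure for it.
   Context: The roles allowed inside number restrictions have the form $\mathcal{R}=\bigsqcup_{i=1}^{M} S_i$, where each $S_i$ is the intersection over $j=1,\dots,N_i$ of role chains $R^{ij}_1\circ R^{ij}_2\circ\cdots\circ R^{ij}_m$ of atomic roles, all chains having the same length $m$ (disjunctive normal form). The tableau algorithm works on ABoxes starting from $\{C_0(x_0)\}$ with $C_0$ in negation normal form with value/existential restrictions rewritten as qualified number restrictions, and uses the $\sqcap$-, $\sqcup$-rules, a $\ge$-rule that creates fresh $\mathcal{R}$-successor chains satisfying $C$ and pairwise distinct, a $\le$-rule that merges two $\mathcal{R}$-successors not declared distinct, and a "choose" rule adding either $C(y)$ or its negation normal form complement for each $\mathcal{R}$-successor $y$ relevant to a number restriction; it answers "satisfiable" iff a complete clash-free ABox is produced. *)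

theory Defs
  imports Main "HOL-Library.Nat_Bijection"
begin

section \<open>Syntax\<close>

text \<open>
  A complex role is in disjunctive normal form: the outer list is the union of the
  \<open>S\<^sub>i\<close>, each \<open>S\<^sub>i\<close> is the intersection of the role chains in the middle list, and
  each chain is a list of atomic roles. Concept, role and individual names are naturals.
\<close>

type_synonym crole = "nat list list list"

datatype concept =
    Top
  | Bot
  | Atom nat
  | Neg concept
  | And concept concept
  | Or concept concept
  | ExR nat concept
  | AllR nat concept
  | AtLeast nat crole concept
  | AtMost nat crole concept

definition wf_crole :: "crole \<Rightarrow> bool" where
  "wf_crole RR \<longleftrightarrow> RR \<noteq> [] \<and> (\<forall>S\<in>set RR. S \<noteq> []) \<and>
     (\<exists>m\<ge>1. \<forall>S\<in>set RR. \<forall>ch\<in>set S. length ch = m)"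

fun wf_concept :: "concept \<Rightarrow> bool" where
  "wf_concept Top = True"
| "wf_concept Bot = True"
| "wf_concept (Atom a) = True"
| "wf_concept (Neg C) = wf_concept C"
| "wf_concept (And C D) = (wf_concept C \<and> wf_concept D)"
| "wf_concept (Or C D) = (wf_concept C \<and> wf_concept D)"
| "wf_concept (ExR r C) = wf_concept C"
| "wf_concept (AllR r C) = wf_concept C"
| "wf_concept (AtLeast n RR C) = (wf_crole RR \<and> wf_concept C)"
| "wf_concept (AtMost n RR C) = (wf_crole RR \<and> wf_concept C)"


section \<open>Semantics\<close>

fun chain_rel :: "(nat \<Rightarrow> ('a \<times> 'a) set) \<Rightarrow> nat list \<Rightarrow> ('a \<times> 'a) set" where
  "chain_rel \<rho> [] = Id"
| "chain_rel \<rho> (r # rs) = \<rho> r O chain_rel \<rho> rs"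

definition crole_rel :: "(nat \<Rightarrow> ('a \<times> 'a) set) \<Rightarrow> crole \<Rightarrow> ('a \<times> 'a) set" where
  "crole_rel \<rho> RR = (\<Union>S\<in>set RR. \<Inter>ch\<in>set S. chain_rel \<rho> ch)"

record 'd interp =
  univ :: "'d set"
  conc :: "nat \<Rightarrow> 'd set"
  role :: "nat \<Rightarrow> ('d \<times> 'd) set"

definition is_interp :: "'d interp \<Rightarrow> bool" where
  "is_interp I \<longleftrightarrow> univ I \<noteq> {} \<and> (\<forall>a. conc I a \<subseteq> univ I) \<and> (\<forall>r. role I r \<subseteq> univ I \<times> univ I)"

fun cext :: "'d interp \<Rightarrow> concept \<Rightarrow> 'd set" where
  "cext I Top = univ I"
| "cext I Bot = {}"
| "cext I (Atom a) = conc I a"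
| "cext I (Neg C) = univ I - cext I C"
| "cext I (And C D) = cext I C \<inter> cext I D"
| "cext I (Or C D) = cext I C \<union> cext I D"
| "cext I (ExR r C) = {x \<in> univ I. \<exists>y. (x, y) \<in> role I r \<and> y \<in> cext I C}"
| "cext I (AllR r C) = {x \<in> univ I. \<forall>y. (x, y) \<in> role I r \<longrightarrow> y \<in> cext I C}"
| "cext I (AtLeast n RR C) = {x \<in> univ I.
     infinite {y. (x, y) \<in> crole_rel (role I) RR \<and> y \<in> cext I C} \<or>
     n \<le> card {y. (x, y) \<in> crole_rel (role I) RR \<and> y \<in> cext I C}}"
| "cext I (AtMost n RR C) = {x \<in> univ I.
     finite {y. (x, y) \<in> crole_rel (role I) RR \<and> y \<in> cext I C} \<and>
     card {y. (x, y) \<in> crole_rel (role I) RR \<and> y \<in> cext I C} \<le> n}"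

text \<open>
  HOL cannot quantify over all domains inside a formula, so the type from which domains
  are drawn is a parameter; domains are arbitrary nonempty subsets of that type. With an
  infinite type, all finite and countable domains are represented up to isomorphism.
\<close>

definition satisfiable :: "'d itself \<Rightarrow> concept \<Rightarrow> bool" where
  "satisfiable _ C \<longleftrightarrow> (\<exists>I :: 'd interp. is_interp I \<and> cext I C \<noteq> {})"

definition subsumed :: "'d itself \<Rightarrow> concept \<Rightarrow> concept \<Rightarrow> bool" where
  "subsumed _ C D \<longleftrightarrow> (\<forall>I :: 'd interp. is_interp I \<longrightarrow> cext I C \<subseteq> cext I D)"


section \<open>Negation normal form\<close>

text \<open>
  \<open>nnf True C\<close> is the negation normal form of \<open>C\<close> and \<open>nnf False C\<close> that of its
  negation; value and existential restrictions become qualified number restrictions.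
\<close>

fun nnf :: "bool \<Rightarrow> concept \<Rightarrow> concept" where
  "nnf p Top = (if p then Top else Bot)"
| "nnf p Bot = (if p then Bot else Top)"
| "nnf p (Atom a) = (if p then Atom a else Neg (Atom a))"
| "nnf p (Neg C) = nnf (\<not> p) C"
| "nnf p (And C D) = (if p then And else Or) (nnf p C) (nnf p D)"
| "nnf p (Or C D) = (if p then Or else And) (nnf p C) (nnf p D)"
| "nnf p (ExR r C) = (if p then AtLeast 1 else AtMost 0) [[[r]]] (nnf True C)"
| "nnf p (AllR r C) = (if p then AtMost 0 else AtLeast 1) [[[r]]] (nnf False C)"
| "nnf p (AtLeast n RR C) =
     (if p then AtLeast n RR (nnf True C)
      else case n of 0 \<Rightarrow> Bot | Suc k \<Rightarrow> AtMost k RR (nnf True C))"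
| "nnf p (AtMost n RR C) = (if p then AtMost n else AtLeast (Suc n)) RR (nnf True C)"

abbreviation compl :: "concept \<Rightarrow> concept" where
  "compl C \<equiv> nnf False C"


section \<open>The tableau algorithm\<close>

datatype assertion =
    CAssert concept nat
  | RAssert nat nat nat
  | Neq nat nat

type_synonym abox = "assertion set"

fun ainds :: "assertion \<Rightarrow> nat set" where
  "ainds (CAssert C x) = {x}"
| "ainds (RAssert r x y) = {x, y}"
| "ainds (Neq x y) = {x, y}"

fun asubst :: "nat \<Rightarrow> nat \<Rightarrow> assertion \<Rightarrow> assertion" where
  "asubst y z (CAssert C x) = CAssert C (if x = y then z else x)"
| "asubst y z (RAssert r x x') = RAssert r (if x = y then z else x) (if x' = y then z else x')"
| "asubst y z (Neq x x') = Neq (if x = y then z else x) (if x' = y then z else x')"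

definition succs :: "abox \<Rightarrow> crole \<Rightarrow> nat \<Rightarrow> nat set" where
  "succs A RR x = {y. (x, y) \<in> crole_rel (\<lambda>r. {(u, v). RAssert r u v \<in> A}) RR}"

definition csuccs :: "abox \<Rightarrow> crole \<Rightarrow> concept \<Rightarrow> nat \<Rightarrow> nat set" where
  "csuccs A RR C x = {y \<in> succs A RR x. CAssert C y \<in> A}"

definition pairwise_neq :: "abox \<Rightarrow> nat set \<Rightarrow> bool" where
  "pairwise_neq A Y \<longleftrightarrow> (\<forall>y\<in>Y. \<forall>z\<in>Y. y \<noteq> z \<longrightarrow> Neq y z \<in> A)"

definition fresh :: "abox \<Rightarrow> nat" where
  "fresh A = Suc (Max (\<Union>a\<in>A. ainds a))"

text \<open>
  \<open>fresh_succ N k\<close> is the \<open>k\<close>-th new successor, and \<open>chain_node N x m k j l\<close> the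
  \<open>l\<close>-th individual on the \<open>j\<close>-th chain (of length \<open>m\<close>) leading from \<open>x\<close> to it. All
  individuals other than \<open>x\<close> are at least \<open>N\<close>; the chains for one \<open>k\<close> share only their
  two end points. Fixing the new names makes the set of results of a rule finite.
\<close>

definition fresh_succ :: "nat \<Rightarrow> nat \<Rightarrow> nat" where
  "fresh_succ N k = N + prod_encode (k, 0)"

definition chain_node :: "nat \<Rightarrow> nat \<Rightarrow> nat \<Rightarrow> nat \<Rightarrow> nat \<Rightarrow> nat \<Rightarrow> nat" where
  "chain_node N x m k j l =
     (if l = 0 then x
      else if l = m then fresh_succ N k
      else N + prod_encode (k, Suc (prod_encode (j, l))))"

text \<open>
  The list \<open>Ss\<close> holds, for each new successor, the disjunct \<open>S\<^sub>i\<close> through which it is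
  reached.
\<close>

definition new_succs :: "nat \<Rightarrow> nat \<Rightarrow> concept \<Rightarrow> nat list list list \<Rightarrow> abox" where
  "new_succs N x C Ss =
     {RAssert (Ss ! k ! j ! l)
              (chain_node N x (length (Ss ! k ! j)) k j l)
              (chain_node N x (length (Ss ! k ! j)) k j (Suc l)) | k j l.
        k < length Ss \<and> j < length (Ss ! k) \<and> l < length (Ss ! k ! j)}
   \<union> {CAssert C (fresh_succ N k) | k. k < length Ss}
   \<union> {Neq (fresh_succ N k) (fresh_succ N k') | k k'.
        k < length Ss \<and> k' < length Ss \<and> k \<noteq> k'}"

inductive tab_step :: "abox \<Rightarrow> abox \<Rightarrow> bool" where
  and_rule:
    "\<lbrakk>CAssert (And C D) x \<in> A; \<not> {CAssert C x, CAssert D x} \<subseteq> A\<rbrakk>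
     \<Longrightarrow> tab_step A (A \<union> {CAssert C x, CAssert D x})"
| or_rule:
    "\<lbrakk>CAssert (Or C D) x \<in> A; {CAssert C x, CAssert D x} \<inter> A = {}; E \<in> {C, D}\<rbrakk>
     \<Longrightarrow> tab_step A (A \<union> {CAssert E x})"
| ge_rule:
    "\<lbrakk>CAssert (AtLeast n RR C) x \<in> A;
      \<not> (\<exists>Y \<subseteq> csuccs A RR C x. finite Y \<and> card Y = n \<and> pairwise_neq A Y);
      length Ss = n; set Ss \<subseteq> set RR\<rbrakk>
     \<Longrightarrow> tab_step A (A \<union> new_succs (fresh A) x C Ss)"
| le_rule:
    "\<lbrakk>CAssert (AtMost n RR C) x \<in> A; card (csuccs A RR C x) > n;
      y \<in> csuccs A RR C x; z \<in> csuccs A RR C x; y \<noteq> z; Neq y z \<notin> A; Neq z y \<notin> A\<rbrakk>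
     \<Longrightarrow> tab_step A (asubst y z ` A)"
| choose_rule:
    "\<lbrakk>CAssert (AtLeast n RR C) x \<in> A \<or> CAssert (AtMost n RR C) x \<in> A;
      y \<in> succs A RR x; {CAssert C y, CAssert (compl C) y} \<inter> A = {};
      E \<in> {C, compl C}\<rbrakk>
     \<Longrightarrow> tab_step A (A \<union> {CAssert E y})"

definition complete :: "abox \<Rightarrow> bool" where
  "complete A \<longleftrightarrow> (\<nexists>B. tab_step A B)"

definition clash :: "abox \<Rightarrow> bool" where
  "clash A \<longleftrightarrow>
     (\<exists>x. CAssert Bot x \<in> A) \<or>
     (\<exists>a x. CAssert (Atom a) x \<in> A \<and> CAssert (Neg (Atom a)) x \<in> A) \<or>
     (\<exists>n RR C x. CAssert (AtMost n RR C) x \<in> A \<and>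
        (\<exists>Y \<subseteq> csuccs A RR C x. finite Y \<and> card Y > n \<and> pairwise_neq A Y))"

definition init_abox :: "concept \<Rightarrow> abox" where
  "init_abox C = {CAssert (nnf True C) 0}"

definition tableau_terminates :: "concept \<Rightarrow> bool" where
  "tableau_terminates C \<longleftrightarrow>
     \<not> (\<exists>f :: nat \<Rightarrow> abox. f 0 = init_abox C \<and> (\<forall>i. tab_step (f i) (f (Suc i))))"

definition tableau_satisfiable :: "concept \<Rightarrow> bool" where
  "tableau_satisfiable C \<longleftrightarrow>
     (\<exists>B. tab_step\<^sup>*\<^sup>* (init_abox C) B \<and> complete B \<and> \<not> clash B)"


section \<open>Computability\<close>

text \<open>
  The total recursive functions of arity \<open>k\<close>, obtained by restricting minimisation to
  regular functions. Only arguments of length \<open>k\<close> are significant, as \<open>ext\<close> expresses.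
\<close>

inductive recursive :: "nat \<Rightarrow> (nat list \<Rightarrow> nat) \<Rightarrow> bool" where
  zero: "recursive k (\<lambda>xs. 0)"
| succ: "recursive 1 (\<lambda>xs. Suc (hd xs))"
| proj: "i < k \<Longrightarrow> recursive k (\<lambda>xs. xs ! i)"
| comp: "\<lbrakk>recursive (length gs) f; \<forall>g\<in>set gs. recursive k g\<rbrakk>
     \<Longrightarrow> recursive k (\<lambda>xs. f (map (\<lambda>g. g xs) gs))"
| prim_rec: "\<lbrakk>recursive k f; recursive (Suc (Suc k)) g\<rbrakk>
     \<Longrightarrow> recursive (Suc k) (\<lambda>xs. rec_nat (f (tl xs)) (\<lambda>n r. g (n # r # tl xs)) (hd xs))"
| mu: "\<lbrakk>recursive (Suc k) f; \<forall>xs. length xs = k \<longrightarrow> (\<exists>n. f (n # xs) = 0)\<rbrakk>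
     \<Longrightarrow> recursive k (\<lambda>xs. LEAST n. f (n # xs) = 0)"
| ext: "\<lbrakk>recursive k f; \<forall>xs. length xs = k \<longrightarrow> g xs = f xs\<rbrakk> \<Longrightarrow> recursive k g"

definition computable :: "(nat \<Rightarrow> nat) \<Rightarrow> bool" where
  "computable f \<longleftrightarrow> recursive 1 (\<lambda>xs. f (hd xs))"

definition decidable :: "nat set \<Rightarrow> bool" where
  "decidable S \<longleftrightarrow> computable (\<lambda>n. if n \<in> S then 1 else 0)"

definition code_crole :: "crole \<Rightarrow> nat" where
  "code_crole RR = list_encode (map (\<lambda>S. list_encode (map list_encode S)) RR)"

fun code_concept :: "concept \<Rightarrow> nat" where
  "code_concept Top = prod_encode (0, 0)"
| "code_concept Bot = prod_encode (1, 0)"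
| "code_concept (Atom a) = prod_encode (2, a)"
| "code_concept (Neg C) = prod_encode (3, code_concept C)"
| "code_concept (And C D) = prod_encode (4, prod_encode (code_concept C, code_concept D))"
| "code_concept (Or C D) = prod_encode (5, prod_encode (code_concept C, code_concept D))"
| "code_concept (ExR r C) = prod_encode (6, prod_encode (r, code_concept C))"
| "code_concept (AllR r C) = prod_encode (7, prod_encode (r, code_concept C))"
| "code_concept (AtLeast n RR C) =
     prod_encode (8, prod_encode (n, prod_encode (code_crole RR, code_concept C)))"
| "code_concept (AtMost n RR C) =
     prod_encode (9, prod_encode (n, prod_encode (code_crole RR, code_concept C)))"

definition code_pair :: "concept \<times> concept \<Rightarrow> nat" where
  "code_pair p = prod_encode (code_concept (fst p), code_concept (snd p))"

fun code_assertion :: "assertion \<Rightarrow> nat" where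
  "code_assertion (CAssert C x) = prod_encode (0, prod_encode (code_concept C, x))"
| "code_assertion (RAssert r x y) = prod_encode (1, prod_encode (r, prod_encode (x, y)))"
| "code_assertion (Neq x y) = prod_encode (2, prod_encode (x, y))"

definition code_abox :: "abox \<Rightarrow> nat" where
  "code_abox A = set_encode (code_assertion ` A)"

lemma code_crole_inject: "code_crole RR = code_crole RR' \<longleftrightarrow> RR = RR'"
proof -
  have inj: "inj (\<lambda>S. list_encode (map list_encode S))"
    by (rule injI) (simp add: list_encode_eq inj_map_eq_map[OF inj_list_encode])
  show ?thesis
    by (simp add: code_crole_def list_encode_eq inj_map_eq_map[OF inj])
qed

lemma inj_code_concept: "inj code_concept"
proof (rule injI)
  fix C D show "code_concept C = code_concept D \<Longrightarrow> C = D"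
    by (induction C arbitrary: D) (case_tac D; simp add: code_crole_inject)+
qed

lemma inj_code_assertion: "inj code_assertion"
proof (rule injI)
  fix a b show "code_assertion a = code_assertion b \<Longrightarrow> a = b"
    by (cases a; cases b) (simp_all add: inj_eq[OF inj_code_concept])
qed

lemma inj_on_code_abox: "inj_on code_abox {A. finite A}"
  unfolding inj_on_def code_abox_def
  by (auto simp: set_encode_eq inj_image_eq_iff[OF inj_code_assertion])

text \<open>
  Effectiveness of the rules: from a finite ABox one can compute the canonical code of the
  finite set of all ABoxes obtained by one rule application (which is 0 iff the ABox is
  complete), and clashes are recognisable.
\<close>

definition wf_abox :: "abox \<Rightarrow> bool" where
  "wf_abox A \<longleftrightarrow> finite A \<and> (\<forall>C x. CAssert C x \<in> A \<longrightarrow> wf_concept C)"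

definition effective_tableau :: bool where
  "effective_tableau \<longleftrightarrow>
     (\<forall>A. wf_abox A \<longrightarrow> finite {B. tab_step A B} \<and> (\<forall>B. tab_step A B \<longrightarrow> wf_abox B)) \<and>
     (\<exists>f. computable f \<and>
        (\<forall>A. wf_abox A \<longrightarrow> f (code_abox A) = set_encode (code_abox ` {B. tab_step A B}))) \<and>
     decidable (code_abox ` {A. wf_abox A \<and> clash A})"

end

theory Submission
  imports Defs
begin

text \<open>
  Termination: all chains of a role have the same length, so every individual of a reachable ABox
  has a level, its distance from the root; each rule respects levels, and a concept of modal depth
  \<open>d\<close> only occurs at levels at most \<open>D - d\<close>. Once an at-least restriction is satisfied at an
  individual by declared-distinct successors it stays satisfied, even under merging. A \<open>\<ge>\<close>-step
  at level \<open>l\<close> therefore decreases the number of unsatisfied at-least restrictions at level \<open>l\<close>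
  and creates individuals only above it, a \<open>\<le>\<close>-step decreases the number of individuals, and the
  other steps add a concept assertion; the lexicographic order on these numbers, taken level by
  level, is well-founded.

  Correctness: a model of an ABox with an applicable rule is, possibly after changing the
  nondeterministic choices, a model of a successor ABox; conversely a complete clash-free ABox is
  itself a finite model.

  Computability: a total function with a recursively enumerable graph is recursive, and r.e.
  predicates are closed under inductive definition by an r.e. rule relation. So it suffices to
  write the rules as list programs; acceptance and, thanks to termination, rejection of a concept
  are then both r.e.
\<close>

section \<open>Recursive functions and r.e. sets of naturals\<close>

text \<open>The class \<open>recursive\<close> has total functions only and r.e. predicates are not
  closed under negation, so each decision combines two enumerations, one per answer. This starts
  with the syntax: the codes of concepts and assertions do not exhaust the naturals, and a number
  that codes nothing must be recognised by rules of its own. Rejection of a concept, likewise, is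
  witnessed by a finite tree that branches over all outcomes of all rules.

  Roles built by union, intersection and composition are positive, hence preserved by homomorphisms.
  ABox inclusion, merging and evaluation in a model are homomorphisms; this one fact yields both the
  persistence of satisfied at-least restrictions and the agreement with models.

  The choose-rule brings in complements, which are not subconcepts. The closure of a concept and the
  truth of assertions in the canonical model are therefore treated by induction on a size in which
  negation has weight 0.

  A canonical model is finite, but an at-least restriction can force it to be arbitrarily large; one
  type serving all concepts must be infinite.\<close>

lemma recursive_computable_comp:
  assumes "computable f" "recursive k g"
  shows "recursive k (\<lambda>xs. f (g xs))"
  using recursive.comp[of "[g]" "\<lambda>xs. f (hd xs)" k] assms by (simp add: computable_def)

lemma recursive_comp2:
  assumes "recursive 2 (\<lambda>xs. F (xs ! 0) (xs ! 1))" "recursive k g" "recursive k h"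
  shows "recursive k (\<lambda>xs. F (g xs) (h xs))"
  using recursive.comp[of "[g, h]" "\<lambda>xs. F (xs ! 0) (xs ! 1)" k] assms
  by (simp add: numeral_2_eq_2)

lemma recursive_Suc: "recursive k g \<Longrightarrow> recursive k (\<lambda>xs. Suc (g xs))"
  using recursive_computable_comp[of Suc k g] recursive.succ by (simp add: computable_def)

text \<open>The scheme \<open>prim_rec\<close> recurses on the first argument and hands on the rest.
  Feeding it \<open>h\<close> followed by all \<open>k\<close> projections allows any recursion
  argument while \<open>G\<close> keeps access to the parameters \<open>xs\<close>.\<close>

lemma recursive_rec_nat:
  assumes f: "recursive k f"
    and g: "recursive (Suc (Suc k)) (\<lambda>ys. G (ys ! 0) (ys ! 1) (drop 2 ys))"
    and h: "recursive k h"
  shows "recursive k (\<lambda>xs. rec_nat (f xs) (\<lambda>n r. G n r xs) (h xs))"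
proof -
  let ?P = "\<lambda>xs. rec_nat (f (tl xs)) (\<lambda>n r. G n r (tl xs)) (hd xs)"
  let ?gs = "h # map (\<lambda>i xs. xs ! i) [0..<k]"
  have "recursive (Suc k) ?P"
    using recursive.prim_rec[OF f g] by simp
  then have "recursive k (\<lambda>xs. ?P (map (\<lambda>g. g xs) ?gs))"
    using h by (intro recursive.comp) (auto intro: recursive.proj)
  then show ?thesis
    by (rule recursive.ext) (auto simp: comp_def map_nth)
qed

lemma computable_id: "computable (\<lambda>x. x)"
  unfolding computable_def
  by (rule recursive.ext[OF recursive.proj[of 0 1]]) (auto simp: length_Suc_conv)

lemma computable_comp: "computable f \<Longrightarrow> computable g \<Longrightarrow> computable (\<lambda>x. f (g x))"
  using recursive_computable_comp[of f 1] by (simp add: computable_def)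

lemma computable_Suc: "computable g \<Longrightarrow> computable (\<lambda>x. Suc (g x))"
  using recursive_Suc by (simp add: computable_def)

lemma computable_zero: "computable (\<lambda>x. 0)"
  by (simp add: computable_def recursive.zero)

lemma computable_const: "computable (\<lambda>x. c)"
  by (induction c) (auto intro: computable_Suc computable_zero)

lemma computable_comp2:
  assumes "recursive 2 (\<lambda>xs. F (xs ! 0) (xs ! 1))" "computable f" "computable g"
  shows "computable (\<lambda>x. F (f x) (g x))"
  using recursive_comp2[OF assms(1)] assms(2,3) by (simp add: computable_def)

section \<open>Arithmetic and the Cantor pairing\<close>

lemma recursive_add: "recursive 2 (\<lambda>xs. xs ! 0 + xs ! 1)"
proof -
  have eq: "a + b = rec_nat a (\<lambda>n r. Suc r) b" for a b :: nat
    by (induction b) auto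
  show ?thesis
    unfolding eq by (intro recursive_rec_nat recursive_Suc recursive.proj) auto
qed

lemma recursive_mult: "recursive 2 (\<lambda>xs. xs ! 0 * xs ! 1)"
proof -
  have eq: "a * b = rec_nat 0 (\<lambda>n r. r + a) b" for a b :: nat
    by (induction b) auto
  have "recursive 4 (\<lambda>ys. ys ! 1 + drop 2 ys ! 0)"
    by (rule recursive.ext[OF recursive_comp2[OF recursive_add recursive.proj[of 1 4] recursive.proj[of 2 4]]])
       auto
  then show ?thesis
    unfolding eq
    by (intro recursive_rec_nat[where G = "\<lambda>n r xs. r + xs ! 0"] recursive.zero recursive.proj)
       (simp_all add: numeral_eq_Suc)
qed

lemma recursive_pred: "recursive k f \<Longrightarrow> recursive k (\<lambda>xs. f xs - 1)"
proof -
  have eq: "a - 1 = rec_nat 0 (\<lambda>n r. n) a" for a :: nat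
    by (induction a) auto
  show "recursive k f \<Longrightarrow> recursive k (\<lambda>xs. f xs - 1)"
    unfolding eq by (intro recursive_rec_nat[where G = "\<lambda>n r xs. n"] recursive.zero recursive.proj) auto
qed

lemma recursive_diff: "recursive 2 (\<lambda>xs. xs ! 0 - xs ! 1)"
proof -
  have eq: "a - b = rec_nat a (\<lambda>n r. r - 1) b" for a b :: nat
    by (induction b) auto
  have "recursive 2 (\<lambda>xs. rec_nat (xs ! 0) (\<lambda>n r. r - 1) (xs ! 1))"
    by (intro recursive_rec_nat[where G = "\<lambda>n r xs. r - 1"] recursive_pred recursive.proj) auto
  then show ?thesis
    by (simp only: eq[symmetric])
qed

lemmas computable_add = computable_comp2[OF recursive_add]
lemmas computable_mult = computable_comp2[OF recursive_mult]
lemmas computable_diff = computable_comp2[OF recursive_diff]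

lemma computable_triangle: "computable f \<Longrightarrow> computable (\<lambda>x. triangle (f x))"
proof -
  have eq: "triangle n = rec_nat 0 (\<lambda>n r. r + Suc n) n" for n
    by (induction n) auto
  have "computable triangle"
    unfolding computable_def eq
    by (intro recursive_rec_nat[where G = "\<lambda>n r xs. r + Suc n"] recursive_comp2[OF recursive_add]
        recursive_Suc recursive.proj recursive.zero)
       (use computable_id in \<open>simp_all add: computable_def\<close>)
  then show "computable f \<Longrightarrow> computable (\<lambda>x. triangle (f x))"
    by (rule computable_comp)
qed

lemma computable_prod_encode:
  "computable f \<Longrightarrow> computable g \<Longrightarrow> computable (\<lambda>x. prod_encode (f x, g x))"
  unfolding prod_encode_def split_conv
  by (intro computable_add computable_triangle)

lemma recursive_prod_encode:
  assumes "recursive k f" "recursive k g"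
  shows "recursive k (\<lambda>xs. prod_encode (f xs, g xs))"
proof -
  have "recursive 2 (\<lambda>xs. triangle (xs ! 0 + xs ! 1) + xs ! 0)"
    by (intro recursive_comp2[OF recursive_add] recursive.proj
        recursive_computable_comp[OF computable_triangle[OF computable_id]]) auto
  from recursive_comp2[OF this assms] show ?thesis
    unfolding prod_encode_def split_conv .
qed

lemma triangle_mono: "a \<le> b \<Longrightarrow> triangle a \<le> triangle b"
  by (induction rule: dec_induct) auto

text \<open>The diagonal of the Cantor pairing on which a number lies is found by unbounded search.\<close>

lemma Least_triangle: "(LEAST s. Suc (prod_encode (a, b)) - triangle (Suc s) = 0) = a + b"
proof (rule Least_equality)
  show "Suc (prod_encode (a, b)) - triangle (Suc (a + b)) = 0"
    by (simp add: prod_encode_def)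
  fix s assume s: "Suc (prod_encode (a, b)) - triangle (Suc s) = 0"
  show "a + b \<le> s"
  proof (rule ccontr)
    assume "\<not> a + b \<le> s"
    then have "triangle (Suc s) \<le> triangle (a + b)" by (intro triangle_mono) auto
    with s show False by (simp add: prod_encode_def)
  qed
qed

lemma computable_Least:
  assumes f: "computable f" and ex: "\<And>x. \<exists>n. f (prod_encode (n, x)) = 0"
  shows "computable (\<lambda>x. LEAST n. f (prod_encode (n, x)) = 0)"
proof -
  have "recursive (Suc 1) (\<lambda>xs. f (prod_encode (xs ! 0, xs ! 1)))"
    by (intro recursive_computable_comp[OF f] recursive_prod_encode recursive.proj) auto
  from recursive.mu[OF this] ex
  have "recursive 1 (\<lambda>xs. LEAST n. f (prod_encode (n, xs ! 0)) = 0)" by simp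
  then show ?thesis
    unfolding computable_def by (rule recursive.ext) (auto simp: length_Suc_conv)
qed

lemma computable_diagonal: "computable (\<lambda>x. LEAST s. Suc x - triangle (Suc s) = 0)"
proof -
  have "recursive (Suc 1) (\<lambda>xs. Suc (xs ! 1) - triangle (Suc (xs ! 0)))"
    by (intro recursive_computable_comp[OF computable_triangle[OF computable_id]]
        recursive_comp2[OF recursive_diff] recursive_Suc recursive.proj) auto
  \<comment> \<open>The witness \<open>s = x\<close> is large enough, as
    \<open>triangle (Suc x) = triangle x + Suc x\<close>.\<close>
  moreover have "\<exists>s. Suc x \<le> triangle (Suc s)" for x
    by (rule exI[of _ x]) simp
  ultimately have "recursive 1 (\<lambda>xs. LEAST s. Suc (xs ! 0) - triangle (Suc s) = 0)"
    using recursive.mu[of 1 "\<lambda>xs. Suc (xs ! 1) - triangle (Suc (xs ! 0))"] by simp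
  then show ?thesis
    unfolding computable_def by (rule recursive.ext) (auto simp: length_Suc_conv)
qed

abbreviation pfst :: "nat \<Rightarrow> nat" where "pfst n \<equiv> fst (prod_decode n)"
abbreviation psnd :: "nat \<Rightarrow> nat" where "psnd n \<equiv> snd (prod_decode n)"

text \<open>In \<open>prod_encode (a, b) = triangle (a + b) + a\<close> the search finds the
  diagonal \<open>a + b\<close>; the first component is the offset on that diagonal, the second is
  what remains of it.\<close>

lemma computable_pfst_psnd: "computable pfst" "computable psnd"
proof -
  have 1: "pfst n = n - triangle (LEAST s. Suc n - triangle (Suc s) = 0)"
    and 2: "psnd n = (LEAST s. Suc n - triangle (Suc s) = 0) - pfst n" for n
  proof -
    obtain a b where n: "n = prod_encode (a, b)" by (metis prod_decode_inverse surj_pair)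
    show "pfst n = n - triangle (LEAST s. Suc n - triangle (Suc s) = 0)"
      and "psnd n = (LEAST s. Suc n - triangle (Suc s) = 0) - pfst n"
      unfolding n Least_triangle by simp_all (simp add: prod_encode_def)
  qed
  show *: "computable pfst"
    unfolding 1 by (intro computable_diff computable_triangle computable_diagonal computable_id)
  show "computable psnd"
    unfolding 2 by (intro computable_diff computable_diagonal *)
qed

lemma computable_pfst: "computable f \<Longrightarrow> computable (\<lambda>x. pfst (f x))"
  and computable_psnd: "computable f \<Longrightarrow> computable (\<lambda>x. psnd (f x))"
  using computable_comp computable_pfst_psnd by blast+

text \<open>Tuples are now packed by \<open>prod_encode\<close>, so that unary functions suffice:
  \<open>g\<close> receives counter, previous value and parameter as one nested pair.\<close>

lemma computable_rec_nat:
  assumes f: "computable f" and h: "computable h"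
    and g: "computable (\<lambda>p. g (pfst (pfst p)) (psnd (pfst p)) (psnd p))"
  shows "computable (\<lambda>x. rec_nat (f x) (\<lambda>n r. g n r x) (h x))"
proof -
  have "recursive 3 (\<lambda>ys. prod_encode (prod_encode (ys ! 0, ys ! 1), ys ! 2))"
    by (intro recursive_prod_encode recursive.proj) auto
  from recursive_computable_comp[OF g this]
  have "recursive 3 (\<lambda>ys. g (ys ! 0) (ys ! 1) (ys ! 2))" by simp
  then have "recursive 3 (\<lambda>ys. g (ys ! 0) (ys ! 1) (hd (drop 2 ys)))"
    by (rule recursive.ext) (auto simp: hd_drop_conv_nth)
  then have "recursive (Suc (Suc 1)) (\<lambda>ys. g (ys ! 0) (ys ! 1) (hd (drop 2 ys)))"
    by (simp add: numeral_3_eq_3)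
  then show ?thesis
    using f h unfolding computable_def by (intro recursive_rec_nat)
qed

text \<open>Semidecidability without partial functions: the projection of the zero set of a total
  recursive function, with \<open>n\<close> as the stage of the search.\<close>

definition cre :: "(nat \<Rightarrow> bool) \<Rightarrow> bool" where
  "cre P \<longleftrightarrow> (\<exists>F. computable F \<and> (\<forall>x. P x \<longleftrightarrow> (\<exists>n. F (prod_encode (x, n)) = 0)))"

lemmas computable_intros = computable_pfst computable_psnd computable_prod_encode computable_Suc
  computable_add computable_mult computable_diff computable_id computable_const

lemma cre_eq0: "computable f \<Longrightarrow> cre (\<lambda>x. f x = 0)"
  unfolding cre_def
  by (rule exI[of _ "\<lambda>q. f (pfst q)"]) (auto intro!: computable_comp[of f] computable_pfst_psnd)

lemma cre_eq: "computable f \<Longrightarrow> computable g \<Longrightarrow> cre (\<lambda>x. f x = g x)"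
proof -
  have eq: "a = b \<longleftrightarrow> (a - b) + (b - a) = 0" for a b :: nat by auto
  show "computable f \<Longrightarrow> computable g \<Longrightarrow> cre (\<lambda>x. f x = g x)"
    unfolding eq[of "f _"] by (intro cre_eq0 computable_intros)
qed

lemma cre_less: "computable f \<Longrightarrow> computable g \<Longrightarrow> cre (\<lambda>x. f x < g x)"
proof -
  have eq: "a < b \<longleftrightarrow> Suc a - b = 0" for a b :: nat by auto
  show "computable f \<Longrightarrow> computable g \<Longrightarrow> cre (\<lambda>x. f x < g x)"
    unfolding eq by (intro cre_eq0 computable_intros)
qed

lemma cre_subst: "cre P \<Longrightarrow> computable f \<Longrightarrow> cre (\<lambda>x. P (f x))"
proof -
  assume "cre P" and f: "computable f"
  then obtain F where F: "computable F" "\<And>x. P x \<longleftrightarrow> (\<exists>n. F (prod_encode (x, n)) = 0)"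
    unfolding cre_def by blast
  show ?thesis
    unfolding cre_def
    by (rule exI[of _ "\<lambda>q. F (prod_encode (f (pfst q), psnd q))"])
       (auto simp: F(2) intro!: computable_comp[OF F(1)] computable_comp[OF f] computable_intros)
qed

text \<open>The witness \<open>y\<close> and the stage that confirms \<open>P x y\<close> are packed
  into one number.\<close>

lemma cre_ex: 
  assumes "cre (\<lambda>p. P (pfst p) (psnd p))"
  shows "cre (\<lambda>x. \<exists>y. P x y)"
proof -
  obtain F where F: "computable F"
    "\<And>p. P (pfst p) (psnd p) \<longleftrightarrow> (\<exists>n. F (prod_encode (p, n)) = 0)"
    using assms unfolding cre_def by blast
  have *: "P x y \<longleftrightarrow> (\<exists>n. F (prod_encode (prod_encode (x, y), n)) = 0)" for x y
    using F(2)[of "prod_encode (x, y)"] by simp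
  have "(\<exists>y. P x y) \<longleftrightarrow> (\<exists>m. F (prod_encode (prod_encode (x, pfst m), psnd m)) = 0)" for x
    unfolding * by (metis fst_conv snd_conv prod_encode_inverse)
  then show ?thesis
    unfolding cre_def
    by (intro exI[of _ "\<lambda>q. F (prod_encode (prod_encode (pfst q, pfst (psnd q)), psnd (psnd q)))"])
      (auto intro!: computable_comp[OF F(1)] computable_intros)
qed

text \<open>A product vanishes iff one of its factors does, so a single stage serves both
  searches.\<close>

lemma cre_disj: "cre P \<Longrightarrow> cre Q \<Longrightarrow> cre (\<lambda>x. P x \<or> Q x)"
proof -
  assume "cre P" "cre Q"
  then obtain F G where F: "computable F" "\<And>x. P x \<longleftrightarrow> (\<exists>n. F (prod_encode (x, n)) = 0)"
    and G: "computable G" "\<And>x. Q x \<longleftrightarrow> (\<exists>n. G (prod_encode (x, n)) = 0)"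
    unfolding cre_def by blast
  show ?thesis
    unfolding cre_def
    by (rule exI[of _ "\<lambda>q. F q * G q"]) (auto simp: F(2) G(2) intro!: computable_mult F(1) G(1))
qed

text \<open>The two searches may succeed at different stages; hence a pair of stages, and a sum in
  place of the product.\<close>

lemma cre_conj: "cre P \<Longrightarrow> cre Q \<Longrightarrow> cre (\<lambda>x. P x \<and> Q x)"
proof -
  assume "cre P" "cre Q"
  then obtain F G where F: "computable F" "\<And>x. P x \<longleftrightarrow> (\<exists>n. F (prod_encode (x, n)) = 0)"
    and G: "computable G" "\<And>x. Q x \<longleftrightarrow> (\<exists>n. G (prod_encode (x, n)) = 0)"
    unfolding cre_def by blast
  show ?thesis
    unfolding cre_def
    by (rule exI[of _ "\<lambda>q. F (prod_encode (pfst q, pfst (psnd q))) + G (prod_encode (pfst q, psnd (psnd q)))"])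
       (auto simp: F(2) G(2) intro!: computable_add computable_comp[OF F(1)] computable_comp[OF G(1)]
         computable_intros, metis fst_conv snd_conv prod_encode_inverse)
qed

text \<open>Finitely many witnesses have a common bound \<open>N\<close>. The product
  \<open>prd\<close> over all stages below \<open>N\<close> vanishes iff \<open>i\<close> has a
  witness there, and the sum \<open>sm\<close> of these products vanishes iff every \<open>i\<close>
  has one; so \<open>N\<close> is the only number left to search for.\<close>

lemma cre_all_less:
  assumes "cre (\<lambda>p. P (pfst p) (psnd p))" and b: "computable b"
  shows "cre (\<lambda>x. \<forall>i<b x. P x i)"
proof -
  obtain F where F: "computable F"
    "\<And>p. P (pfst p) (psnd p) \<longleftrightarrow> (\<exists>n. F (prod_encode (p, n)) = 0)"
    using assms unfolding cre_def by blast
  have PF: "P x y \<longleftrightarrow> (\<exists>n. F (prod_encode (prod_encode (x, y), n)) = 0)" for x y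
    using F(2)[of "prod_encode (x, y)"] by simp
  define prd where "prd N x i = rec_nat 1 (\<lambda>n r. r * F (prod_encode (prod_encode (x, i), n))) N" for N x i
  define sm where "sm k N x = rec_nat 0 (\<lambda>i r. r + prd N x i) k" for k N x
  have prd: "prd N x i = 0 \<longleftrightarrow> (\<exists>n<N. F (prod_encode (prod_encode (x, i), n)) = 0)" for N x i
    by (induction N) (auto simp: prd_def less_Suc_eq)
  have sm: "sm k N x = 0 \<longleftrightarrow> (\<forall>i<k. prd N x i = 0)" for k N x
    by (induction k) (auto simp: sm_def less_Suc_eq)
  have c1: "computable (\<lambda>q. prd (f q) (g q) (h q))"
    if "computable f" "computable g" "computable h" for f g h
    unfolding prd_def
    by (intro computable_rec_nat[where g = "\<lambda>n r q. r * F (prod_encode (prod_encode (g q, h q), n))"]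
        computable_const computable_mult computable_comp[OF F(1)] computable_intros that
        computable_comp[of g psnd] computable_comp[of h psnd] computable_pfst_psnd)
  have c2: "computable (\<lambda>q. sm (b (pfst q)) (psnd q) (pfst q))"
    unfolding sm_def
    by (intro computable_rec_nat[where g = "\<lambda>i r q. r + prd (psnd q) (pfst q) i"]
        computable_const computable_add c1 computable_intros computable_comp[OF b])
  have "(\<forall>i<b x. P x i) \<longleftrightarrow> (\<exists>N. sm (b x) N x = 0)" for x
  proof
    assume "\<forall>i<b x. P x i"
    then obtain w where w: "\<And>i. i < b x \<Longrightarrow> F (prod_encode (prod_encode (x, i), w i)) = 0"
      unfolding PF by metis
    have "w i < Suc (Max (w ` {..<b x}))" if "i < b x" for i
      using that by (simp add: less_Suc_eq_le)
    then show "\<exists>N. sm (b x) N x = 0"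
      unfolding sm prd using w by blast
  qed (auto simp: sm prd PF)
  then show ?thesis
    unfolding cre_def using c2 by (intro exI[of _ "\<lambda>q. sm (b (pfst q)) (psnd q) (pfst q)"]) auto
qed

text \<open>Since \<open>f\<close> is total, the search for a value together with a confirming stage
  succeeds on every input, as regular minimisation demands; whatever pair is found carries the right
  value because a graph is single-valued.\<close>

lemma computable_if_cre_graph:
  assumes "cre (\<lambda>p. psnd p = f (pfst p))"
  shows "computable f"
proof -
  obtain F where F: "computable F"
    "\<And>p. psnd p = f (pfst p) \<longleftrightarrow> (\<exists>n. F (prod_encode (p, n)) = 0)"
    using assms unfolding cre_def by blast
  have *: "y = f x \<longleftrightarrow> (\<exists>n. F (prod_encode (prod_encode (x, y), n)) = 0)" for x y
    using F(2)[of "prod_encode (x, y)"] by simp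
  define G where "G q = F (prod_encode (prod_encode (psnd q, pfst (pfst q)), psnd (pfst q)))" for q
  have G: "computable G"
    unfolding G_def by (intro computable_comp[OF F(1)] computable_intros)
  have ex: "\<exists>n. G (prod_encode (n, x)) = 0" for x
  proof -
    obtain n where "F (prod_encode (prod_encode (x, f x), n)) = 0" using * by blast
    then have "G (prod_encode (prod_encode (f x, n), x)) = 0" by (simp add: G_def)
    then show ?thesis by blast
  qed
  have "pfst (LEAST n. G (prod_encode (n, x)) = 0) = f x" for x
    unfolding * using LeastI_ex[OF ex[of x]] by (auto simp: G_def)
  then have "f = (\<lambda>x. pfst (LEAST n. G (prod_encode (n, x)) = 0))" by auto
  then show ?thesis
    using computable_pfst[OF computable_Least[OF G ex]] by simp
qed

section \<open>Computability on encoded types\<close>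

definition lhd :: "nat \<Rightarrow> nat" where "lhd n = pfst (n - 1)"
text \<open>The code 0 is the empty list, and \<open>psnd (0 - 1) = 0\<close> by truncated
  subtraction, so dropping past the end stays at the empty list, as for \<open>drop\<close>.\<close>

definition ldrop :: "nat \<Rightarrow> nat \<Rightarrow> nat" where "ldrop i n = rec_nat n (\<lambda>_ r. psnd (r - 1)) i"

lemma ldrop_list_encode [simp]: "ldrop i (list_encode xs) = list_encode (drop i xs)"
proof (induction i)
  case (Suc i)
  have "psnd (list_encode ys - 1) = list_encode (tl ys)" for ys
    using prod_decode_def prod_decode_aux.simps[of 0 0] by (cases ys) simp_all
  then show ?case
    using Suc by (simp add: ldrop_def drop_Suc tl_drop)
qed (simp add: ldrop_def)

lemma computable_lhd: "computable f \<Longrightarrow> computable (\<lambda>x. lhd (f x))"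
  unfolding lhd_def by (intro computable_intros)

lemma computable_ldrop: "computable f \<Longrightarrow> computable g \<Longrightarrow> computable (\<lambda>x. ldrop (f x) (g x))"
  unfolding ldrop_def
  by (intro computable_rec_nat[where g = "\<lambda>_ r _. psnd (r - 1)"] computable_intros)

text \<open>An encoding need not be onto, because the codes fixed for concepts and assertions are
  not. The range must be r.e. in order to quantify existentially over the type, and its complement
  in order to decide sets of codes.\<close>

class enc =
  fixes enc :: "'a \<Rightarrow> nat"
  assumes enc_inject: "enc x = enc y \<Longrightarrow> x = y"
    and cre_range: "cre (\<lambda>n. n \<in> range enc)"
    and cre_not_range: "cre (\<lambda>n. n \<notin> range enc)"

abbreviation codes :: "'a::enc itself \<Rightarrow> nat set" where
  "codes _ \<equiv> range (enc :: 'a \<Rightarrow> nat)"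

lemma enc_eq_iff [simp]: "enc x = enc y \<longleftrightarrow> x = y"
  using enc_inject by auto

lemma cre_True: "cre (\<lambda>n. True)" and cre_False: "cre (\<lambda>n. False)"
  using cre_eq[OF computable_const[of 0] computable_const[of 0]]
    cre_eq[OF computable_const[of 0] computable_const[of 1]] by auto

instantiation nat :: enc
begin
definition enc_nat :: "nat \<Rightarrow> nat" where "enc_nat n = n"
instance by standard (auto simp: enc_nat_def cre_True cre_False)
end

instantiation bool :: enc
begin
definition enc_bool :: "bool \<Rightarrow> nat" where "enc_bool b = (if b then 1 else 0)"
instance
proof
  let ?R = "range (enc :: bool \<Rightarrow> nat)"
  have r: "n \<in> ?R \<longleftrightarrow> n < 2" for n
    by (auto simp: enc_bool_def image_iff less_2_cases_iff intro: exI[of _ "n = 1"])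
  show "cre (\<lambda>n. n \<in> ?R)"
    unfolding r by (intro cre_less computable_intros)
  show "cre (\<lambda>n. n \<notin> ?R)"
    unfolding r not_less less_Suc_eq_le[symmetric] by (intro cre_less computable_intros)
qed (auto simp: enc_bool_def split: if_splits)
end

instantiation prod :: (enc, enc) enc
begin
definition enc_prod :: "'a \<times> 'b \<Rightarrow> nat" where "enc_prod p = prod_encode (enc (fst p), enc (snd p))"
instance
proof
  let ?R = "range (enc :: 'a \<times> 'b \<Rightarrow> nat)"
  have r: "n \<in> ?R \<longleftrightarrow>
      pfst n \<in> codes TYPE('a) \<and> psnd n \<in> codes TYPE('b)" for n
    by (auto simp: enc_prod_def image_iff) (metis prod_decode_inverse surjective_pairing)
  show "cre (\<lambda>n. n \<in> ?R)"
    unfolding r by (intro cre_conj cre_subst[OF cre_range] computable_intros)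
  show "cre (\<lambda>n. n \<notin> ?R)"
    unfolding r de_Morgan_conj by (intro cre_disj cre_subst[OF cre_not_range] computable_intros)
qed (auto simp: enc_prod_def prod_eq_iff)
end

instantiation list :: (enc) enc
begin
definition enc_list :: "'a list \<Rightarrow> nat" where "enc_list xs = list_encode (map enc xs)"
instance
proof
  let ?R = "range (enc :: 'a list \<Rightarrow> nat)"
  \<comment> \<open>The code itself bounds the number of positions to inspect; positions beyond the
    end satisfy \<open>ldrop i n = 0\<close>, so letting \<open>i\<close> run up to \<open>n\<close>
    does no harm.\<close>
  have len: "length xs \<le> list_encode xs" for xs
    by (induction xs) (auto intro: order_trans[OF _ le_prod_encode_2])
  have r: "n \<in> ?R \<longleftrightarrow>
      (\<forall>i<n. ldrop i n = 0 \<or> lhd (ldrop i n) \<in> codes TYPE('a))" (is "_ \<longleftrightarrow> ?Q n") for n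
  proof -
    obtain xs where n: "n = list_encode xs" by (metis list_decode_inverse)
    have nth: "xs ! i \<in> codes TYPE('a) \<longleftrightarrow> (ldrop i n = 0 \<or> lhd (ldrop i n) \<in> codes TYPE('a))"
      if "i < length xs" for i
    proof -
      have "ldrop i n = list_encode (xs ! i # drop (Suc i) xs)"
        by (simp only: n ldrop_list_encode Cons_nth_drop_Suc[OF that])
      then have "ldrop i n \<noteq> 0" "lhd (ldrop i n) = xs ! i"
        by (simp_all add: lhd_def)
      then show ?thesis by simp
    qed
    have "n \<in> ?R \<longleftrightarrow> set xs \<subseteq> codes TYPE('a)"
      using ex_map_conv[of xs "enc :: 'a \<Rightarrow> nat"]
      by (auto simp: n enc_list_def image_iff list_encode_eq subset_iff)
    also have "\<dots> \<longleftrightarrow> (\<forall>i<length xs. xs ! i \<in> codes TYPE('a))"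
      by (simp only: set_conv_nth) blast
    also have "\<dots> \<longleftrightarrow> (\<forall>i<length xs. ldrop i n = 0 \<or> lhd (ldrop i n) \<in> codes TYPE('a))"
      by (simp only: nth cong: imp_cong)
    also have "\<dots> \<longleftrightarrow> ?Q n"
    proof
      assume *: "\<forall>i<length xs. ldrop i n = 0 \<or> lhd (ldrop i n) \<in> codes TYPE('a)"
      show "?Q n"
      proof (intro allI impI)
        fix i show "ldrop i n = 0 \<or> lhd (ldrop i n) \<in> codes TYPE('a)"
          using * by (cases "i < length xs") (auto simp: n)
      qed
    qed (use len[of xs] n in \<open>meson less_le_trans\<close>)
    finally show ?thesis .
  qed
  show "cre (\<lambda>n. n \<in> ?R)"
    unfolding r
    by (intro cre_all_less cre_disj cre_eq cre_subst[OF cre_range] computable_lhd computable_ldrop computable_intros)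
  have "n \<notin> ?R \<longleftrightarrow>
      (\<exists>i. i < n \<and> 0 < ldrop i n \<and> lhd (ldrop i n) \<notin> codes TYPE('a))" for n
    unfolding r by auto
  then show "cre (\<lambda>n. n \<notin> ?R)"
    by (simp only:) (intro cre_ex cre_conj cre_less cre_subst[OF cre_not_range] computable_lhd computable_ldrop computable_intros)
  show "xs = ys" if "enc xs = enc ys" for xs ys :: "'a list"
    using that inj_map_eq_map[OF injI[of enc, OF enc_inject]] by (auto simp: enc_list_def list_encode_eq)
qed
end

text \<open>
  Nothing is required of \<open>W\<close> outside the range of the encoding. Functions are taken to be computable
  when their graph is r.e., so that all closure properties of functions reduce to those of predicates.
\<close>

definition re :: "('a::enc \<Rightarrow> bool) \<Rightarrow> bool" where
  "re P \<longleftrightarrow> (\<exists>W. cre W \<and> (\<forall>x. P x \<longleftrightarrow> W (enc x)))"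

definition compf :: "('a::enc \<Rightarrow> 'b::enc) \<Rightarrow> bool" where
  "compf f \<longleftrightarrow> re (\<lambda>p. snd p = f (fst p))"

section \<open>Closure properties of r.e. predicates and computable functions on encoded
  types\<close>

lemma re_subst_code:
  assumes "re P" "computable F" "\<And>x. enc (f x) = F (enc x)"
  shows "re (\<lambda>x. P (f x))"
proof -
  obtain W where W: "cre W" "\<And>x. P x \<longleftrightarrow> W (enc x)"
    using assms(1) unfolding re_def by blast
  show ?thesis
    unfolding re_def using cre_subst[OF W(1) assms(2)] W(2) assms(3)
    by (intro exI[of _ "\<lambda>n. W (F n)"]) auto
qed

lemma re_conj: "re P \<Longrightarrow> re Q \<Longrightarrow> re (\<lambda>x. P x \<and> Q x)"
  unfolding re_def by (metis (no_types, lifting) cre_conj)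

lemma re_disj: "re P \<Longrightarrow> re Q \<Longrightarrow> re (\<lambda>x. P x \<or> Q x)"
  unfolding re_def by (metis (no_types, lifting) cre_disj)

text \<open>The witness is searched among numbers, so the search must be confined to codes; this is
  the use of \<open>cre_range\<close>.\<close>

lemma re_ex:
  fixes P :: "'a::enc \<Rightarrow> 'b::enc \<Rightarrow> bool"
  assumes "re (\<lambda>p. P (fst p) (snd p))"
  shows "re (\<lambda>x. \<exists>y. P x y)"
proof -
  obtain W where W: "cre W" "\<And>p. P (fst p) (snd p) \<longleftrightarrow> W (enc p)"
    using assms(1) unfolding re_def by blast
  have "P x y \<longleftrightarrow> W (prod_encode (enc x, enc y))" for x y
    using W(2)[of "(x, y)"] by (simp add: enc_prod_def)
  moreover have "cre (\<lambda>x. \<exists>y. y \<in> codes TYPE('b) \<and> W (prod_encode (x, y)))"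
    by (intro cre_ex cre_conj cre_subst[OF cre_range] cre_subst[OF W(1)] computable_intros)
  ultimately show ?thesis
    unfolding re_def by (intro exI[of _ "\<lambda>x. \<exists>y. y \<in> codes TYPE('b) \<and> W (prod_encode (x, y))"]) auto
qed

text \<open>Only the graph of \<open>f\<close> is available, so the value is guessed and checked
  against it.\<close>

lemma re_subst:
  assumes "re P" "compf f"
  shows "re (\<lambda>x. P (f x))"
proof -
  have "re (\<lambda>p. P (snd p))"
    using assms(1) by (rule re_subst_code[where F = psnd]) (auto simp: computable_pfst_psnd enc_prod_def)
  then have "re (\<lambda>x. \<exists>y. y = f x \<and> P y)"
    using assms(2) unfolding compf_def by (intro re_ex re_conj)
  then show ?thesis by simp
qed

lemma compfI: "computable F \<Longrightarrow> (\<And>x. enc (f x) = F (enc x)) \<Longrightarrow> compf f"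
proof -
  assume F: "computable F" and f: "\<And>x. enc (f x) = F (enc x)"
  have "snd p = f (fst p) \<longleftrightarrow> psnd (enc p) = F (pfst (enc p))" for p
    using f[symmetric] by (simp add: enc_prod_def)
  then show ?thesis
    unfolding compf_def re_def
    by (intro exI[of _ "\<lambda>n. psnd n = F (pfst n)"]) (auto intro!: cre_eq computable_comp[OF F] computable_intros computable_pfst_psnd)
qed

lemma compf_comp: "compf f \<Longrightarrow> compf g \<Longrightarrow> compf (\<lambda>x. f (g x))"
proof -
  assume f: "compf f" and g: "compf g"
  have "re (\<lambda>q. snd q = g (fst (fst q)))"
    using re_subst_code[of "\<lambda>p. snd p = g (fst p)" "\<lambda>n. prod_encode (pfst (pfst n), psnd n)" "\<lambda>q. (fst (fst q), snd q)"] g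
    by (simp add: compf_def enc_prod_def computable_intros computable_pfst_psnd)
  moreover have "re (\<lambda>q. snd (fst q) = f (snd q))"
    using re_subst_code[of "\<lambda>p. snd p = f (fst p)" "\<lambda>n. prod_encode (psnd n, psnd (pfst n))" "\<lambda>q. (snd q, snd (fst q))"] f
    by (simp add: compf_def enc_prod_def computable_intros computable_pfst_psnd)
  ultimately have "re (\<lambda>p. \<exists>z. z = g (fst p) \<and> snd p = f z)"
    by (intro re_ex re_conj)
  then show ?thesis by (simp add: compf_def)
qed

lemma compf_id: "compf (\<lambda>x. x)"
  by (rule compfI[OF computable_id]) simp

lemma compf_const: "compf (\<lambda>x. c)"
  by (rule compfI[OF computable_const[of "enc c"]]) simp

lemma compf_fst: "compf f \<Longrightarrow> compf (\<lambda>x. fst (f x))"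
  by (rule compf_comp[where f = fst], rule compfI[where F = pfst]) (auto simp: computable_pfst_psnd enc_prod_def)

lemma compf_snd: "compf f \<Longrightarrow> compf (\<lambda>x. snd (f x))"
  by (rule compf_comp[where f = snd], rule compfI[where F = psnd]) (auto simp: computable_pfst_psnd enc_prod_def)

lemma re_eq: "compf f \<Longrightarrow> compf g \<Longrightarrow> re (\<lambda>x. f x = g x)"
proof -
  assume "compf f" "compf g"
  then have "re (\<lambda>x. \<exists>y. y = f x \<and> y = g x)"
    unfolding compf_def by (intro re_ex re_conj)
  then show ?thesis by simp
qed

lemma compf_Pair: "compf f \<Longrightarrow> compf g \<Longrightarrow> compf (\<lambda>x. (f x, g x))"
proof -
  assume f: "compf f" and g: "compf g"
  have "re (\<lambda>p. fst (snd p) = f (fst p) \<and> snd (snd p) = g (fst p))"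
    by (intro re_conj re_eq compf_fst compf_snd compf_id compf_comp[OF f] compf_comp[OF g])
  moreover have "(\<lambda>p. fst (snd p) = f (fst p) \<and> snd (snd p) = g (fst p)) = (\<lambda>p. snd p = (f (fst p), g (fst p)))"
    by (auto simp: prod_eq_iff)
  ultimately show ?thesis
    unfolding compf_def by simp
qed

lemma compf_comp2:
  assumes "compf (\<lambda>p. F (fst p) (snd p))" "compf f" "compf g"
  shows "compf (\<lambda>x. F (f x) (g x))"
  using compf_comp[OF assms(1) compf_Pair[OF assms(2,3)]] by simp

lemma compf_comp3:
  assumes "compf (\<lambda>p. F (fst p) (fst (snd p)) (snd (snd p)))" "compf f" "compf g" "compf h"
  shows "compf (\<lambda>x. F (f x) (g x) (h x))"
  using compf_comp[OF assms(1) compf_Pair[OF assms(2) compf_Pair[OF assms(3,4)]]] by simp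

lemma compf_comp4:
  assumes "compf (\<lambda>p. F (fst p) (fst (snd p)) (fst (snd (snd p))) (snd (snd (snd p))))"
    "compf f" "compf g" "compf h" "compf k"
  shows "compf (\<lambda>x. F (f x) (g x) (h x) (k x))"
  using compf_comp[OF assms(1) compf_Pair[OF assms(2) compf_Pair[OF assms(3) compf_Pair[OF assms(4,5)]]]] by simp

lemma re_subst2:
  assumes "re (\<lambda>p. P (fst p) (snd p))" "compf f" "compf g"
  shows "re (\<lambda>x. P (f x) (g x))"
  using re_subst[OF assms(1) compf_Pair[OF assms(2,3)]] by simp

lemma compf2I:
  assumes "computable (\<lambda>p. F (pfst p) (psnd p))" "\<And>x y. enc (f x y) = F (enc x) (enc y)" "compf g" "compf h"
  shows "compf (\<lambda>x. f (g x) (h x))"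
  using assms(3,4)
  by (rule compf_comp2[rotated]) (rule compfI[OF assms(1)], simp add: assms(2) enc_prod_def)

lemma compf_Suc: "compf f \<Longrightarrow> compf (\<lambda>x. Suc (f x))"
  by (rule compf_comp, rule compfI[where F = Suc])
     (auto simp: enc_nat_def intro: computable_Suc computable_id)

lemma compf_add: "compf f \<Longrightarrow> compf g \<Longrightarrow> compf (\<lambda>x. f x + g x :: nat)"
  by (rule compf2I[where F = "(+)"]) (auto simp: enc_nat_def intro!: computable_intros computable_pfst_psnd)

lemma compf_prod_encode: "compf f \<Longrightarrow> compf g \<Longrightarrow> compf (\<lambda>x. prod_encode (f x, g x))"
  by (rule compf2I[where F = "\<lambda>a b. prod_encode (a, b)"]) (auto simp: enc_nat_def intro!: computable_intros computable_pfst_psnd)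

lemma compf_Cons: "compf f \<Longrightarrow> compf g \<Longrightarrow> compf (\<lambda>x. f x # g x)"
  by (rule compf2I[where F = "\<lambda>a b. Suc (prod_encode (a, b))"]) (auto simp: enc_list_def intro!: computable_intros computable_pfst_psnd)

lemma compf_drop: "compf f \<Longrightarrow> compf g \<Longrightarrow> compf (\<lambda>x. drop (f x) (g x))"
  by (rule compf2I[where F = ldrop]) (auto simp: enc_nat_def enc_list_def drop_map intro!: computable_ldrop computable_pfst_psnd)

lemma compf_enc: "compf f \<Longrightarrow> compf (\<lambda>x. enc (f x))"
  by (rule compf_comp, rule compfI[where F = "\<lambda>n. n"]) (auto simp: enc_nat_def intro: computable_id)

lemma re_all_less:
  fixes P :: "'a::enc \<Rightarrow> nat \<Rightarrow> bool"
  assumes P: "re (\<lambda>p. P (fst p) (snd p))" and b: "compf b"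
  shows "re (\<lambda>x. \<forall>i<b x. P x i)"
proof -
  obtain W where W: "cre W" "\<And>p. P (fst p) (snd p) \<longleftrightarrow> W (enc p)"
    using P unfolding re_def by blast
  have W': "P x y \<longleftrightarrow> W (prod_encode (enc x, y))" for x y
    using W(2)[of "(x, y)"] by (simp add: enc_prod_def enc_nat_def)
  have "cre (\<lambda>q. \<forall>i<psnd q. W (prod_encode (pfst q, i)))"
    by (intro cre_all_less cre_subst[OF W(1)] computable_intros)
  then have "re (\<lambda>p. \<forall>i<snd p. P (fst p) i)"
    unfolding re_def
    by (intro exI[of _ "\<lambda>q. \<forall>i<psnd q. W (prod_encode (pfst q, i))"]) (simp add: W' enc_prod_def enc_nat_def)
  from re_subst2[OF this compf_id b] show ?thesis .
qed

lemma re_mem: "compf f \<Longrightarrow> compf l \<Longrightarrow> re (\<lambda>x. f x \<in> set (l x))"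
proof -
  assume f: "compf f" and l: "compf l"
  have eq: "y \<in> set xs \<longleftrightarrow> (\<exists>i s. drop i xs = y # s)" for y :: 'b and xs
    by (metis Cons_nth_drop_Suc in_set_conv_nth in_set_dropD list.set_intros(1))
  show ?thesis
    unfolding eq
    by (intro re_ex re_eq compf_drop compf_Cons compf_fst compf_snd compf_id compf_comp[OF f] compf_comp[OF l])
qed

lemma re_ball:
  assumes P: "re (\<lambda>p. P (fst p) (snd p))" and l: "compf l"
  shows "re (\<lambda>x. \<forall>y\<in>set (l x). P x y)"
proof -
  \<comment> \<open>The two conditions force \<open>n = length xs\<close>; the list is traversed
    without presupposing that \<open>length\<close> is computable.\<close>
  have eq: "(\<forall>y\<in>set xs. Q y) \<longleftrightarrow> (\<exists>n. drop n xs = [] \<and> (\<forall>i<n. \<exists>y s. drop i xs = y # s \<and> Q y))" for Q and xs :: "'b list"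
  proof
    assume "\<forall>y\<in>set xs. Q y"
    then show "\<exists>n. drop n xs = [] \<and> (\<forall>i<n. \<exists>y s. drop i xs = y # s \<and> Q y)"
      by (intro exI[of _ "length xs"]) (auto simp: Cons_nth_drop_Suc[symmetric])
  next
    assume "\<exists>n. drop n xs = [] \<and> (\<forall>i<n. \<exists>y s. drop i xs = y # s \<and> Q y)"
    then obtain n where n: "length xs \<le> n" "\<And>i. i < n \<Longrightarrow> \<exists>y s. drop i xs = y # s \<and> Q y" by auto
    show "\<forall>y\<in>set xs. Q y"
    proof
      fix y assume "y \<in> set xs"
      then obtain i where i: "i < length xs" "y = xs ! i" by (metis in_set_conv_nth)
      then show "Q y"
        using n(2)[of i] n(1) by (auto simp: Cons_nth_drop_Suc[symmetric])
    qed
  qed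
  show ?thesis
    unfolding eq
    by (intro re_ex re_conj re_eq re_all_less compf_drop compf_Cons compf_fst compf_snd compf_id compf_const
        compf_comp[OF l] re_subst2[OF P])
qed

text \<open>\<open>R x ps\<close> reads: \<open>x\<close> follows from the premises
  \<open>ps\<close>. The least fixed point of an r.e. rule relation with finite premise lists is
  again r.e. Recursors, recursive functions on concepts and both verdicts of the tableau are all
  obtained as instances.\<close>

inductive deriv :: "('a \<Rightarrow> 'a list \<Rightarrow> bool) \<Rightarrow> 'a \<Rightarrow> bool" for R where
  derivI: "R x ps \<Longrightarrow> \<forall>p\<in>set ps. deriv R p \<Longrightarrow> deriv R x"

text \<open>A derivation is a list in which each entry follows from entries further to the right.\<close>

lemma re_deriv:
  assumes R: "re (\<lambda>p. R (fst p) (snd p))"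
  shows "re (deriv R)"
proof -
  define J where "J l \<longleftrightarrow> (\<exists>n. drop n l = [] \<and> (\<forall>i<n. \<exists>y s. drop i l = y # s \<and> (\<exists>ps. R y ps \<and> (\<forall>p\<in>set ps. p \<in> set s))))" for l
  have Nil: "J []" unfolding J_def by (intro exI[of _ 0]) auto
  have Cons: "J (y # s) \<longleftrightarrow> (\<exists>ps. R y ps \<and> (\<forall>p\<in>set ps. p \<in> set s)) \<and> J s" for y s
  proof
    assume "J (y # s)"
    then obtain n where n: "drop n (y # s) = []" "\<And>i. i < n \<Longrightarrow> \<exists>z t. drop i (y # s) = z # t \<and> (\<exists>ps. R z ps \<and> (\<forall>p\<in>set ps. p \<in> set t))"
      unfolding J_def by blast
    from n(1) obtain m where m: "n = Suc m" by (cases n) auto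
    show "(\<exists>ps. R y ps \<and> (\<forall>p\<in>set ps. p \<in> set s)) \<and> J s"
    proof
      show "\<exists>ps. R y ps \<and> (\<forall>p\<in>set ps. p \<in> set s)" using n(2)[of 0] m by auto
      show "J s" unfolding J_def using n(1) n(2)[of "Suc _"] m by (intro exI[of _ m]) auto
    qed
  next
    assume *: "(\<exists>ps. R y ps \<and> (\<forall>p\<in>set ps. p \<in> set s)) \<and> J s"
    then obtain n where "drop n s = []" "\<forall>i<n. \<exists>z t. drop i s = z # t \<and> (\<exists>ps. R z ps \<and> (\<forall>p\<in>set ps. p \<in> set t))"
      unfolding J_def by blast
    with * show "J (y # s)" unfolding J_def
      by (intro exI[of _ "Suc n"]) (auto simp: All_less_Suc2 drop_Cons')
  qed
  have app: "J (l @ l')" if "J l" "J l'" for l l'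
    using that by (induction l) (auto simp: Cons)
  have sound: "\<forall>x\<in>set l. deriv R x" if "J l" for l
    using that by (induction l) (auto simp: Cons intro: derivI)
  have "\<exists>l. J l \<and> x \<in> set l" if "deriv R x" for x
    using that
  proof induction
    case (derivI x ps)
    \<comment> \<open>The derivations of the finitely many premises are concatenated: each entry
      refers only to entries on its right, which remain there.\<close>
    have "\<exists>l. J l \<and> set qs \<subseteq> set l" if "set qs \<subseteq> set ps" for qs
      using that
    proof (induction qs)
      case (Cons q qs)
      then obtain l l' where "J l" "set qs \<subseteq> set l" "J l'" "q \<in> set l'"
        using derivI(2) by auto
      then show ?case by (intro exI[of _ "l @ l'"]) (auto intro: app)
    qed (auto intro: Nil)
    then obtain l where "J l" "set ps \<subseteq> set l" by blast
    then have "J (x # l)" using derivI(1) by (auto simp: Cons)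
    then show ?case by (intro exI[of _ "x # l"]) auto
  qed
  with sound have eq: "deriv R = (\<lambda>x. \<exists>l. J l \<and> x \<in> set l)" by (auto simp: fun_eq_iff)
  show ?thesis
    unfolding eq J_def
    by (intro re_ex re_conj re_eq re_all_less re_ball re_mem re_subst2[OF R] compf_drop compf_Cons compf_fst
        compf_snd compf_id compf_const)
qed

section \<open>Decidable predicates and recursors\<close>

lemma re_bool: "compf P \<Longrightarrow> re (\<lambda>x. P x)"
  using re_eq[of P "\<lambda>x. True"] compf_const by auto

lemma re_not_bool: "compf P \<Longrightarrow> re (\<lambda>x. \<not> P x)"
  using re_eq[of P "\<lambda>x. False"] compf_const by auto

text \<open>Post's theorem: the two possible values split the graph into two r.e. pieces.\<close>

lemma compf_boolI: "re P \<Longrightarrow> re (\<lambda>x. \<not> P x) \<Longrightarrow> compf P"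
proof -
  assume P: "re P" and nP: "re (\<lambda>x. \<not> P x)"
  have eq: "(b = P x) \<longleftrightarrow> (b = True \<and> P x) \<or> (b = False \<and> \<not> P x)" for b x by auto
  show ?thesis
    unfolding compf_def eq
    by (intro re_disj re_conj re_eq compf_snd compf_fst compf_id compf_const re_subst[OF P] re_subst[OF nP])
qed

lemma compf_conj: "compf P \<Longrightarrow> compf Q \<Longrightarrow> compf (\<lambda>x. P x \<and> Q x)"
  by (rule compf_boolI) (unfold de_Morgan_conj, (intro re_conj re_disj re_bool re_not_bool; assumption)+)

lemma compf_disj: "compf P \<Longrightarrow> compf Q \<Longrightarrow> compf (\<lambda>x. P x \<or> Q x)"
  by (rule compf_boolI) (unfold de_Morgan_disj, (intro re_conj re_disj re_bool re_not_bool; assumption)+)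

lemma compf_not: "compf P \<Longrightarrow> compf (\<lambda>x. \<not> P x)"
  by (rule compf_boolI) (auto intro: re_bool re_not_bool)

lemma compf_less: "compf f \<Longrightarrow> compf g \<Longrightarrow> compf (\<lambda>x. f x < (g x :: nat))"
proof -
  have "re (\<lambda>p. fst p < (snd p :: nat))"
    unfolding re_def by (intro exI[of _ "\<lambda>n. pfst n < psnd n"])
      (auto simp: enc_prod_def enc_nat_def intro: cre_less computable_pfst_psnd)
  moreover have "re (\<lambda>p. \<not> fst p < (snd p :: nat))"
    unfolding re_def not_less less_Suc_eq_le[symmetric] by (intro exI[of _ "\<lambda>n. psnd n < Suc (pfst n)"])
      (simp add: enc_prod_def enc_nat_def cre_less computable_pfst_psnd computable_Suc)
  ultimately show "compf f \<Longrightarrow> compf g \<Longrightarrow> compf (\<lambda>x. f x < (g x :: nat))"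
    by (rule compf_comp2[where F = "(<)", OF compf_boolI])
qed

text \<open>Distinct values have distinct codes, and one of the two codes is smaller; this makes
  inequality r.e. on every encoded type.\<close>

lemma compf_eq: "compf f \<Longrightarrow> compf g \<Longrightarrow> compf (\<lambda>x. f x = g x)"
proof (rule compf_boolI[OF re_eq])
  assume f: "compf f" and g: "compf g"
  have "re (\<lambda>x. enc (f x) < enc (g x) \<or> enc (g x) < enc (f x))"
    by (intro re_disj re_bool compf_less compf_enc f g)
  then show "re (\<lambda>x. f x \<noteq> g x)"
    by (simp flip: linorder_neq_iff)
qed

lemma compf_if: "compf P \<Longrightarrow> compf f \<Longrightarrow> compf g \<Longrightarrow> compf (\<lambda>x. if P x then f x else g x)"
proof -
  assume P: "compf P" and f: "compf f" and g: "compf g"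
  have eq: "(y = (if P x then f x else g x)) \<longleftrightarrow> (P x \<and> y = f x) \<or> (\<not> P x \<and> y = g x)" for x y by auto
  show ?thesis
    unfolding compf_def eq
    by (intro re_disj re_conj re_bool re_not_bool re_eq compf_comp[OF P] compf_comp[OF f] compf_comp[OF g]
        compf_fst compf_snd compf_id)
qed

text \<open>The graph of the recursor is generated by rules with at most one premise. The parameter
  \<open>x\<close> is part of the derived triple because the rules themselves are fixed. Values may
  lie in any encoded type, so this also covers programs that return lists of lists.\<close>

lemma compf_rec_list:
  assumes a: "compf a"
    and g: "compf (\<lambda>p. g (fst p) (fst (snd p)) (fst (snd (snd p))) (snd (snd (snd p))))"
    and l: "compf l"
  shows "compf (\<lambda>x. rec_list (a x) (\<lambda>y ys r. g x y ys r) (l x))"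
proof -
  define R where "R = (\<lambda>t ps. (fst (snd t) = [] \<and> snd (snd t) = a (fst t)) \<or>
     (\<exists>y ys r. fst (snd t) = y # ys \<and> snd (snd t) = g (fst t) y ys r \<and> ps = [(fst t, ys, r)]))"
  have R: "re (\<lambda>p. R (fst p) (snd p))"
    unfolding R_def
    by (intro re_disj re_conj re_ex re_eq compf_comp[OF a] compf_comp4[OF g] compf_Pair compf_Cons compf_fst compf_snd
        compf_id compf_const)
  have 1: "snd (snd t) = rec_list (a (fst t)) (g (fst t)) (fst (snd t))" if "deriv R t" for t
    using that by induction (auto simp: R_def)
  have 2: "deriv R (x, xs, rec_list (a x) (g x) xs)" for x xs
  proof (induction xs)
    case Nil show ?case by (rule derivI[of _ _ "[]"]) (auto simp: R_def)
  next
    case (Cons y ys)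
    then show ?case by (intro derivI[of _ _ "[(x, ys, rec_list (a x) (g x) ys)]"]) (auto simp: R_def)
  qed
  have eq: "(y = rec_list (a x) (g x) (l x)) \<longleftrightarrow> deriv R (x, l x, y)" for x y
    using 1[of "(x, l x, y)"] 2[of x "l x"] by auto
  show ?thesis
    unfolding compf_def eq
    by (intro re_subst[OF re_deriv[OF R]] compf_Pair compf_comp[OF l] compf_fst compf_snd compf_id)
qed

lemma compf_rec_nat:
  assumes a: "compf a"
    and g: "compf (\<lambda>p. g (fst p) (fst (snd p)) (snd (snd p)))"
    and l: "compf l"
  shows "compf (\<lambda>x. rec_nat (a x) (\<lambda>y r. g x y r) (l x))"
proof -
  define R where "R = (\<lambda>t ps. (fst (snd t) = 0 \<and> snd (snd t) = a (fst t)) \<or>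
     (\<exists>y r. fst (snd t) = Suc y \<and> snd (snd t) = g (fst t) y r \<and> ps = [(fst t, y, r)]))"
  have R: "re (\<lambda>p. R (fst p) (snd p))"
    unfolding R_def
    by (intro re_disj re_conj re_ex re_eq compf_comp[OF a] compf_comp3[OF g] compf_Pair compf_Cons compf_Suc compf_fst compf_snd
        compf_id compf_const)
  have 1: "snd (snd t) = rec_nat (a (fst t)) (g (fst t)) (fst (snd t))" if "deriv R t" for t
    using that by induction (auto simp: R_def)
  have 2: "deriv R (x, n, rec_nat (a x) (g x) n)" for x n
  proof (induction n)
    case 0 show ?case by (rule derivI[of _ _ "[]"]) (auto simp: R_def)
  next
    case (Suc n)
    then show ?case by (intro derivI[of _ _ "[(x, n, rec_nat (a x) (g x) n)]"]) (auto simp: R_def)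
  qed
  have eq: "(y = rec_nat (a x) (g x) (l x)) \<longleftrightarrow> deriv R (x, l x, y)" for x y
    using 1[of "(x, l x, y)"] 2[of x "l x"] by auto
  show ?thesis
    unfolding compf_def eq
    by (intro re_subst[OF re_deriv[OF R]] compf_Pair compf_comp[OF l] compf_fst compf_snd compf_id)
qed

lemma computable_if_compf: "compf f \<Longrightarrow> computable f"
proof -
  assume "compf f"
  then obtain W where W: "cre W" "\<And>p. snd p = f (fst p) \<longleftrightarrow> W (enc p)"
    unfolding compf_def re_def by blast
  have "W = (\<lambda>n. psnd n = f (pfst n))"
    using W(2)[of "prod_decode _"] by (simp add: enc_prod_def enc_nat_def fun_eq_iff)
  then show ?thesis
    using W(1) by (intro computable_if_cre_graph) simp
qed

lemma decidableI: "re (\<lambda>n. n \<in> S) \<Longrightarrow> re (\<lambda>n. n \<notin> S) \<Longrightarrow> decidable S"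
  unfolding decidable_def
  by (intro computable_if_compf compf_if compf_boolI compf_const)

lemma re_range: "compf f \<Longrightarrow> re (\<lambda>x. f x \<in> codes TYPE('b::enc))"
  and re_not_range: "compf f \<Longrightarrow> re (\<lambda>x. f x \<notin> codes TYPE('b::enc))"
proof -
  have *: "re (\<lambda>n. n \<in> codes TYPE('b))" "re (\<lambda>n. n \<notin> codes TYPE('b))"
    unfolding re_def enc_nat_def
    using cre_range[where 'a = 'b] cre_not_range[where 'a = 'b] by blast+
  show "compf f \<Longrightarrow> re (\<lambda>x. f x \<in> codes TYPE('b))"
    by (rule re_subst[OF *(1)])
  show "compf f \<Longrightarrow> re (\<lambda>x. f x \<notin> codes TYPE('b))"
    by (rule re_subst[OF *(2)])
qed

text \<open>The complement has two sources: numbers that code nothing, and codes of elements outside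
  \<open>P\<close>. Injectivity of \<open>enc\<close> keeps the latter apart from the image.\<close>

lemma decidable_enc_image:
  fixes P :: "'a::enc \<Rightarrow> bool"
  assumes P: "compf P"
  shows "decidable (enc ` {x. P x})"
proof (rule decidableI)
  have 1: "n \<in> enc ` {x. P x} \<longleftrightarrow> (\<exists>x. n = enc x \<and> P x)"
    and 2: "n \<notin> enc ` {x. P x} \<longleftrightarrow> n \<notin> codes TYPE('a) \<or> (\<exists>x. n = enc x \<and> \<not> P x)" for n
    by (auto simp: image_iff)
  show "re (\<lambda>n. n \<in> enc ` {x. P x})"
    unfolding 1 by (intro re_ex re_conj re_eq re_bool compf_comp[OF P] compf_enc compf_fst compf_snd compf_id)
  show "re (\<lambda>n. n \<notin> enc ` {x. P x})"
    unfolding 2 by (intro re_disj re_not_range re_ex re_conj re_eq re_not_bool compf_comp[OF P] compf_enc compf_fst compf_snd compf_id)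
qed

subsection \<open>List programs\<close>

named_theorems compf_intro

declare compf_const [compf_intro] compf_id [compf_intro] compf_fst [compf_intro] compf_snd [compf_intro]
  compf_Pair [compf_intro] compf_Suc [compf_intro] compf_add [compf_intro] compf_prod_encode [compf_intro]
  compf_Cons [compf_intro] compf_drop [compf_intro] compf_enc [compf_intro] compf_conj [compf_intro]
  compf_disj [compf_intro] compf_not [compf_intro] compf_less [compf_intro] compf_eq [compf_intro]
  compf_if [compf_intro] compf_rec_list [compf_intro] compf_rec_nat [compf_intro]

text \<open>The pattern for the list functions that follow: rewrite with a recursor and leave the
  rest to the recursor lemmas. A function argument is taken together with the parameter
  \<open>x\<close>, as a computable function of the pair.\<close>

lemma compf_append [compf_intro]:
  assumes "compf f" "compf g"
  shows "compf (\<lambda>x. f x @ g x)"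
proof -
  have eq: "xs @ ys = rec_list ys (\<lambda>z zs r. z # r) xs" for xs ys :: "'b list"
    by (induction xs) auto
  show ?thesis
    unfolding eq by (intro compf_intro assms)
qed

lemma compf_map [compf_intro]:
  assumes "compf (\<lambda>p. h (fst p) (snd p))" "compf l"
  shows "compf (\<lambda>x. map (\<lambda>y. h x y) (l x))"
proof -
  have eq: "map f xs = rec_list [] (\<lambda>z zs r. f z # r) xs" for f :: "'b \<Rightarrow> 'c" and xs
    by (induction xs) auto
  show ?thesis
    unfolding eq by (intro compf_intro compf_comp2[OF assms(1)] assms(2))
qed

lemma compf_concat [compf_intro]:
  assumes "compf l"
  shows "compf (\<lambda>x. concat (l x))"
proof -
  have eq: "concat xs = rec_list [] (\<lambda>z zs r. z @ r) xs" for xs :: "'b list list"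
    by (induction xs) auto
  show ?thesis
    unfolding eq by (intro compf_intro assms)
qed

lemma compf_filter [compf_intro]:
  assumes "compf (\<lambda>p. h (fst p) (snd p))" "compf l"
  shows "compf (\<lambda>x. filter (\<lambda>y. h x y) (l x))"
proof -
  have eq: "filter f xs = rec_list [] (\<lambda>z zs r. if f z then z # r else r) xs" for f :: "'b \<Rightarrow> bool" and xs
    by (induction xs) auto
  show ?thesis
    unfolding eq by (intro compf_intro compf_comp2[OF assms(1)] assms(2))
qed

lemma compf_bex [compf_intro]:
  assumes "compf (\<lambda>p. h (fst p) (snd p))" "compf l"
  shows "compf (\<lambda>x. \<exists>y\<in>set (l x). h x y)"
proof -
  have eq: "(\<exists>y\<in>set xs. f y) = rec_list False (\<lambda>z zs r. f z \<or> r) xs" for f :: "'b \<Rightarrow> bool" and xs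
    by (induction xs) auto
  show ?thesis
    unfolding eq by (intro compf_intro compf_comp2[OF assms(1)] assms(2))
qed

lemma compf_ball [compf_intro]:
  assumes "compf (\<lambda>p. h (fst p) (snd p))" "compf l"
  shows "compf (\<lambda>x. \<forall>y\<in>set (l x). h x y)"
proof -
  have eq: "(\<forall>y\<in>set xs. f y) = rec_list True (\<lambda>z zs r. f z \<and> r) xs" for f :: "'b \<Rightarrow> bool" and xs
    by (induction xs) auto
  show ?thesis
    unfolding eq by (intro compf_intro compf_comp2[OF assms(1)] assms(2))
qed

lemma compf_mem [compf_intro]: "compf f \<Longrightarrow> compf l \<Longrightarrow> compf (\<lambda>x. f x \<in> set (l x))"
proof -
  assume f: "compf f" and l: "compf l"
  have "compf (\<lambda>x. \<exists>z\<in>set (l x). f x = z)"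
    by (intro compf_intro compf_comp[OF f] l)
  then show ?thesis by simp
qed

lemma compf_length [compf_intro]:
  assumes "compf l"
  shows "compf (\<lambda>x. length (l x))"
proof -
  have eq: "length xs = rec_list 0 (\<lambda>z zs r. Suc r) xs" for xs :: "'b list"
    by (induction xs) auto
  show ?thesis
    unfolding eq by (intro compf_intro assms)
qed

lemma compf_upt [compf_intro]:
  assumes "compf f"
  shows "compf (\<lambda>x. [0..<f x])"
proof -
  have eq: "[0..<n] = rec_nat [] (\<lambda>m r. r @ [m]) n" for n
    by (induction n) auto
  show ?thesis
    unfolding eq by (intro compf_intro assms)
qed

lemma compf_remdups [compf_intro]:
  assumes "compf l"
  shows "compf (\<lambda>x. remdups (l x))"
proof -
  have eq: "remdups xs = rec_list [] (\<lambda>z zs r. if z \<in> set zs then r else z # r) xs" for xs :: "'b list"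
    by (induction xs) auto
  show ?thesis
    unfolding eq by (intro compf_intro assms)
qed

lemma compf_subseqs [compf_intro]:
  assumes "compf l"
  shows "compf (\<lambda>x. subseqs (l x))"
proof -
  have eq: "subseqs xs = rec_list [[]] (\<lambda>z zs r. map (\<lambda>ys. z # ys) r @ r) xs" for xs :: "'b list"
    by (induction xs) (auto simp: Let_def)
  show ?thesis
    unfolding eq by (intro compf_intro assms)
qed

lemma compf_n_lists [compf_intro]: "compf n \<Longrightarrow> compf l \<Longrightarrow> compf (\<lambda>x. List.n_lists (n x) (l x))"
proof -
  assume n: "compf n" and l: "compf l"
  have eq: "List.n_lists k xs = rec_nat [[]] (\<lambda>m r. concat (map (\<lambda>ys. map (\<lambda>y. y # ys) xs) r)) k" for k and xs :: "'b list"
    by (induction k) auto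
  show ?thesis
    unfolding eq by (intro compf_intro n compf_comp[OF l])
qed

lemma compf_power2 [compf_intro]:
  assumes "compf f"
  shows "compf (\<lambda>x. 2 ^ f x :: nat)"
proof -
  have eq: "2 ^ n = rec_nat (1::nat) (\<lambda>m r. r + r) n" for n
    by (induction n) auto
  show ?thesis
    unfolding eq by (intro compf_intro assms)
qed

text \<open>\<open>set_encode\<close> sums \<open>2 ^ y\<close> over a set. An entry that occurs
  again later is skipped, so that every element contributes once.\<close>

definition set_code :: "nat list \<Rightarrow> nat" where
  "set_code xs = rec_list 0 (\<lambda>y ys r. if y \<in> set ys then r else 2 ^ y + r) xs"

lemma set_code: "set_code xs = set_encode (set xs)"
  by (induction xs) (auto simp: set_code_def insert_absorb)

lemma compf_set_encode [compf_intro]: "compf l \<Longrightarrow> compf (\<lambda>x. set_encode (set (l x)))"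
  unfolding set_code[symmetric] set_code_def by (intro compf_intro)

lemma compf_prod_decode [compf_intro]: "compf f \<Longrightarrow> compf (\<lambda>x. prod_decode (f x))"
  by (rule compf_comp, rule compfI[of "\<lambda>n. n"]) (auto simp: enc_prod_def enc_nat_def intro: computable_id)

subsection \<open>Encoding of concepts and assertions\<close>

lemma enc_crole: "enc RR = code_crole RR"
proof -
  have "enc ch = list_encode ch" for ch :: "nat list"
    by (simp add: enc_list_def enc_nat_def[abs_def])
  then have "enc S = list_encode (map list_encode S)" for S :: "nat list list"
    by (auto simp: enc_list_def[of S] intro!: arg_cong[where f = list_encode])
  then show ?thesis by (auto simp: enc_list_def[of RR] code_crole_def intro!: arg_cong[where f = list_encode])
qed

text \<open>The coding read backwards: whether \<open>n\<close> is a code depends on its tag and its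
  components. This turns into rules for codes and, negated, into rules for non-codes.\<close>

lemma code_concept_range:
  "n \<in> range code_concept \<longleftrightarrow>
     (pfst n < 2 \<and> psnd n = 0) \<or> pfst n = 2 \<or> (pfst n = 3 \<and> psnd n \<in> range code_concept) \<or>
     ((pfst n = 4 \<or> pfst n = 5) \<and> pfst (psnd n) \<in> range code_concept \<and> psnd (psnd n) \<in> range code_concept) \<or>
     ((pfst n = 6 \<or> pfst n = 7) \<and> psnd (psnd n) \<in> range code_concept) \<or>
     ((pfst n = 8 \<or> pfst n = 9) \<and> pfst (psnd (psnd n)) \<in> codes TYPE(crole) \<and>
        psnd (psnd (psnd n)) \<in> range code_concept)" (is "_ \<longleftrightarrow> ?Q n")
proof
  assume "n \<in> range code_concept"
  then obtain C where "n = code_concept C" by auto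
  then show "?Q n" by (cases C) (auto simp: enc_crole)
next
  have dec: "n = prod_encode (pfst n, psnd n)" for n by simp
  assume "?Q n"
  then consider "pfst n = 0" "psnd n = 0" | "pfst n = 1" "psnd n = 0" | "pfst n = 2"
    | C where "pfst n = 3" "psnd n = code_concept C"
    | C D where "pfst n = 4" "pfst (psnd n) = code_concept C" "psnd (psnd n) = code_concept D"
    | C D where "pfst n = 5" "pfst (psnd n) = code_concept C" "psnd (psnd n) = code_concept D"
    | C where "pfst n = 6" "psnd (psnd n) = code_concept C"
    | C where "pfst n = 7" "psnd (psnd n) = code_concept C"
    | RR C where "pfst n = 8" "pfst (psnd (psnd n)) = code_crole RR" "psnd (psnd (psnd n)) = code_concept C"
    | RR C where "pfst n = 9" "pfst (psnd (psnd n)) = code_crole RR" "psnd (psnd (psnd n)) = code_concept C"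
    by (auto simp: less_2_cases_iff enc_crole)
  then show "n \<in> range code_concept"
  proof cases
    case 1 then show ?thesis by (metis code_concept.simps(1) dec rangeI)
  next
    case 2 then show ?thesis by (metis code_concept.simps(2) dec rangeI)
  next
    case 3 then show ?thesis by (metis code_concept.simps(3) dec rangeI)
  next
    case (4 C) then show ?thesis by (metis code_concept.simps(4) dec rangeI)
  next
    case (5 C D) then show ?thesis by (metis code_concept.simps(5) dec rangeI)
  next
    case (6 C D) then show ?thesis by (metis code_concept.simps(6) dec rangeI)
  next
    case (7 C) then show ?thesis by (metis code_concept.simps(7) dec rangeI)
  next
    case (8 C) then show ?thesis by (metis code_concept.simps(8) dec rangeI)
  next
    case (9 RR C) then show ?thesis by (metis code_concept.simps(9) dec rangeI)
  next
    case (10 RR C) then show ?thesis by (metis code_concept.simps(10) dec rangeI)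
  qed
qed

lemma psnd_le: "psnd n \<le> n" and pfst_le: "pfst n \<le> n"
  by (metis le_prod_encode_2 prod_decode_inverse surjective_pairing,
      metis le_prod_encode_1 prod_decode_inverse surjective_pairing)

text \<open>Provides well-founded recursion on codes. Tag 0 has to be excluded, since
  \<open>prod_encode (0, 0) = 0\<close>; only codes with tag at least 3 have concept components, so
  nothing is lost.\<close>

lemma psnd_less: "0 < pfst n \<Longrightarrow> psnd n < n"
proof -
  have tri: "b \<le> triangle b" for b by (induction b) auto
  have "b < prod_encode (a, b)" if "0 < a" for a b
    using that tri[of "a + b"] unfolding prod_encode_def split_conv by linarith
  then show "0 < pfst n \<Longrightarrow> psnd n < n"
    by (metis prod_decode_inverse surjective_pairing)
qed

definition concept_code_rule :: "nat \<Rightarrow> nat list \<Rightarrow> bool" where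
  "concept_code_rule n ps \<longleftrightarrow>
     (pfst n < 2 \<and> psnd n = 0) \<or> pfst n = 2 \<or> (pfst n = 3 \<and> ps = [psnd n]) \<or>
     ((pfst n = 4 \<or> pfst n = 5) \<and> ps = [pfst (psnd n), psnd (psnd n)]) \<or>
     ((pfst n = 6 \<or> pfst n = 7) \<and> ps = [psnd (psnd n)]) \<or>
     ((pfst n = 8 \<or> pfst n = 9) \<and> pfst (psnd (psnd n)) \<in> codes TYPE(crole) \<and>
        ps = [psnd (psnd (psnd n))])"

text \<open>Being no code always has a finite local reason: an unknown tag, a nonzero payload for
  \<open>Top\<close> or \<open>Bot\<close>, a bad role code, or one bad component. Hence a single
  premise suffices where a code would need two.\<close>

definition concept_noncode_rule :: "nat \<Rightarrow> nat list \<Rightarrow> bool" where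
  "concept_noncode_rule n ps \<longleftrightarrow>
     9 < pfst n \<or> (pfst n < 2 \<and> 0 < psnd n) \<or> (pfst n = 3 \<and> ps = [psnd n]) \<or>
     ((pfst n = 4 \<or> pfst n = 5) \<and> (ps = [pfst (psnd n)] \<or> ps = [psnd (psnd n)])) \<or>
     ((pfst n = 6 \<or> pfst n = 7) \<and> ps = [psnd (psnd n)]) \<or>
     ((pfst n = 8 \<or> pfst n = 9) \<and> (pfst (psnd (psnd n)) \<notin> codes TYPE(crole) \<or>
        ps = [psnd (psnd (psnd n))]))"

lemma deriv_concept_code: "deriv concept_code_rule n \<longleftrightarrow> n \<in> range code_concept"
proof
  assume "deriv concept_code_rule n"
  then show "n \<in> range code_concept"
  proof induction
    case (derivI n ps)
    then show ?case
      by (subst code_concept_range) (auto simp only: concept_code_rule_def list.set ball_simps insert_iff)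
  qed
next
  assume "n \<in> range code_concept"
  then show "deriv concept_code_rule n"
  proof (induction n rule: less_induct)
    case (less n)
    have lt: "psnd n < n" "pfst (psnd n) < n" "psnd (psnd n) < n" "psnd (psnd (psnd n)) < n" if "0 < pfst n"
      using psnd_less[OF that] psnd_le pfst_le by (meson le_less_trans)+
    define ps where "ps = (if pfst n < 3 then [] else if pfst n = 3 then [psnd n]
       else if pfst n < 6 then [pfst (psnd n), psnd (psnd n)]
       else if pfst n < 8 then [psnd (psnd n)] else [psnd (psnd (psnd n))])"
    show ?case
    proof (rule derivI[of _ _ ps])
      show "concept_code_rule n ps"
        using less.prems by (subst (asm) code_concept_range) (auto simp: concept_code_rule_def ps_def)
      show "\<forall>p\<in>set ps. deriv concept_code_rule p"
        using less.prems lt less.IH by (subst (asm) code_concept_range) (auto simp: ps_def)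
    qed
  qed
qed

lemma deriv_concept_noncode: "deriv concept_noncode_rule n \<longleftrightarrow> n \<notin> range code_concept"
proof
  assume "deriv concept_noncode_rule n"
  then show "n \<notin> range code_concept"
  proof induction
    case (derivI n ps)
    then show ?case
      by (subst code_concept_range) (auto simp: concept_noncode_rule_def)
  qed
next
  assume "n \<notin> range code_concept"
  then show "deriv concept_noncode_rule n"
  proof (induction n rule: less_induct)
    case (less n)
    have lt: "psnd n < n" "pfst (psnd n) < n" "psnd (psnd n) < n" "psnd (psnd (psnd n)) < n" if "0 < pfst n"
      using psnd_less[OF that] psnd_le pfst_le by (meson le_less_trans)+
    define ps where "ps = (if pfst n < 3 \<or> 9 < pfst n then [] else if pfst n = 3 then [psnd n]
       else if pfst n < 6 then (if pfst (psnd n) \<in> range code_concept then [psnd (psnd n)] else [pfst (psnd n)])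
       else if pfst n < 8 then [psnd (psnd n)]
       else if pfst (psnd (psnd n)) \<in> codes TYPE(crole) then [psnd (psnd (psnd n))] else [])"
    have "pfst n < 2 \<or> pfst n = 2 \<or> pfst n = 3 \<or> pfst n = 4 \<or> pfst n = 5 \<or> pfst n = 6 \<or> pfst n = 7 \<or>
       pfst n = 8 \<or> pfst n = 9 \<or> 9 < pfst n" by linarith
    then have "concept_noncode_rule n ps \<and> (\<forall>p\<in>set ps. p < n \<and> p \<notin> range code_concept)"
      using less.prems lt unfolding concept_noncode_rule_def ps_def
      by (subst (asm) code_concept_range) (elim disjE; simp)
    then show ?case
      using less.IH by (intro derivI[of _ _ ps]) auto
  qed
qed

lemma re_concept_rules:
  "re (\<lambda>p. concept_code_rule (fst p) (snd p))" "re (\<lambda>p. concept_noncode_rule (fst p) (snd p))"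
  unfolding concept_code_rule_def concept_noncode_rule_def
  by (intro re_disj re_conj re_eq re_bool[OF compf_less] re_range re_not_range compf_intro)+

lemma cre_if_re: "re P \<Longrightarrow> cre P"
proof -
  assume "re P"
  then obtain W where "cre W" "P = W" unfolding re_def enc_nat_def by blast
  then show "cre P" by simp
qed

instantiation concept :: enc
begin
definition enc_concept :: "concept \<Rightarrow> nat" where "enc_concept = code_concept"
instance
proof
  let ?R = "range (enc :: concept \<Rightarrow> nat)"
  show "cre (\<lambda>n. n \<in> ?R)" "cre (\<lambda>n. n \<notin> ?R)"
    unfolding enc_concept_def
    by (fold deriv_concept_code deriv_concept_noncode)
       (rule cre_if_re re_deriv re_concept_rules)+
qed (auto simp: enc_concept_def inj_eq[OF inj_code_concept])
end

instantiation assertion :: enc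
begin
definition enc_assertion :: "assertion \<Rightarrow> nat" where "enc_assertion = code_assertion"
instance
proof
  let ?R = "range (enc :: assertion \<Rightarrow> nat)"
  have dec: "n = prod_encode (pfst n, psnd n)" for n by simp
  have r: "n \<in> ?R \<longleftrightarrow>
      (pfst n = 0 \<and> pfst (psnd n) \<in> codes TYPE(concept)) \<or> pfst n = 1 \<or> pfst n = 2" for n
  proof
    assume "n \<in> ?R"
    then obtain a where "n = code_assertion a" by (auto simp: enc_assertion_def)
    then show "(pfst n = 0 \<and> pfst (psnd n) \<in> codes TYPE(concept)) \<or> pfst n = 1 \<or> pfst n = 2"
      by (cases a) (auto simp: enc_concept_def)
  next
    assume "(pfst n = 0 \<and> pfst (psnd n) \<in> codes TYPE(concept)) \<or> pfst n = 1 \<or> pfst n = 2"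
    then consider C where "pfst n = 0" "pfst (psnd n) = code_concept C" | "pfst n = 1" | "pfst n = 2"
      by (auto simp: enc_concept_def)
    then show "n \<in> ?R"
      unfolding enc_assertion_def
    proof cases
      case (1 C) then show "n \<in> range code_assertion" by (metis code_assertion.simps(1) dec rangeI)
    next
      case 2 then show "n \<in> range code_assertion" by (metis code_assertion.simps(2) dec rangeI)
    next
      case 3 then show "n \<in> range code_assertion" by (metis code_assertion.simps(3) dec rangeI)
    qed
  qed
  show "cre (\<lambda>n. n \<in> ?R)"
    unfolding r by (intro cre_if_re re_disj re_conj re_eq re_range compf_intro)
  have r': "n \<notin> ?R \<longleftrightarrow>
      (pfst n = 0 \<and> pfst (psnd n) \<notin> codes TYPE(concept)) \<or> 2 < pfst n" for n
    unfolding r by auto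
  show "cre (\<lambda>n. n \<notin> ?R)"
    unfolding r' by (intro cre_if_re re_disj re_conj re_eq re_not_range re_bool[OF compf_less] compf_intro)
qed (auto simp: enc_assertion_def inj_eq[OF inj_code_assertion])
end

text \<open>A constructor with arguments is coded as its tag paired with the code of the
  right-nested tuple of its arguments, which is how \<open>enc\<close> treats tuples.\<close>

lemma compf_tag: "(\<And>x. enc (f x) = prod_encode (t, enc x)) \<Longrightarrow> compf f"
  by (rule compfI[of "\<lambda>n. prod_encode (t, n)"]) (auto intro: computable_intros)

lemma compf_concept [compf_intro]:
  "compf a \<Longrightarrow> compf (\<lambda>x. Atom (a x))"
  "compf f \<Longrightarrow> compf (\<lambda>x. Neg (f x))"
  "compf f \<Longrightarrow> compf g \<Longrightarrow> compf (\<lambda>x. And (f x) (g x))"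
  "compf f \<Longrightarrow> compf g \<Longrightarrow> compf (\<lambda>x. Or (f x) (g x))"
  "compf a \<Longrightarrow> compf g \<Longrightarrow> compf (\<lambda>x. ExR (a x) (g x))"
  "compf a \<Longrightarrow> compf g \<Longrightarrow> compf (\<lambda>x. AllR (a x) (g x))"
  "compf a \<Longrightarrow> compf r \<Longrightarrow> compf g \<Longrightarrow> compf (\<lambda>x. AtLeast (a x) (r x) (g x))"
  "compf a \<Longrightarrow> compf r \<Longrightarrow> compf g \<Longrightarrow> compf (\<lambda>x. AtMost (a x) (r x) (g x))"
  by ((rule compf_comp compf_comp2 compf_comp3; (assumption | (rule compf_tag, simp add: enc_concept_def enc_prod_def enc_nat_def enc_crole)))+)

lemma compf_assertion [compf_intro]:
  "compf f \<Longrightarrow> compf a \<Longrightarrow> compf (\<lambda>x. CAssert (f x) (a x))"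
  "compf r \<Longrightarrow> compf a \<Longrightarrow> compf b \<Longrightarrow> compf (\<lambda>x. RAssert (r x) (a x) (b x))"
  "compf a \<Longrightarrow> compf b \<Longrightarrow> compf (\<lambda>x. Neq (a x) (b x))"
  by ((rule compf_comp compf_comp2 compf_comp3; (assumption | (rule compf_tag, simp add: enc_assertion_def enc_concept_def enc_prod_def enc_nat_def)))+)

lemmas re_intro = re_ex re_conj re_disj re_eq

text \<open>Replaces the unbounded choice of a common length by comparisons of chains within the
  lists, which a list program can carry out.\<close>

lemma wf_crole_alt:
  "wf_crole RR \<longleftrightarrow> RR \<noteq> [] \<and> (\<forall>S\<in>set RR. S \<noteq> []) \<and>
     (\<forall>S\<in>set RR. \<forall>ch\<in>set S. ch \<noteq> [] \<and> (\<forall>S'\<in>set RR. \<forall>ch'\<in>set S'. length ch' = length ch))"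
    (is "_ \<longleftrightarrow> ?Q")
proof
  assume ?Q
  then obtain S ch where "S \<in> set RR" "ch \<in> set S" by (metis ex_in_conv set_empty)
  with \<open>?Q\<close> have "ch \<noteq> []" and len: "\<forall>S\<in>set RR. \<forall>ch'\<in>set S. length ch' = length ch"
    by blast+
  from \<open>ch \<noteq> []\<close> have "length ch \<ge> 1" by (cases ch) auto
  with len \<open>?Q\<close> show "wf_crole RR" unfolding wf_crole_def by blast
next
  assume "wf_crole RR"
  then obtain m where "m \<ge> 1" "RR \<noteq> []" "\<forall>S\<in>set RR. S \<noteq> []" "\<forall>S\<in>set RR. \<forall>ch\<in>set S. length ch = m"
    unfolding wf_crole_def by blast
  moreover from this have "\<forall>S\<in>set RR. \<forall>ch\<in>set S. ch \<noteq> []"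
    by (metis list.size(3) not_one_le_zero)
  ultimately show ?Q by simp
qed

lemma compf_wf_crole: "compf f \<Longrightarrow> compf (\<lambda>x. wf_crole (f x))"
  by (rule compf_comp[where f = wf_crole]) (unfold wf_crole_alt, intro compf_intro, assumption)

text \<open>The rules derive a concept together with its truth value, so that negative answers are
  enumerated as well.\<close>

lemma compf_wf_concept [compf_intro]: "compf f \<Longrightarrow> compf (\<lambda>x. wf_concept (f x))"
proof -
  define R where "R t ps \<longleftrightarrow> ((fst t = Top \<and> snd t = True) \<or> (fst t = Bot \<and> snd t = True) \<or> (\<exists>a. fst t = Atom a \<and> snd t = True) \<or>
     (\<exists>C. fst t = Neg C \<and> ps = [(C, snd t)]) \<or>
     (\<exists>C D b c. (fst t = And C D \<or> fst t = Or C D) \<and> ps = [(C, b), (D, c)] \<and> snd t = (b \<and> c)) \<or>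
     (\<exists>r C. (fst t = ExR r C \<or> fst t = AllR r C) \<and> ps = [(C, snd t)]) \<or>
     (\<exists>n RR C b. (fst t = AtLeast n RR C \<or> fst t = AtMost n RR C) \<and> ps = [(C, b)] \<and> snd t = (wf_crole RR \<and> b)))" for t ps
  have R: "re (\<lambda>p. R (fst p) (snd p))"
    unfolding R_def by (intro re_intro compf_wf_crole compf_intro)
  have 1: "snd t = wf_concept (fst t)" if "deriv R t" for t
    using that by induction (auto simp: R_def)
  have ax: "deriv R t" if "R t []" for t using that by (auto intro: derivI)
  have 2: "deriv R (C, wf_concept C)" for C
  proof (induction C)
    case (Neg C) then show ?case by (intro derivI[of _ _ "[(C, wf_concept C)]"]) (auto simp: R_def)
  next
    case (And C D) then show ?case by (intro derivI[of _ _ "[(C, wf_concept C), (D, wf_concept D)]"]) (auto simp: R_def)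
  next
    case (Or C D) then show ?case by (intro derivI[of _ _ "[(C, wf_concept C), (D, wf_concept D)]"]) (auto simp: R_def)
  next
    case (ExR r C) then show ?case by (intro derivI[of _ _ "[(C, wf_concept C)]"]) (auto simp: R_def)
  next
    case (AllR r C) then show ?case by (intro derivI[of _ _ "[(C, wf_concept C)]"]) (auto simp: R_def)
  next
    case (AtLeast n RR C) then show ?case by (intro derivI[of _ _ "[(C, wf_concept C)]"]) (auto simp: R_def)
  next
    case (AtMost n RR C) then show ?case by (intro derivI[of _ _ "[(C, wf_concept C)]"]) (auto simp: R_def)
  qed (rule ax, simp add: R_def)+
  have eq: "(b = wf_concept C) \<longleftrightarrow> deriv R (C, b)" for b C
    using 1[of "(C, b)"] 2[of C] by auto
  have "compf wf_concept"
    unfolding compf_def eq by (intro re_subst[OF re_deriv[OF R]] compf_intro)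
  then show "compf f \<Longrightarrow> compf (\<lambda>x. wf_concept (f x))" by (rule compf_comp)
qed

text \<open>The polarity belongs to the derived triple because \<open>Neg\<close> flips it and a
  value restriction calls for the negation of its argument.\<close>

lemma compf_nnf [compf_intro]: "compf p \<Longrightarrow> compf f \<Longrightarrow> compf (\<lambda>x. nnf (p x) (f x))"
proof -
  define R :: "bool \<times> concept \<times> concept \<Rightarrow> (bool \<times> concept \<times> concept) list \<Rightarrow> bool"
    where "R t ps \<longleftrightarrow> (
     (fst (snd t) = Top \<and> snd (snd t) = (if fst t then Top else Bot)) \<or>
     (fst (snd t) = Bot \<and> snd (snd t) = (if fst t then Bot else Top)) \<or>
     (\<exists>a. fst (snd t) = Atom a \<and> snd (snd t) = (if fst t then Atom a else Neg (Atom a))) \<or>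
     (\<exists>C. fst (snd t) = Neg C \<and> ps = [(\<not> fst t, C, snd (snd t))]) \<or>
     (\<exists>C D C' D'. fst (snd t) = And C D \<and> ps = [(fst t, C, C'), (fst t, D, D')] \<and>
         snd (snd t) = (if fst t then And C' D' else Or C' D')) \<or>
     (\<exists>C D C' D'. fst (snd t) = Or C D \<and> ps = [(fst t, C, C'), (fst t, D, D')] \<and>
         snd (snd t) = (if fst t then Or C' D' else And C' D')) \<or>
     (\<exists>r C C'. fst (snd t) = ExR r C \<and> ps = [(True, C, C')] \<and>
         snd (snd t) = (if fst t then AtLeast 1 [[[r]]] C' else AtMost 0 [[[r]]] C')) \<or>
     (\<exists>r C C'. fst (snd t) = AllR r C \<and> ps = [(False, C, C')] \<and>
         snd (snd t) = (if fst t then AtMost 0 [[[r]]] C' else AtLeast 1 [[[r]]] C')) \<or>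
     (\<exists>n RR C C'. fst (snd t) = AtLeast n RR C \<and> ps = [(True, C, C')] \<and>
         ((fst t = True \<and> snd (snd t) = AtLeast n RR C') \<or> (fst t = False \<and> n = 0 \<and> snd (snd t) = Bot) \<or>
          (\<exists>k. fst t = False \<and> n = Suc k \<and> snd (snd t) = AtMost k RR C'))) \<or>
     (\<exists>n RR C C'. fst (snd t) = AtMost n RR C \<and> ps = [(True, C, C')] \<and>
         snd (snd t) = (if fst t then AtMost n RR C' else AtLeast (Suc n) RR C')))" for t ps
  have R: "re (\<lambda>p. R (fst p) (snd p))"
    unfolding R_def by (intro re_intro compf_intro)
  have 1: "snd (snd t) = nnf (fst t) (fst (snd t))" if "deriv R t" for t
    using that by induction (auto simp: R_def)
  have ax: "deriv R t" if "R t []" for t using that by (auto intro: derivI)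
  have 2: "deriv R (p, C, nnf p C)" for p C
  proof (induction C arbitrary: p)
    case (Neg C) then show ?case by (intro derivI[of _ _ "[(\<not> p, C, nnf (\<not> p) C)]"]) (auto simp: R_def)
  next
    case (And C D) then show ?case by (intro derivI[of _ _ "[(p, C, nnf p C), (p, D, nnf p D)]"]) (auto simp: R_def)
  next
    case (Or C D) then show ?case by (intro derivI[of _ _ "[(p, C, nnf p C), (p, D, nnf p D)]"]) (auto simp: R_def)
  next
    case (ExR r C) then show ?case by (intro derivI[of _ _ "[(True, C, nnf True C)]"]) (auto simp: R_def)
  next
    case (AllR r C) then show ?case by (intro derivI[of _ _ "[(False, C, nnf False C)]"]) (auto simp: R_def)
  next
    case (AtLeast n RR C) then show ?case
      by (intro derivI[of _ _ "[(True, C, nnf True C)]"]) (cases n; auto simp: R_def)+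
  next
    case (AtMost n RR C) then show ?case by (intro derivI[of _ _ "[(True, C, nnf True C)]"]) (auto simp: R_def)
  qed (rule ax, simp add: R_def)+
  have eq: "(D = nnf p C) \<longleftrightarrow> deriv R (p, C, D)" for p C D
    using 1[of "(p, C, D)"] 2[of p C] by auto
  have "compf (\<lambda>q. nnf (fst q) (snd q))"
    unfolding compf_def eq by (intro re_subst[OF re_deriv[OF R]] compf_intro)
  then show "compf p \<Longrightarrow> compf f \<Longrightarrow> compf (\<lambda>x. nnf (p x) (f x))" by (rule compf_comp2)
qed

text \<open>A partial destructor returns a list of at most one element; pattern matching in a list
  program is then \<open>concat\<close> over \<open>map\<close>.\<close>

fun dest_CAssert :: "assertion \<Rightarrow> (concept \<times> nat) list" where
  "dest_CAssert (CAssert C x) = [(C, x)]" | "dest_CAssert _ = []"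

fun dest_RAssert :: "assertion \<Rightarrow> (nat \<times> nat \<times> nat) list" where
  "dest_RAssert (RAssert r x y) = [(r, x, y)]" | "dest_RAssert _ = []"

fun inds_list :: "assertion \<Rightarrow> nat list" where
  "inds_list (CAssert C x) = [x]" | "inds_list (RAssert r x y) = [x, y]" | "inds_list (Neq x y) = [x, y]"

fun dest_And :: "concept \<Rightarrow> (concept \<times> concept) list" where
  "dest_And (And C D) = [(C, D)]" | "dest_And _ = []"

fun dest_Or :: "concept \<Rightarrow> (concept \<times> concept) list" where
  "dest_Or (Or C D) = [(C, D)]" | "dest_Or _ = []"

fun dest_AtLeast :: "concept \<Rightarrow> (nat \<times> crole \<times> concept) list" where
  "dest_AtLeast (AtLeast n RR C) = [(n, RR, C)]" | "dest_AtLeast _ = []"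

fun dest_AtMost :: "concept \<Rightarrow> (nat \<times> crole \<times> concept) list" where
  "dest_AtMost (AtMost n RR C) = [(n, RR, C)]" | "dest_AtMost _ = []"

fun dest_Atom :: "concept \<Rightarrow> nat list" where
  "dest_Atom (Atom a) = [a]" | "dest_Atom _ = []"

lemma compf_dest_assertion:
  "compf dest_CAssert" "compf dest_RAssert" "compf inds_list"
proof -
  have "y = dest_CAssert a \<longleftrightarrow> (\<exists>C x. a = CAssert C x \<and> y = [(C, x)]) \<or> (\<exists>r u v. a = RAssert r u v \<and> y = []) \<or>
      (\<exists>u v. a = Neq u v \<and> y = [])" for a y by (cases a) auto
  then show "compf dest_CAssert"
    unfolding compf_def by (simp only:) (intro re_intro compf_intro)
  have "y = dest_RAssert a \<longleftrightarrow> (\<exists>C x. a = CAssert C x \<and> y = []) \<or> (\<exists>r u v. a = RAssert r u v \<and> y = [(r, u, v)]) \<or>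
      (\<exists>u v. a = Neq u v \<and> y = [])" for a y by (cases a) auto
  then show "compf dest_RAssert"
    unfolding compf_def by (simp only:) (intro re_intro compf_intro)
  have "y = inds_list a \<longleftrightarrow> (\<exists>C x. a = CAssert C x \<and> y = [x]) \<or> (\<exists>r u v. a = RAssert r u v \<and> y = [u, v]) \<or>
      (\<exists>u v. a = Neq u v \<and> y = [u, v])" for a y by (cases a) auto
  then show "compf inds_list"
    unfolding compf_def by (simp only:) (intro re_intro compf_intro)
qed

text \<open>The default case is recognised by the tag of the code, which avoids listing the other
  nine constructors.\<close>

lemma compf_dest_concept:
  "compf dest_And" "compf dest_Or" "compf dest_AtLeast" "compf dest_AtMost" "compf dest_Atom"
proof -
  have "y = dest_And c \<longleftrightarrow> (\<exists>C D. c = And C D \<and> y = [(C, D)]) \<or> ((pfst (enc c) = 4) = False \<and> y = [])" for c y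
    by (cases c) (auto simp: enc_concept_def)
  then show "compf dest_And"
    unfolding compf_def by (simp only:) (intro re_intro compf_intro)
  have "y = dest_Or c \<longleftrightarrow> (\<exists>C D. c = Or C D \<and> y = [(C, D)]) \<or> ((pfst (enc c) = 5) = False \<and> y = [])" for c y
    by (cases c) (auto simp: enc_concept_def)
  then show "compf dest_Or"
    unfolding compf_def by (simp only:) (intro re_intro compf_intro)
  have "y = dest_AtLeast c \<longleftrightarrow> (\<exists>n RR C. c = AtLeast n RR C \<and> y = [(n, RR, C)]) \<or> ((pfst (enc c) = 8) = False \<and> y = [])" for c y
    by (cases c) (auto simp: enc_concept_def)
  then show "compf dest_AtLeast"
    unfolding compf_def by (simp only:) (intro re_intro compf_intro)
  have "y = dest_AtMost c \<longleftrightarrow> (\<exists>n RR C. c = AtMost n RR C \<and> y = [(n, RR, C)]) \<or> ((pfst (enc c) = 9) = False \<and> y = [])" for c y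
    by (cases c) (auto simp: enc_concept_def)
  then show "compf dest_AtMost"
    unfolding compf_def by (simp only:) (intro re_intro compf_intro)
  have "y = dest_Atom c \<longleftrightarrow> (\<exists>a. c = Atom a \<and> y = [a]) \<or> ((pfst (enc c) = 2) = False \<and> y = [])" for c y
    by (cases c) (auto simp: enc_concept_def)
  then show "compf dest_Atom"
    unfolding compf_def by (simp only:) (intro re_intro compf_intro)
qed

lemma compf_asubst [compf_intro]: "compf y \<Longrightarrow> compf z \<Longrightarrow> compf a \<Longrightarrow> compf (\<lambda>x. asubst (y x) (z x) (a x))"
proof -
  have "b = asubst y z a \<longleftrightarrow>
     (\<exists>C x. a = CAssert C x \<and> b = CAssert C (if x = y then z else x)) \<or>
     (\<exists>r u v. a = RAssert r u v \<and> b = RAssert r (if u = y then z else u) (if v = y then z else v)) \<or>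
     (\<exists>u v. a = Neq u v \<and> b = Neq (if u = y then z else u) (if v = y then z else v))" for y z a b
    by (cases a) auto
  then have "compf (\<lambda>p. asubst (fst p) (fst (snd p)) (snd (snd p)))"
    unfolding compf_def by (simp only:) (intro re_intro compf_intro)
  then show "compf y \<Longrightarrow> compf z \<Longrightarrow> compf a \<Longrightarrow> compf (\<lambda>x. asubst (y x) (z x) (a x))"
    by (rule compf_comp3)
qed

lemmas compf_dest [compf_intro] =
  compf_dest_assertion[THEN compf_comp] compf_dest_concept[THEN compf_comp]

subsection \<open>The tableau rules as list programs\<close>

definition inds :: "abox \<Rightarrow> nat set" where "inds A = (\<Union>a\<in>A. ainds a)"

definition conc_list :: "assertion list \<Rightarrow> (concept \<times> nat) list" where
  "conc_list L = concat (map dest_CAssert L)"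

definition role_list :: "assertion list \<Rightarrow> (nat \<times> nat \<times> nat) list" where
  "role_list L = concat (map dest_RAssert L)"

definition ind_list :: "assertion list \<Rightarrow> nat list" where
  "ind_list L = concat (map inds_list L)"

text \<open>The identity, for the empty chain, is cut down to the individuals of the ABox.\<close>

definition chain_list :: "assertion list \<Rightarrow> nat list \<Rightarrow> (nat \<times> nat) list" where
  "chain_list L ch = rec_list (map (\<lambda>u. (u, u)) (ind_list L))
     (\<lambda>r rs R. concat (map (\<lambda>e. concat (map (\<lambda>p.
        if fst e = r \<and> snd (snd e) = fst p then [(fst (snd e), snd p)] else []) R)) (role_list L))) ch"

definition succ_list :: "assertion list \<Rightarrow> crole \<Rightarrow> nat \<Rightarrow> nat list" where
  "succ_list L RR x = filter (\<lambda>y. \<exists>S\<in>set RR. \<forall>ch\<in>set S. (x, y) \<in> set (chain_list L ch)) (ind_list L)"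

text \<open>Without repetitions the length is the number of successors, and sublists correspond to
  subsets.\<close>

definition csucc_list :: "assertion list \<Rightarrow> crole \<Rightarrow> concept \<Rightarrow> nat \<Rightarrow> nat list" where
  "csucc_list L RR C x = remdups (filter (\<lambda>y. CAssert C y \<in> set L) (succ_list L RR x))"

definition neq_list :: "assertion list \<Rightarrow> nat list \<Rightarrow> bool" where
  "neq_list L Y \<longleftrightarrow> (\<forall>y\<in>set Y. \<forall>z\<in>set Y. y = z \<or> Neq y z \<in> set L)"

definition fresh_list :: "assertion list \<Rightarrow> nat" where
  "fresh_list L = Suc (rec_list 0 (\<lambda>z zs r. if r < z then z else r) (ind_list L))"

text \<open>Unlike \<open>(!)\<close>, this is specified beyond the end of the list, hence provably computable.\<close>

definition nth_or :: "'a \<Rightarrow> 'a list \<Rightarrow> nat \<Rightarrow> 'a" where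
  "nth_or d xs i = rec_list d (\<lambda>y ys r. y) (drop i xs)"

definition new_list :: "nat \<Rightarrow> nat \<Rightarrow> concept \<Rightarrow> nat list list list \<Rightarrow> assertion list" where
  "new_list N x C Ss =
     concat (map (\<lambda>k. concat (map (\<lambda>j. map (\<lambda>l.
        RAssert (nth_or 0 (nth_or [] (nth_or [] Ss k) j) l)
          (chain_node N x (length (nth_or [] (nth_or [] Ss k) j)) k j l)
          (chain_node N x (length (nth_or [] (nth_or [] Ss k) j)) k j (Suc l)))
        [0..<length (nth_or [] (nth_or [] Ss k) j)]) [0..<length (nth_or [] Ss k)])) [0..<length Ss])
     @ map (\<lambda>k. CAssert C (fresh_succ N k)) [0..<length Ss]
     @ concat (map (\<lambda>k. concat (map (\<lambda>k'. if k = k' then [] else [Neq (fresh_succ N k) (fresh_succ N k')])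
         [0..<length Ss])) [0..<length Ss])"

definition and_steps :: "assertion list \<Rightarrow> assertion list list" where
  "and_steps L = concat (map (\<lambda>p. concat (map (\<lambda>q.
     if CAssert (fst q) (snd p) \<in> set L \<and> CAssert (snd q) (snd p) \<in> set L then []
     else [CAssert (fst q) (snd p) # CAssert (snd q) (snd p) # L]) (dest_And (fst p)))) (conc_list L))"

definition or_steps :: "assertion list \<Rightarrow> assertion list list" where
  "or_steps L = concat (map (\<lambda>p. concat (map (\<lambda>q.
     if CAssert (fst q) (snd p) \<in> set L \<or> CAssert (snd q) (snd p) \<in> set L then []
     else [CAssert (fst q) (snd p) # L, CAssert (snd q) (snd p) # L]) (dest_Or (fst p)))) (conc_list L))"

definition ge_steps :: "assertion list \<Rightarrow> assertion list list" where
  "ge_steps L = concat (map (\<lambda>p. concat (map (\<lambda>q.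
     if \<exists>Y\<in>set (subseqs (csucc_list L (fst (snd q)) (snd (snd q)) (snd p))). length Y = fst q \<and> neq_list L Y then []
     else map (\<lambda>Ss. new_list (fresh_list L) (snd p) (snd (snd q)) Ss @ L) (List.n_lists (fst q) (fst (snd q))))
     (dest_AtLeast (fst p)))) (conc_list L))"

definition le_steps :: "assertion list \<Rightarrow> assertion list list" where
  "le_steps L = concat (map (\<lambda>p. concat (map (\<lambda>q.
     if fst q < length (csucc_list L (fst (snd q)) (snd (snd q)) (snd p))
     then concat (map (\<lambda>y. concat (map (\<lambda>z.
       if y = z \<or> Neq y z \<in> set L \<or> Neq z y \<in> set L then [] else [map (\<lambda>a. asubst y z a) L])
       (csucc_list L (fst (snd q)) (snd (snd q)) (snd p)))) (csucc_list L (fst (snd q)) (snd (snd q)) (snd p)))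
     else [])
     (dest_AtMost (fst p)))) (conc_list L))"

definition choose_steps :: "assertion list \<Rightarrow> assertion list list" where
  "choose_steps L = concat (map (\<lambda>p. concat (map (\<lambda>q. concat (map (\<lambda>y.
     if CAssert (snd (snd q)) y \<in> set L \<or> CAssert (compl (snd (snd q))) y \<in> set L then []
     else [CAssert (snd (snd q)) y # L, CAssert (compl (snd (snd q))) y # L])
     (succ_list L (fst (snd q)) (snd p)))) (dest_AtLeast (fst p) @ dest_AtMost (fst p)))) (conc_list L))"

definition steps :: "assertion list \<Rightarrow> assertion list list" where
  "steps L = and_steps L @ or_steps L @ ge_steps L @ le_steps L @ choose_steps L"

definition clash_list :: "assertion list \<Rightarrow> bool" where
  "clash_list L \<longleftrightarrow>
     (\<exists>p\<in>set (conc_list L). fst p = Bot) \<or>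
     (\<exists>p\<in>set (conc_list L). \<exists>a\<in>set (dest_Atom (fst p)). CAssert (Neg (Atom a)) (snd p) \<in> set L) \<or>
     (\<exists>p\<in>set (conc_list L). \<exists>q\<in>set (dest_AtMost (fst p)).
        \<exists>Y\<in>set (subseqs (csucc_list L (fst (snd q)) (snd (snd q)) (snd p))). fst q < length Y \<and> neq_list L Y)"

definition wf_list :: "assertion list \<Rightarrow> bool" where
  "wf_list L \<longleftrightarrow> (\<forall>p\<in>set (conc_list L). wf_concept (fst p))"

lemma compf_conc_list [compf_intro]: "compf f \<Longrightarrow> compf (\<lambda>x. conc_list (f x))"
  by (rule compf_comp[where f = conc_list]) (unfold conc_list_def, intro compf_intro)

lemma compf_role_list [compf_intro]: "compf f \<Longrightarrow> compf (\<lambda>x. role_list (f x))"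
  by (rule compf_comp[where f = role_list]) (unfold role_list_def, intro compf_intro)

lemma compf_ind_list [compf_intro]: "compf f \<Longrightarrow> compf (\<lambda>x. ind_list (f x))"
  by (rule compf_comp[where f = ind_list]) (unfold ind_list_def, intro compf_intro)

lemma compf_chain_list [compf_intro]: "compf f \<Longrightarrow> compf g \<Longrightarrow> compf (\<lambda>x. chain_list (f x) (g x))"
  by (rule compf_comp2[where F = chain_list]) (unfold chain_list_def, intro compf_intro)

lemma compf_succ_list [compf_intro]:
  "compf f \<Longrightarrow> compf g \<Longrightarrow> compf h \<Longrightarrow> compf (\<lambda>x. succ_list (f x) (g x) (h x))"
  by (rule compf_comp3[where F = succ_list]) (unfold succ_list_def, intro compf_intro)

lemma compf_csucc_list [compf_intro]:
  "compf f \<Longrightarrow> compf g \<Longrightarrow> compf h \<Longrightarrow> compf k \<Longrightarrow> compf (\<lambda>x. csucc_list (f x) (g x) (h x) (k x))"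
  by (rule compf_comp4[where F = csucc_list]) (unfold csucc_list_def, intro compf_intro)

lemma compf_neq_list [compf_intro]: "compf f \<Longrightarrow> compf g \<Longrightarrow> compf (\<lambda>x. neq_list (f x) (g x))"
  by (rule compf_comp2[where F = neq_list]) (unfold neq_list_def, intro compf_intro)

lemma compf_fresh_list [compf_intro]: "compf f \<Longrightarrow> compf (\<lambda>x. fresh_list (f x))"
  by (rule compf_comp[where f = fresh_list]) (unfold fresh_list_def, intro compf_intro)

lemma compf_nth_or [compf_intro]: "compf d \<Longrightarrow> compf f \<Longrightarrow> compf g \<Longrightarrow> compf (\<lambda>x. nth_or (d x) (f x) (g x))"
  unfolding nth_or_def by (intro compf_intro)

lemma compf_fresh_succ [compf_intro]: "compf f \<Longrightarrow> compf g \<Longrightarrow> compf (\<lambda>x. fresh_succ (f x) (g x))"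
  unfolding fresh_succ_def by (intro compf_intro)

lemma compf_chain_node [compf_intro]:
  "compf f \<Longrightarrow> compf g \<Longrightarrow> compf h \<Longrightarrow> compf k \<Longrightarrow> compf j \<Longrightarrow> compf l \<Longrightarrow>
   compf (\<lambda>x. chain_node (f x) (g x) (h x) (k x) (j x) (l x))"
  unfolding chain_node_def by (intro compf_intro)

lemma compf_new_list [compf_intro]:
  "compf f \<Longrightarrow> compf g \<Longrightarrow> compf h \<Longrightarrow> compf k \<Longrightarrow> compf (\<lambda>x. new_list (f x) (g x) (h x) (k x))"
  by (rule compf_comp4[where F = new_list]) (unfold new_list_def, intro compf_intro)

lemma compf_and_steps: "compf f \<Longrightarrow> compf (\<lambda>x. and_steps (f x))"
  by (rule compf_comp[where f = and_steps]) (unfold and_steps_def, intro compf_intro)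

lemma compf_or_steps: "compf f \<Longrightarrow> compf (\<lambda>x. or_steps (f x))"
  by (rule compf_comp[where f = or_steps]) (unfold or_steps_def, intro compf_intro)

lemma compf_ge_steps: "compf f \<Longrightarrow> compf (\<lambda>x. ge_steps (f x))"
  by (rule compf_comp[where f = ge_steps]) (unfold ge_steps_def, intro compf_intro)

lemma compf_le_steps: "compf f \<Longrightarrow> compf (\<lambda>x. le_steps (f x))"
  by (rule compf_comp[where f = le_steps]) (unfold le_steps_def, intro compf_intro)

lemma compf_choose_steps: "compf f \<Longrightarrow> compf (\<lambda>x. choose_steps (f x))"
  by (rule compf_comp[where f = choose_steps]) (unfold choose_steps_def, intro compf_intro)

lemma compf_steps [compf_intro]: "compf f \<Longrightarrow> compf (\<lambda>x. steps (f x))"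
  unfolding steps_def
  by (intro compf_append compf_and_steps compf_or_steps compf_ge_steps compf_le_steps compf_choose_steps)

lemma compf_clash_list [compf_intro]: "compf f \<Longrightarrow> compf (\<lambda>x. clash_list (f x))"
  by (rule compf_comp[where f = clash_list]) (unfold clash_list_def, intro compf_intro)

lemma compf_wf_list [compf_intro]: "compf f \<Longrightarrow> compf (\<lambda>x. wf_list (f x))"
  by (rule compf_comp[where f = wf_list]) (unfold wf_list_def, intro compf_intro)

section \<open>Agreement of the list programs with the tableau rules\<close>

abbreviation arole :: "abox \<Rightarrow> nat \<Rightarrow> (nat \<times> nat) set" where
  "arole A \<equiv> (\<lambda>r. {(u, v). RAssert r u v \<in> A})"

lemma mem_conc_list: "p \<in> set (conc_list L) \<longleftrightarrow> CAssert (fst p) (snd p) \<in> set L"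
proof -
  have "p \<in> set (dest_CAssert a) \<longleftrightarrow> a = CAssert (fst p) (snd p)" for a
    by (cases a) (auto simp: prod_eq_iff)
  then show ?thesis by (auto simp: conc_list_def)
qed

lemma mem_role_list: "e \<in> set (role_list L) \<longleftrightarrow> RAssert (fst e) (fst (snd e)) (snd (snd e)) \<in> set L"
proof -
  have "e \<in> set (dest_RAssert a) \<longleftrightarrow> a = RAssert (fst e) (fst (snd e)) (snd (snd e))" for a
    by (cases a) (auto simp: prod_eq_iff)
  then show ?thesis by (auto simp: role_list_def)
qed

lemma bex_conc_list: "(\<exists>p\<in>set (conc_list L). P p) \<longleftrightarrow> (\<exists>C x. CAssert C x \<in> set L \<and> P (C, x))"
  by (simp add: Bex_def mem_conc_list split_paired_Ex)

lemma bex_role_list: "(\<exists>e\<in>set (role_list L). P e) \<longleftrightarrow> (\<exists>r x y. RAssert r x y \<in> set L \<and> P (r, x, y))"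
  by (simp add: Bex_def mem_role_list split_paired_Ex)

text \<open>Lists of outcomes are described by bounded existential statements with an arbitrary
  predicate \<open>P\<close>: in this form nested \<open>concat\<close>, \<open>map\<close> and
  \<open>if\<close> are removed by rewriting.\<close>

lemma bex_concat_map: "(\<exists>y\<in>set (concat (map f xs)). P y) \<longleftrightarrow> (\<exists>x\<in>set xs. \<exists>y\<in>set (f x). P y)"
  by auto

lemma bex_if_list:
  "(\<exists>y\<in>set (if c then [] else l). P y) \<longleftrightarrow> \<not> c \<and> (\<exists>y\<in>set l. P y)"
  "(\<exists>y\<in>set (if c then l else []). P y) \<longleftrightarrow> c \<and> (\<exists>y\<in>set l. P y)"
  by auto

lemma set_ind_list: "set (ind_list L) = inds (set L)"
proof -
  have "set (inds_list a) = ainds a" for a by (cases a) auto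
  then show ?thesis by (auto simp: ind_list_def inds_def)
qed

lemma RAssert_inds: "RAssert r x y \<in> A \<Longrightarrow> x \<in> inds A" "RAssert r x y \<in> A \<Longrightarrow> y \<in> inds A"
  unfolding inds_def by force+

lemma CAssert_inds: "CAssert C x \<in> A \<Longrightarrow> x \<in> inds A"
  unfolding inds_def by force

lemma chain_rel_inds: "(x, y) \<in> chain_rel (arole A) ch \<Longrightarrow> ch \<noteq> [] \<Longrightarrow> x \<in> inds A \<and> y \<in> inds A"
proof (induction ch arbitrary: x)
  case (Cons r ch)
  then obtain z where z: "RAssert r x z \<in> A" "(z, y) \<in> chain_rel (arole A) ch" by auto
  then show ?case using Cons.IH[OF z(2)] RAssert_inds by (cases ch) auto
qed simp

lemma set_chain_list: "set (chain_list L ch) = chain_rel (arole (set L)) ch \<inter> inds (set L) \<times> inds (set L)"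
proof (induction ch)
  case Nil
  then show ?case by (auto simp: chain_list_def set_ind_list)
next
  case (Cons r ch)
  have "chain_list L (r # ch) = concat (map (\<lambda>e. concat (map (\<lambda>p.
        if fst e = r \<and> snd (snd e) = fst p then [(fst (snd e), snd p)] else []) (chain_list L ch))) (role_list L))"
    by (simp add: chain_list_def)
  then have "(\<exists>p\<in>set (chain_list L (r # ch)). p = (x, y)) \<longleftrightarrow>
      (\<exists>z. RAssert r x z \<in> set L \<and> (z, y) \<in> set (chain_list L ch))" for x y
    by (simp only: bex_concat_map bex_role_list bex_if_list fst_conv snd_conv) force
  then have "set (chain_list L (r # ch)) =
      {(x, y). \<exists>z. RAssert r x z \<in> set L \<and> (z, y) \<in> set (chain_list L ch)}"
    by auto
  also have "\<dots> = chain_rel (arole (set L)) (r # ch) \<inter> inds (set L) \<times> inds (set L)"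
    unfolding Cons.IH by (auto intro: RAssert_inds)
  finally show ?case .
qed

lemma wf_crole_nonempty:
  assumes "wf_crole RR" "S \<in> set RR"
  shows "S \<noteq> []" "ch \<in> set S \<Longrightarrow> ch \<noteq> []"
  using assms by (auto simp: wf_crole_alt)

text \<open>An empty intersection would be the universal relation and the empty chain the identity;
  well-formed roles contain neither, so all their successors come from asserted edges.\<close>

lemma succs_inds:
  assumes "wf_crole RR" "y \<in> succs A RR x"
  shows "x \<in> inds A" "y \<in> inds A"
proof -
  obtain S where S: "S \<in> set RR" "\<forall>ch\<in>set S. (x, y) \<in> chain_rel (arole A) ch"
    using assms(2) by (auto simp: succs_def crole_rel_def)
  obtain ch where "ch \<in> set S" using wf_crole_nonempty(1)[OF assms(1) S(1)] by (metis list.set_sel(1))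
  then show "x \<in> inds A" "y \<in> inds A"
    using S chain_rel_inds[of x y A ch] wf_crole_nonempty(2)[OF assms(1) S(1)] by blast+
qed

lemma set_succ_list:
  assumes "wf_crole RR"
  shows "set (succ_list L RR x) = succs (set L) RR x"
proof -
  have "y \<in> set (succ_list L RR x) \<longleftrightarrow> y \<in> succs (set L) RR x" for y
  proof (cases "x \<in> inds (set L) \<and> y \<in> inds (set L)")
    case True
    then show ?thesis
      by (simp add: succ_list_def set_ind_list set_chain_list succs_def crole_rel_def)
  next
    case False
    have "y \<notin> set (succ_list L RR x)"
    proof
      assume "y \<in> set (succ_list L RR x)"
      then obtain S where S: "y \<in> inds (set L)" "S \<in> set RR" "\<forall>ch\<in>set S. (x, y) \<in> set (chain_list L ch)"
        by (auto simp: succ_list_def set_ind_list)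
      then show False
        using False wf_crole_nonempty(1)[OF assms S(2)] by (auto simp: set_chain_list neq_Nil_conv)
    qed
    then show ?thesis using False succs_inds[OF assms] by blast
  qed
  then show ?thesis by blast
qed

lemma set_csucc_list: "wf_crole RR \<Longrightarrow> set (csucc_list L RR C x) = csuccs (set L) RR C x"
  by (auto simp: csucc_list_def set_succ_list csuccs_def)

lemma length_csucc_list: "wf_crole RR \<Longrightarrow> length (csucc_list L RR C x) = card (csuccs (set L) RR C x)"
  by (subst set_csucc_list[symmetric], assumption)
     (simp add: csucc_list_def flip: distinct_card)

lemma neq_list_iff: "neq_list L Y \<longleftrightarrow> pairwise_neq (set L) (set Y)"
  by (auto simp: neq_list_def pairwise_neq_def)

text \<open>Reduces the search for a set of pairwise distinct successors to a search through
  sublists: over a distinct list every subset is a sublist without repetition, so length and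
  cardinality agree.\<close>

lemma bex_subseqs:
  assumes "distinct xs"
  shows "(\<exists>Y\<in>set (subseqs xs). P (length Y) \<and> Q (set Y)) \<longleftrightarrow> (\<exists>Y\<subseteq>set xs. finite Y \<and> P (card Y) \<and> Q Y)"
proof
  assume "\<exists>Y\<in>set (subseqs xs). P (length Y) \<and> Q (set Y)"
  then obtain Y where Y: "Y \<in> set (subseqs xs)" "P (length Y)" "Q (set Y)" by blast
  then have "distinct Y" "set Y \<subseteq> set xs"
    using subseqs_distinctD[OF Y(1) assms] subseqs_powset[of xs] by auto
  then show "\<exists>Y\<subseteq>set xs. finite Y \<and> P (card Y) \<and> Q Y"
    using Y by (intro exI[of _ "set Y"]) (auto simp: distinct_card)
next
  assume "\<exists>Y\<subseteq>set xs. finite Y \<and> P (card Y) \<and> Q Y"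
  then obtain Y where Y: "Y \<subseteq> set xs" "P (card Y)" "Q Y" by blast
  then obtain ys where ys: "ys \<in> set (subseqs xs)" "Y = set ys"
    using subseqs_powset[of xs] by (metis PowI imageE)
  then show "\<exists>Y\<in>set (subseqs xs). P (length Y) \<and> Q (set Y)"
    using Y subseqs_distinctD[OF ys(1) assms] by (auto simp: distinct_card)
qed

lemma bex_subseqs_csucc_list:
  assumes "wf_crole RR"
  shows "(\<exists>Y\<in>set (subseqs (csucc_list L RR C x)). P (length Y) \<and> neq_list L Y) \<longleftrightarrow>
    (\<exists>Y\<subseteq>csuccs (set L) RR C x. finite Y \<and> P (card Y) \<and> pairwise_neq (set L) Y)"
  unfolding neq_list_iff set_csucc_list[OF assms, symmetric]
  by (rule bex_subseqs) (simp add: csucc_list_def)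

lemmas bex_subseqs_csucc_list_eq = bex_subseqs_csucc_list[where P = "\<lambda>k. k = n" for n]
  and bex_subseqs_csucc_list_less = bex_subseqs_csucc_list[where P = "\<lambda>k. n < k" for n]

text \<open>\<open>Max\<close> of the empty set is unspecified, whereas the program starts from 0.
  Fresh names are requested only where an at-least restriction is asserted, hence for nonempty
  lists.\<close>

lemma fresh_list_eq: "L \<noteq> [] \<Longrightarrow> fresh_list L = fresh (set L)"
proof -
  have Max: "rec_list 0 (\<lambda>z zs r. if r < z then z else r) xs = Max (set xs)" if "xs \<noteq> []" for xs :: "nat list"
    using that
  proof (induction xs rule: list_nonempty_induct)
    case (cons x xs)
    then have "Max (set (x # xs)) = max x (Max (set xs))" by simp
    then show ?case using cons.IH by (simp only: list.rec max_def) auto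
  qed simp
  assume "L \<noteq> []"
  then have "ind_list L \<noteq> []"
    by (cases L; cases "hd L") (auto simp: ind_list_def)
  then show ?thesis by (simp add: fresh_list_def fresh_def Max set_ind_list inds_def)
qed

lemma nth_or: "i < length xs \<Longrightarrow> nth_or d xs i = xs ! i"
  by (simp add: nth_or_def Cons_nth_drop_Suc[symmetric])

lemma set_new_list: "set (new_list N x C Ss) = new_succs N x C Ss"
proof -
  let ?c = "\<lambda>k j. nth_or [] (nth_or [] Ss k) j"
  let ?n = "\<lambda>k j. chain_node N x (length (?c k j)) k j" and ?m = "\<lambda>k j. chain_node N x (length (Ss ! k ! j)) k j"
  have "set (concat (map (\<lambda>k. concat (map (\<lambda>j. map (\<lambda>l.
        RAssert (nth_or 0 (?c k j) l) (?n k j l) (?n k j (Suc l)))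
        [0..<length (?c k j)]) [0..<length (nth_or [] Ss k)])) [0..<length Ss])) =
    {RAssert (Ss ! k ! j ! l) (?m k j l) (?m k j (Suc l)) | k j l.
        k < length Ss \<and> j < length (Ss ! k) \<and> l < length (Ss ! k ! j)}" (is "?A = ?B")
  proof
    show "?A \<subseteq> ?B"
    proof
      fix a assume "a \<in> ?A"
      then obtain k j l where *: "k < length Ss" "j < length (nth_or [] Ss k)"
        "l < length (?c k j)"
        "a = RAssert (nth_or 0 (?c k j) l) (?n k j l) (?n k j (Suc l))"
        by auto
      then show "a \<in> ?B" by (auto simp: nth_or)
    qed
    show "?B \<subseteq> ?A"
    proof
      fix a assume "a \<in> ?B"
      then obtain k j l where *: "k < length Ss" "j < length (Ss ! k)" "l < length (Ss ! k ! j)"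
        "a = RAssert (Ss ! k ! j ! l) (?m k j l) (?m k j (Suc l))"
        by blast
      have "\<exists>b\<in>?A. b = a"
        unfolding bex_concat_map by (rule bexI[of _ k], rule bexI[of _ j]) (use * in \<open>auto simp: nth_or\<close>)
      then show "a \<in> ?A" by blast
    qed
  qed
  moreover have "set (map (\<lambda>k. CAssert C (fresh_succ N k)) [0..<length Ss]) =
      {CAssert C (fresh_succ N k) | k. k < length Ss}"
    by auto
  moreover have "set (concat (map (\<lambda>k. concat (map (\<lambda>k'.
        if k = k' then [] else [Neq (fresh_succ N k) (fresh_succ N k')]) [0..<length Ss])) [0..<length Ss])) =
      {Neq (fresh_succ N k) (fresh_succ N k') | k k'. k < length Ss \<and> k' < length Ss \<and> k \<noteq> k'}"
    (is "?A = ?B")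
  proof
    show "?A \<subseteq> ?B" by (auto split: if_splits) blast
    show "?B \<subseteq> ?A"
    proof
      fix a assume "a \<in> ?B"
      then obtain k k' where *: "k < length Ss" "k' < length Ss" "k \<noteq> k'" "a = Neq (fresh_succ N k) (fresh_succ N k')"
        by blast
      have "\<exists>b\<in>?A. b = a"
        unfolding bex_concat_map by (rule bexI[of _ k], rule bexI[of _ k']) (use * in auto)
      then show "a \<in> ?A" by blast
    qed
  qed
  ultimately show ?thesis
    unfolding new_list_def new_succs_def set_append Un_assoc by (simp only:)
qed

lemma finite_new_succs: "finite (new_succs N x C Ss)"
  using set_new_list[of N x C Ss] by (metis List.finite_set)

lemma wf_list_iff: "wf_list L \<longleftrightarrow> wf_abox (set L)"
  by (simp add: wf_list_def wf_abox_def Ball_def mem_conc_list split_paired_All)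

lemma bex_dest_concept:
  "(\<exists>q\<in>set (dest_And c). P q) \<longleftrightarrow> (\<exists>C D. c = And C D \<and> P (C, D))"
  "(\<exists>q\<in>set (dest_Or c). P q) \<longleftrightarrow> (\<exists>C D. c = Or C D \<and> P (C, D))"
  "(\<exists>q\<in>set (dest_AtLeast c). P' q) \<longleftrightarrow> (\<exists>n RR C. c = AtLeast n RR C \<and> P' (n, RR, C))"
  "(\<exists>q\<in>set (dest_AtMost c). P' q) \<longleftrightarrow> (\<exists>n RR C. c = AtMost n RR C \<and> P' (n, RR, C))"
  "(\<exists>a\<in>set (dest_Atom c). P'' a) \<longleftrightarrow> (\<exists>a. c = Atom a \<and> P'' a)"
  by (cases c; auto)+

lemma bex_conc_dest:
  "(\<exists>p\<in>set (conc_list L). \<exists>q\<in>set (dest_And (fst p)). P p q) \<longleftrightarrow>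
    (\<exists>C D x. CAssert (And C D) x \<in> set L \<and> P (And C D, x) (C, D))"
  "(\<exists>p\<in>set (conc_list L). \<exists>q\<in>set (dest_Or (fst p)). P p q) \<longleftrightarrow>
    (\<exists>C D x. CAssert (Or C D) x \<in> set L \<and> P (Or C D, x) (C, D))"
  "(\<exists>p\<in>set (conc_list L). \<exists>q\<in>set (dest_AtLeast (fst p)). P' p q) \<longleftrightarrow>
    (\<exists>n RR C x. CAssert (AtLeast n RR C) x \<in> set L \<and> P' (AtLeast n RR C, x) (n, RR, C))"
  "(\<exists>p\<in>set (conc_list L). \<exists>q\<in>set (dest_AtMost (fst p)). P' p q) \<longleftrightarrow>
    (\<exists>n RR C x. CAssert (AtMost n RR C) x \<in> set L \<and> P' (AtMost n RR C, x) (n, RR, C))"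
  "(\<exists>p\<in>set (conc_list L). \<exists>a\<in>set (dest_Atom (fst p)). P'' p a) \<longleftrightarrow>
    (\<exists>a x. CAssert (Atom a) x \<in> set L \<and> P'' (Atom a, x) a)"
  unfolding bex_conc_list bex_dest_concept fst_conv snd_conv by blast+

lemma bex_conc_number:
  "(\<exists>p\<in>set (conc_list L). \<exists>q\<in>set (dest_AtLeast (fst p) @ dest_AtMost (fst p)). P p q) \<longleftrightarrow>
    (\<exists>n RR C x. (CAssert (AtLeast n RR C) x \<in> set L \<and> P (AtLeast n RR C, x) (n, RR, C)) \<or>
      (CAssert (AtMost n RR C) x \<in> set L \<and> P (AtMost n RR C, x) (n, RR, C)))"
  unfolding bex_conc_list bex_dest_concept fst_conv snd_conv set_append bex_Un by blast

lemmas bex_simps_list = bex_concat_map bex_conc_dest bex_if_list fst_conv snd_conv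

lemma bex_and_steps:
  "(\<exists>B\<in>set (and_steps L). P B) \<longleftrightarrow> (\<exists>C D x. CAssert (And C D) x \<in> set L \<and>
     \<not> {CAssert C x, CAssert D x} \<subseteq> set L \<and> P (CAssert C x # CAssert D x # L))"
  unfolding and_steps_def bex_simps_list by auto

lemma bex_or_steps:
  "(\<exists>B\<in>set (or_steps L). P B) \<longleftrightarrow> (\<exists>C D x E. CAssert (Or C D) x \<in> set L \<and>
     {CAssert C x, CAssert D x} \<inter> set L = {} \<and> E \<in> {C, D} \<and> P (CAssert E x # L))"
  unfolding or_steps_def bex_simps_list by auto

lemma bex_ge_steps:
  assumes "wf_list L"
  shows "(\<exists>B\<in>set (ge_steps L). P B) \<longleftrightarrow> (\<exists>n RR C x Ss. CAssert (AtLeast n RR C) x \<in> set L \<and>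
      \<not> (\<exists>Y \<subseteq> csuccs (set L) RR C x. finite Y \<and> card Y = n \<and> pairwise_neq (set L) Y) \<and>
      length Ss = n \<and> set Ss \<subseteq> set RR \<and> P (new_list (fresh_list L) x C Ss @ L))"
proof -
  have wf: "wf_crole RR" if "CAssert (AtLeast n RR C) x \<in> set L" for n RR C x
    using assms that by (auto simp: wf_list_iff wf_abox_def)
  have "(\<exists>B\<in>set (ge_steps L). P B) \<longleftrightarrow> (\<exists>n RR C x. CAssert (AtLeast n RR C) x \<in> set L \<and>
      \<not> (\<exists>Y\<in>set (subseqs (csucc_list L RR C x)). length Y = n \<and> neq_list L Y) \<and>
      (\<exists>Ss. length Ss = n \<and> set Ss \<subseteq> set RR \<and> P (new_list (fresh_list L) x C Ss @ L)))"
    unfolding ge_steps_def bex_simps_list by (auto simp: set_n_lists)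
  also have "\<dots> \<longleftrightarrow> (\<exists>n RR C x. CAssert (AtLeast n RR C) x \<in> set L \<and>
      \<not> (\<exists>Y \<subseteq> csuccs (set L) RR C x. finite Y \<and> card Y = n \<and> pairwise_neq (set L) Y) \<and>
      (\<exists>Ss. length Ss = n \<and> set Ss \<subseteq> set RR \<and> P (new_list (fresh_list L) x C Ss @ L)))"
    by (simp only: bex_subseqs_csucc_list_eq[OF wf] cong: conj_cong)
  finally show ?thesis by (simp only: ex_simps(1,2)[symmetric])
qed

lemma bex_le_steps:
  assumes "wf_list L"
  shows "(\<exists>B\<in>set (le_steps L). P B) \<longleftrightarrow> (\<exists>n RR C x y z. CAssert (AtMost n RR C) x \<in> set L \<and>
      card (csuccs (set L) RR C x) > n \<and> y \<in> csuccs (set L) RR C x \<and> z \<in> csuccs (set L) RR C x \<and>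
      y \<noteq> z \<and> Neq y z \<notin> set L \<and> Neq z y \<notin> set L \<and> P (map (\<lambda>a. asubst y z a) L))"
proof -
  have wf: "wf_crole RR" if "CAssert (AtMost n RR C) x \<in> set L" for n RR C x
    using assms that by (auto simp: wf_list_iff wf_abox_def)
  have "(\<exists>B\<in>set (le_steps L). P B) \<longleftrightarrow> (\<exists>n RR C x. CAssert (AtMost n RR C) x \<in> set L \<and>
      length (csucc_list L RR C x) > n \<and> (\<exists>y\<in>set (csucc_list L RR C x). \<exists>z\<in>set (csucc_list L RR C x).
      y \<noteq> z \<and> Neq y z \<notin> set L \<and> Neq z y \<notin> set L \<and> P (map (\<lambda>a. asubst y z a) L)))"
    unfolding le_steps_def bex_simps_list by auto
  also have "\<dots> \<longleftrightarrow> (\<exists>n RR C x. CAssert (AtMost n RR C) x \<in> set L \<and>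
      card (csuccs (set L) RR C x) > n \<and> (\<exists>y\<in>csuccs (set L) RR C x. \<exists>z\<in>csuccs (set L) RR C x.
      y \<noteq> z \<and> Neq y z \<notin> set L \<and> Neq z y \<notin> set L \<and> P (map (\<lambda>a. asubst y z a) L)))"
    by (simp only: set_csucc_list[OF wf] length_csucc_list[OF wf] cong: conj_cong)
  finally show ?thesis by (simp only: Bex_def ex_simps(1,2)[symmetric] conj_assoc)
qed

lemma bex_choose_steps:
  assumes "wf_list L"
  shows "(\<exists>B\<in>set (choose_steps L). P B) \<longleftrightarrow> (\<exists>n RR C x y E.
      (CAssert (AtLeast n RR C) x \<in> set L \<or> CAssert (AtMost n RR C) x \<in> set L) \<and>
      y \<in> succs (set L) RR x \<and> {CAssert C y, CAssert (compl C) y} \<inter> set L = {} \<and>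
      E \<in> {C, compl C} \<and> P (CAssert E y # L))"
proof -
  have wf: "wf_crole RR" if "CAssert (AtLeast n RR C) x \<in> set L \<or> CAssert (AtMost n RR C) x \<in> set L" for n RR C x
    using assms that by (auto simp: wf_list_iff wf_abox_def)
  have "(\<exists>B\<in>set (choose_steps L). P B) \<longleftrightarrow> (\<exists>n RR C x.
      (CAssert (AtLeast n RR C) x \<in> set L \<or> CAssert (AtMost n RR C) x \<in> set L) \<and>
      (\<exists>y\<in>set (succ_list L RR x). {CAssert C y, CAssert (compl C) y} \<inter> set L = {} \<and>
      (\<exists>E\<in>{C, compl C}. P (CAssert E y # L))))"
    unfolding choose_steps_def bex_concat_map bex_conc_number bex_if_list fst_conv snd_conv
      conj_disj_distribR[symmetric] by simp
  also have "\<dots> \<longleftrightarrow> (\<exists>n RR C x.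
      (CAssert (AtLeast n RR C) x \<in> set L \<or> CAssert (AtMost n RR C) x \<in> set L) \<and>
      (\<exists>y\<in>succs (set L) RR x. {CAssert C y, CAssert (compl C) y} \<inter> set L = {} \<and>
      (\<exists>E\<in>{C, compl C}. P (CAssert E y # L))))"
    by (simp only: set_succ_list[OF wf] cong: conj_cong)
  finally show ?thesis by (simp only: Bex_def ex_simps[symmetric] conj_assoc)
qed

text \<open>Lists represent ABoxes up to order and repetition, so outcomes are compared as sets.
  Well-formedness enters through the number restrictions: for an ill-formed role
  \<open>succs\<close> can contain individuals that occur nowhere in the list.\<close>

lemma tab_step_steps:
  assumes "wf_list L"
  shows "tab_step (set L) B \<longleftrightarrow> (\<exists>L'\<in>set (steps L). B = set L')"
proof -
  have "(\<exists>L'\<in>set (steps L). B = set L') \<longleftrightarrow>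
      (\<exists>L'\<in>set (and_steps L). B = set L') \<or> (\<exists>L'\<in>set (or_steps L). B = set L') \<or>
      (\<exists>L'\<in>set (ge_steps L). B = set L') \<or> (\<exists>L'\<in>set (le_steps L). B = set L') \<or>
      (\<exists>L'\<in>set (choose_steps L). B = set L')"
    by (auto simp: steps_def)
  moreover have "B = set (CAssert C x # CAssert D x # L) \<longleftrightarrow> B = set L \<union> {CAssert C x, CAssert D x}" for C D x
    by auto
  moreover have "B = set (CAssert C x # L) \<longleftrightarrow> B = set L \<union> {CAssert C x}" for C x
    by auto
  moreover have "B = set (new_list (fresh_list L) x C Ss @ L) \<longleftrightarrow> B = set L \<union> new_succs (fresh (set L)) x C Ss"
    if "CAssert (AtLeast n RR C) x \<in> set L" for n RR x C Ss
    using that by (subst fresh_list_eq) (auto simp: set_new_list)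
  moreover have "B = set (map (\<lambda>a. asubst y z a) L) \<longleftrightarrow> B = asubst y z ` set L" for y z
    by auto
  ultimately have "(\<exists>L'\<in>set (steps L). B = set L') \<longleftrightarrow>
      (\<exists>C D x. CAssert (And C D) x \<in> set L \<and> \<not> {CAssert C x, CAssert D x} \<subseteq> set L \<and>
         B = set L \<union> {CAssert C x, CAssert D x}) \<or>
      (\<exists>C D x E. CAssert (Or C D) x \<in> set L \<and> {CAssert C x, CAssert D x} \<inter> set L = {} \<and> E \<in> {C, D} \<and>
         B = set L \<union> {CAssert E x}) \<or>
      (\<exists>n RR C x Ss. CAssert (AtLeast n RR C) x \<in> set L \<and>
        \<not> (\<exists>Y \<subseteq> csuccs (set L) RR C x. finite Y \<and> card Y = n \<and> pairwise_neq (set L) Y) \<and>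
        length Ss = n \<and> set Ss \<subseteq> set RR \<and> B = set L \<union> new_succs (fresh (set L)) x C Ss) \<or>
      (\<exists>n RR C x y z. CAssert (AtMost n RR C) x \<in> set L \<and>
        card (csuccs (set L) RR C x) > n \<and> y \<in> csuccs (set L) RR C x \<and> z \<in> csuccs (set L) RR C x \<and>
        y \<noteq> z \<and> Neq y z \<notin> set L \<and> Neq z y \<notin> set L \<and> B = asubst y z ` set L) \<or>
      (\<exists>n RR C x y E.
        (CAssert (AtLeast n RR C) x \<in> set L \<or> CAssert (AtMost n RR C) x \<in> set L) \<and>
        y \<in> succs (set L) RR x \<and> {CAssert C y, CAssert (compl C) y} \<inter> set L = {} \<and>
        E \<in> {C, compl C} \<and> B = set L \<union> {CAssert E y})"
    by (simp only: bex_and_steps bex_or_steps bex_ge_steps[OF assms] bex_le_steps[OF assms] bex_choose_steps[OF assms]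
        cong: conj_cong)
  moreover have "tab_step (set L) B \<longleftrightarrow> \<dots>"
    unfolding tab_step.simps[of "set L" B]
    by (intro arg_cong2[where f = "(\<or>)"]; iprover)
  ultimately show ?thesis by simp
qed

lemma clash_list_iff:
  assumes "wf_list L"
  shows "clash_list L \<longleftrightarrow> clash (set L)"
proof -
  have wf: "wf_crole RR" if "CAssert (AtMost n RR C) x \<in> set L" for n RR C x
    using assms that by (auto simp: wf_list_iff wf_abox_def)
  have "clash_list L \<longleftrightarrow> (\<exists>x. CAssert Bot x \<in> set L) \<or>
     (\<exists>a x. CAssert (Atom a) x \<in> set L \<and> CAssert (Neg (Atom a)) x \<in> set L) \<or>
     (\<exists>n RR C x. CAssert (AtMost n RR C) x \<in> set L \<and>
        (\<exists>Y\<in>set (subseqs (csucc_list L RR C x)). n < length Y \<and> neq_list L Y))"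
    unfolding clash_list_def bex_conc_dest bex_conc_list fst_conv snd_conv by simp
  also have "\<dots> \<longleftrightarrow> clash (set L)"
    unfolding clash_def by (simp only: bex_subseqs_csucc_list_less[OF wf] cong: conj_cong)
  finally show ?thesis .
qed

section \<open>Termination\<close>

text \<open>Negation has weight 0, so \<open>nnf\<close> never increases the size and
  \<open>compl C\<close> is smaller than any number restriction on \<open>C\<close>.\<close>

fun csize :: "concept \<Rightarrow> nat" where
  "csize Top = 1" | "csize Bot = 1" | "csize (Atom a) = 1" | "csize (Neg C) = csize C"
| "csize (And C D) = Suc (csize C + csize D)" | "csize (Or C D) = Suc (csize C + csize D)"
| "csize (ExR r C) = Suc (csize C)" | "csize (AllR r C) = Suc (csize C)"
| "csize (AtLeast n RR C) = Suc (csize C)" | "csize (AtMost n RR C) = Suc (csize C)"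

definition clen :: "crole \<Rightarrow> nat" where "clen RR = length (hd (hd RR))"

text \<open>A number restriction counts with the length of its chains, the distance at which its
  argument gets asserted. This makes \<open>depth C + lev x\<close> a quantity that the rules do not
  push beyond its initial bound.\<close>

fun depth :: "concept \<Rightarrow> nat" where
  "depth Top = 0" | "depth Bot = 0" | "depth (Atom a) = 0" | "depth (Neg C) = depth C"
| "depth (And C D) = max (depth C) (depth D)" | "depth (Or C D) = max (depth C) (depth D)"
| "depth (ExR r C) = Suc (depth C)" | "depth (AllR r C) = Suc (depth C)"
| "depth (AtLeast n RR C) = clen RR + depth C" | "depth (AtMost n RR C) = clen RR + depth C"

fun is_nnf :: "concept \<Rightarrow> bool" where
  "is_nnf Top = True" | "is_nnf Bot = True" | "is_nnf (Atom a) = True" | "is_nnf (Neg C) = (\<exists>a. C = Atom a)"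
| "is_nnf (And C D) = (is_nnf C \<and> is_nnf D)" | "is_nnf (Or C D) = (is_nnf C \<and> is_nnf D)"
| "is_nnf (ExR r C) = False" | "is_nnf (AllR r C) = False"
| "is_nnf (AtLeast n RR C) = is_nnf C" | "is_nnf (AtMost n RR C) = is_nnf C"

lemma csize_pos: "0 < csize C"
  by (induction C) auto

lemma csize_nnf: "csize (nnf p C) \<le> csize C"
  by (induction C arbitrary: p) (auto split: nat.split simp: csize_pos Suc_le_eq less_Suc_eq_le intro: add_mono)

lemma depth_nnf: "depth (nnf p C) \<le> depth C"
  by (induction C arbitrary: p) (auto split: nat.split simp: clen_def intro: max.mono max.coboundedI1 max.coboundedI2)

lemma is_nnf_nnf: "is_nnf (nnf p C)"
  by (induction C arbitrary: p) (auto split: nat.split)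

lemma wf_concept_nnf: "wf_concept C \<Longrightarrow> wf_concept (nnf p C)"
  by (induction C arbitrary: p) (auto split: nat.split simp: wf_crole_def)

text \<open>A subconcept closure that also contains \<open>compl C\<close> for each qualifier, since
  the choose-rule may assert either. A finite closed set bounds all concept assertions of a
  run.\<close>

definition closed :: "concept set \<Rightarrow> bool" where
  "closed F \<longleftrightarrow> (\<forall>C D. And C D \<in> F \<or> Or C D \<in> F \<longrightarrow> C \<in> F \<and> D \<in> F) \<and>
     (\<forall>n RR C. AtLeast n RR C \<in> F \<or> AtMost n RR C \<in> F \<longrightarrow> C \<in> F \<and> compl C \<in> F) \<and>
     (\<forall>C\<in>F. wf_concept C \<and> is_nnf C)"

lemma closed_binary: "closed F \<Longrightarrow> And C D \<in> F \<or> Or C D \<in> F \<Longrightarrow> C \<in> F \<and> D \<in> F"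
  unfolding closed_def by blast

lemma closed_number:
  assumes "closed F" "AtLeast n RR C \<in> F \<or> AtMost n RR C \<in> F"
  shows "wf_crole RR" "C \<in> F" "compl C \<in> F"
proof -
  have "wf_concept (AtLeast n RR C) \<or> wf_concept (AtMost n RR C)"
    using assms unfolding closed_def by blast
  then show "wf_crole RR" by simp
  show "C \<in> F" "compl C \<in> F" using assms unfolding closed_def by blast+
qed

lemma closed_Un: "closed F \<Longrightarrow> closed G \<Longrightarrow> closed (F \<union> G)"
  unfolding closed_def by blast

lemma closed_insert:
  assumes "closed F" "wf_concept C" "is_nnf C" "\<And>D E. C = And D E \<or> C = Or D E \<Longrightarrow> D \<in> F \<and> E \<in> F"
    "\<And>n RR D. C = AtLeast n RR D \<or> C = AtMost n RR D \<Longrightarrow> D \<in> F \<and> compl D \<in> F"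
  shows "closed (insert C F)"
  unfolding closed_def
proof (intro conjI allI ballI impI)
  fix D E assume "And D E \<in> insert C F \<or> Or D E \<in> insert C F"
  then show "D \<in> insert C F" "E \<in> insert C F" using assms(4)[of D E] closed_binary[OF assms(1), of D E] by blast+
next
  fix n RR D assume "AtLeast n RR D \<in> insert C F \<or> AtMost n RR D \<in> insert C F"
  then show "D \<in> insert C F" "compl D \<in> insert C F"
    using assms(5)[of n RR D] closed_number[OF assms(1), of n RR D] by blast+
next
  fix D assume "D \<in> insert C F"
  then show "wf_concept D" "is_nnf D" using assms(1-3) unfolding closed_def by blast+
qed

lemma closed_empty: "closed {}"
  by (simp add: closed_def)

text \<open>The induction is on the size because \<open>compl D\<close> is not a subconcept of a
  restriction on \<open>D\<close>, although it is smaller.\<close>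

lemma ex_closed: "wf_concept C \<Longrightarrow> is_nnf C \<Longrightarrow> \<exists>F. finite F \<and> closed F \<and> C \<in> F"
proof (induction "csize C" arbitrary: C rule: less_induct)
  case less
  have IH2: "\<exists>F. finite F \<and> closed F \<and> D \<in> F \<and> E \<in> F"
    if DE: "csize D < csize C" "csize E < csize C" "wf_concept D" "is_nnf D" "wf_concept E" "is_nnf E" for D E
  proof -
    obtain F G where "finite F" "closed F" "D \<in> F" "finite G" "closed G" "E \<in> G"
      using less.hyps[OF DE(1,3,4)] less.hyps[OF DE(2,5,6)] by blast
    then show ?thesis by (intro exI[of _ "F \<union> G"]) (auto intro: closed_Un)
  qed
  have IH3: "\<exists>F. finite F \<and> closed F \<and> D \<in> F \<and> compl D \<in> F"
    if "csize D < csize C" "wf_concept D" "is_nnf D" for D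
    using that csize_nnf[of False D] by (intro IH2) (auto simp: is_nnf_nnf wf_concept_nnf)
  show ?case
  proof (cases C)
    case (And D E)
    then obtain F where "finite F" "closed F" "D \<in> F" "E \<in> F" using IH2[of D E] less.prems by auto
    then show ?thesis using And less.prems
      by (intro exI[of _ "insert C F"]) (auto intro!: closed_insert)
  next
    case (Or D E)
    then obtain F where "finite F" "closed F" "D \<in> F" "E \<in> F" using IH2[of D E] less.prems by auto
    then show ?thesis using Or less.prems
      by (intro exI[of _ "insert C F"]) (auto intro!: closed_insert)
  next
    case (AtLeast n RR D)
    then obtain F where "finite F" "closed F" "D \<in> F" "compl D \<in> F" using IH3[of D] less.prems by auto
    then show ?thesis using AtLeast less.prems
      by (intro exI[of _ "insert C F"]) (auto intro!: closed_insert)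
  next
    case (AtMost n RR D)
    then obtain F where "finite F" "closed F" "D \<in> F" "compl D \<in> F" using IH3[of D] less.prems by auto
    then show ?thesis using AtMost less.prems
      by (intro exI[of _ "insert C F"]) (auto intro!: closed_insert)
  qed (use less.prems in \<open>auto intro!: exI[of _ "{C}"] closed_insert[OF closed_empty]\<close>)
qed

section \<open>Homomorphisms, paths and merging\<close>

lemma chain_rel_hom:
  assumes "\<And>r u v. (u, v) \<in> \<rho> r \<Longrightarrow> (h u, h v) \<in> \<rho>' r"
  shows "(x, y) \<in> chain_rel \<rho> ch \<Longrightarrow> (h x, h y) \<in> chain_rel \<rho>' ch"
proof (induction ch arbitrary: x)
  case (Cons r ch)
  then obtain z where "(x, z) \<in> \<rho> r" "(z, y) \<in> chain_rel \<rho> ch" by auto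
  then show ?case using assms[of x z r] Cons.IH[of z] by (auto intro: relcompI)
qed simp

text \<open>The same disjunct and the same chains work in the image. Applied with the identity to
  ABox inclusion, with a renaming to merging, and with an assignment to models.\<close>

lemma crole_rel_hom:
  assumes "\<And>r u v. (u, v) \<in> \<rho> r \<Longrightarrow> (h u, h v) \<in> \<rho>' r"
    and "(x, y) \<in> crole_rel \<rho> RR"
  shows "(h x, h y) \<in> crole_rel \<rho>' RR"
proof -
  obtain S where "S \<in> set RR" "\<forall>ch\<in>set S. (x, y) \<in> chain_rel \<rho> ch"
    using assms(2) by (auto simp: crole_rel_def)
  then have "\<forall>ch\<in>set S. (h x, h y) \<in> chain_rel \<rho>' ch"
    using chain_rel_hom[of \<rho> h \<rho>', OF assms(1)] by simp
  then show ?thesis using \<open>S \<in> set RR\<close> by (auto simp: crole_rel_def)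
qed

lemma chain_rel_path:
  "(\<And>l. l < length ch \<Longrightarrow> (f l, f (Suc l)) \<in> \<rho> (ch ! l)) \<Longrightarrow> (f 0, f (length ch)) \<in> chain_rel \<rho> ch"
proof (induction ch arbitrary: f)
  case (Cons r ch)
  have "(f 0, f 1) \<in> \<rho> r" using Cons.prems[of 0] by simp
  moreover have "(f (Suc 0), f (Suc (length ch))) \<in> chain_rel \<rho> ch"
    using Cons.IH[of "\<lambda>l. f (Suc l)"] Cons.prems[of "Suc _"] by auto
  ultimately show ?case by auto
qed simp

lemma chain_rel_pathE:
  "(x, y) \<in> chain_rel \<rho> ch \<Longrightarrow> \<exists>f. f 0 = x \<and> f (length ch) = y \<and> (\<forall>l<length ch. (f l, f (Suc l)) \<in> \<rho> (ch ! l))"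
proof (induction ch arbitrary: x)
  case (Cons r ch)
  then obtain z where z: "(x, z) \<in> \<rho> r" "(z, y) \<in> chain_rel \<rho> ch" by auto
  obtain f where f: "f 0 = z" "f (length ch) = y" "\<forall>l<length ch. (f l, f (Suc l)) \<in> \<rho> (ch ! l)"
    using Cons.IH[OF z(2)] by blast
  then show ?case
    by (intro exI[of _ "case_nat x f"]) (auto simp: z nth_Cons split: nat.split)
qed auto

definition ren :: "nat \<Rightarrow> nat \<Rightarrow> nat \<Rightarrow> nat" where "ren y z u = (if u = y then z else u)"

lemma asubst_ren:
  "asubst y z (CAssert C x) = CAssert C (ren y z x)"
  "asubst y z (RAssert r u v) = RAssert r (ren y z u) (ren y z v)"
  "asubst y z (Neq u v) = Neq (ren y z u) (ren y z v)"
  by (auto simp: ren_def)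

declare asubst.simps [simp del]

lemma mem_asubst_image:
  "CAssert C x \<in> asubst y z ` A \<longleftrightarrow> (\<exists>x'. CAssert C x' \<in> A \<and> x = ren y z x')" (is ?C)
  "RAssert r u v \<in> asubst y z ` A \<longleftrightarrow> (\<exists>u' v'. RAssert r u' v' \<in> A \<and> u = ren y z u' \<and> v = ren y z v')" (is ?R)
  "Neq u v \<in> asubst y z ` A \<longleftrightarrow> (\<exists>u' v'. Neq u' v' \<in> A \<and> u = ren y z u' \<and> v = ren y z v')" (is ?N)
proof -
  have "asubst y z a = CAssert C x \<longleftrightarrow> (\<exists>x'. a = CAssert C x' \<and> x = ren y z x')"
    "asubst y z a = RAssert r u v \<longleftrightarrow> (\<exists>u' v'. a = RAssert r u' v' \<and> u = ren y z u' \<and> v = ren y z v')"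
    "asubst y z a = Neq u v \<longleftrightarrow> (\<exists>u' v'. a = Neq u' v' \<and> u = ren y z u' \<and> v = ren y z v')" for a
    by (cases a; auto simp: asubst_ren)+
  then show ?C ?R ?N
    unfolding image_iff by metis+
qed

lemma inds_asubst: "inds (asubst y z ` A) = ren y z ` inds A"
proof -
  have "ainds (asubst y z a) = ren y z ` ainds a" for a
    by (cases a) (auto simp: asubst_ren)
  then show ?thesis by (auto simp: inds_def)
qed

lemma finite_inds: "finite A \<Longrightarrow> finite (inds A)"
proof -
  have "finite (ainds a)" for a by (cases a) auto
  then show "finite A \<Longrightarrow> finite (inds A)" by (auto simp: inds_def)
qed

lemma inds_less_fresh: "finite A \<Longrightarrow> u \<in> inds A \<Longrightarrow> u < fresh A"
  using finite_inds[of A] unfolding fresh_def inds_def by (simp add: less_Suc_eq_le)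

lemma inds_Un: "inds (A \<union> B) = inds A \<union> inds B"
  by (auto simp: inds_def)

lemma csuccs_mono: "A \<subseteq> B \<Longrightarrow> csuccs A RR C x \<subseteq> csuccs B RR C x"
proof -
  assume "A \<subseteq> B"
  have "(x, y) \<in> crole_rel (arole B) RR" if "(x, y) \<in> crole_rel (arole A) RR" for y
    by (rule crole_rel_hom[where h = "\<lambda>x. x" and \<rho> = "arole A"]) (use that \<open>A \<subseteq> B\<close> in auto)
  then show ?thesis using \<open>A \<subseteq> B\<close> unfolding csuccs_def succs_def by auto
qed

definition ge_sat :: "abox \<Rightarrow> nat \<Rightarrow> nat \<Rightarrow> crole \<Rightarrow> concept \<Rightarrow> bool" where
  "ge_sat A x n RR C \<longleftrightarrow> (\<exists>Y \<subseteq> csuccs A RR C x. finite Y \<and> card Y = n \<and> pairwise_neq A Y)"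

lemma ge_sat_mono: "A \<subseteq> B \<Longrightarrow> ge_sat A x n RR C \<Longrightarrow> ge_sat B x n RR C"
proof -
  assume AB: "A \<subseteq> B" and "ge_sat A x n RR C"
  then obtain Y where "Y \<subseteq> csuccs A RR C x" "finite Y" "card Y = n" "pairwise_neq A Y"
    unfolding ge_sat_def by blast
  then show ?thesis
    unfolding ge_sat_def using csuccs_mono[OF AB, of RR C x] AB
    by (intro exI[of _ Y]) (auto simp: pairwise_neq_def)
qed

lemma csuccs_asubst: "u \<in> csuccs A RR C x \<Longrightarrow> ren y z u \<in> csuccs (asubst y z ` A) RR C (ren y z x)"
proof -
  assume u: "u \<in> csuccs A RR C x"
  have "(ren y z x, ren y z u) \<in> crole_rel (arole (asubst y z ` A)) RR"
    by (rule crole_rel_hom[where h = "ren y z" and \<rho> = "arole A"])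
       (use u in \<open>auto simp: mem_asubst_image csuccs_def succs_def\<close>)
  then show ?thesis using u unfolding csuccs_def succs_def by (auto simp: mem_asubst_image)
qed

text \<open>The merged individuals \<open>y\<close> and \<open>z\<close> are not declared distinct,
  while the members of the witnessing set \<open>Y\<close> are. So \<open>Y\<close> does not contain
  both, the renaming is injective on it, and its size is preserved.\<close>

lemma ge_sat_asubst:
  assumes "Neq y z \<notin> A" "Neq z y \<notin> A" "ge_sat A x n RR C"
  shows "ge_sat (asubst y z ` A) (ren y z x) n RR C"
proof -
  obtain Y where Y: "Y \<subseteq> csuccs A RR C x" "finite Y" "card Y = n" "pairwise_neq A Y"
    using assms(3) unfolding ge_sat_def by blast
  have inj: "inj_on (ren y z) Y"
    using assms(1,2) Y(4) by (auto simp: inj_on_def ren_def pairwise_neq_def split: if_splits)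
  have "pairwise_neq (asubst y z ` A) (ren y z ` Y)"
    unfolding pairwise_neq_def
  proof (intro ballI impI)
    fix a b assume "a \<in> ren y z ` Y" "b \<in> ren y z ` Y" "a \<noteq> b"
    then obtain u v where "u \<in> Y" "v \<in> Y" "a = ren y z u" "b = ren y z v" "u \<noteq> v" by blast
    moreover from this have "Neq u v \<in> A" using Y(4) by (simp add: pairwise_neq_def)
    ultimately show "Neq a b \<in> asubst y z ` A" unfolding mem_asubst_image by blast
  qed
  then show ?thesis
    unfolding ge_sat_def using Y inj csuccs_asubst[of _ A RR C x y z]
    by (intro exI[of _ "ren y z ` Y"]) (auto simp: card_image)
qed

text \<open>The level function is constrained only by the assertions present, which leaves it free
  on names that do not occur yet; a \<open>\<ge>\<close>-step redefines it there.\<close>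

definition tab_inv :: "concept set \<Rightarrow> nat \<Rightarrow> (nat \<Rightarrow> nat) \<Rightarrow> abox \<Rightarrow> bool" where
  "tab_inv F D lev A \<longleftrightarrow> finite A \<and> (\<forall>C x. CAssert C x \<in> A \<longrightarrow> C \<in> F \<and> depth C + lev x \<le> D) \<and>
     (\<forall>r u v. RAssert r u v \<in> A \<longrightarrow> lev v = Suc (lev u))"

lemma clen: "wf_crole RR \<Longrightarrow> S \<in> set RR \<Longrightarrow> ch \<in> set S \<Longrightarrow> length ch = clen RR"
  unfolding wf_crole_def clen_def by (metis list.set_sel(1))

lemma clen_pos: "wf_crole RR \<Longrightarrow> 0 < clen RR"
  unfolding wf_crole_def clen_def by (metis list.set_sel(1) less_eq_Suc_le One_nat_def)

lemma chain_rel_level: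
  assumes "\<forall>r u v. RAssert r u v \<in> A \<longrightarrow> lev v = Suc (lev u)"
  shows "(x, y) \<in> chain_rel (arole A) ch \<Longrightarrow> lev y = lev x + length ch"
  by (induction ch arbitrary: x) (use assms in fastforce)+

text \<open>Any chain of any disjunct may be inspected, since all have length
  \<open>clen RR\<close>. Two successors of \<open>x\<close> for the same role thus share a level,
  and merging them is compatible with \<open>lev\<close>.\<close>

lemma succs_level:
  assumes "\<forall>r u v. RAssert r u v \<in> A \<longrightarrow> lev v = Suc (lev u)" "wf_crole RR" "y \<in> succs A RR x"
  shows "lev y = lev x + clen RR"
proof -
  obtain S where S: "S \<in> set RR" "\<forall>ch\<in>set S. (x, y) \<in> chain_rel (arole A) ch"
    using assms(3) by (auto simp: succs_def crole_rel_def)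
  obtain ch where ch: "ch \<in> set S" using wf_crole_nonempty(1)[OF assms(2) S(1)] by (metis list.set_sel(1))
  have "lev y = lev x + length ch"
    using chain_rel_level[of A lev x y ch] assms(1) S(2) ch by blast
  then show ?thesis using clen[OF assms(2) S(1) ch] by simp
qed

text \<open>
  Whether a restriction is asserted at \<open>x\<close> is deliberately ignored: assertions get added later, and
  the count must not increase when they are.
\<close>

definition unsat :: "concept set \<Rightarrow> (nat \<Rightarrow> nat) \<Rightarrow> abox \<Rightarrow> nat \<Rightarrow> (nat \<times> concept) set" where
  "unsat F lev A l = {(x, c). x \<in> inds A \<and> lev x = l \<and> c \<in> F \<and> (\<exists>n RR C. c = AtLeast n RR C \<and> \<not> ge_sat A x n RR C)}"

definition conc_pairs :: "abox \<Rightarrow> (concept \<times> nat) set" where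
  "conc_pairs A = {(C, x). CAssert C x \<in> A}"

text \<open>A \<open>\<ge>\<close>-step at level \<open>l\<close> may raise every entry after
  position \<open>l\<close>: it adds individuals, with unsatisfied restrictions at higher levels.
  Hence low levels come first and the two global counts last. The length depends on \<open>D\<close>
  alone, as \<open>lex\<close> compares only lists of equal length.\<close>

definition tab_measure :: "concept set \<Rightarrow> nat \<Rightarrow> (nat \<Rightarrow> nat) \<Rightarrow> abox \<Rightarrow> nat list" where
  "tab_measure F D lev A = map (\<lambda>l. card (unsat F lev A l)) [0..<Suc D] @
     [card (inds A), card (F \<times> inds A - conc_pairs A)]"

lemma finite_unsat: "finite F \<Longrightarrow> finite A \<Longrightarrow> finite (unsat F lev A l)"
  by (rule finite_subset[of _ "inds A \<times> F"]) (auto simp: unsat_def finite_inds)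

text \<open>The entries before position \<open>i\<close> only have to be non-increasing: if one of
  them already drops, the first such drop decides.\<close>

lemma lex_less_than:
  "length xs = length ys \<Longrightarrow> i < length xs \<Longrightarrow> xs ! i < ys ! i \<Longrightarrow> (\<And>j. j < i \<Longrightarrow> xs ! j \<le> ys ! j) \<Longrightarrow>
   (xs, ys) \<in> lex less_than"
proof (induction xs ys arbitrary: i rule: list_induct2)
  case (Cons x xs y ys)
  show ?case
  proof (cases i)
    case 0
    then show ?thesis using Cons by simp
  next
    case (Suc j)
    then have "(xs, ys) \<in> lex less_than"
      using Cons.prems(3)[of "Suc _"] Cons.prems(1,2) by (intro Cons.IH[of j]) auto
    moreover have "x \<le> y" using Cons.prems(3)[of 0] Suc by simp
    ultimately show ?thesis using Cons.hyps by (auto simp: le_less)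
  qed
qed simp

lemma nth_tab_measure:
  "l \<le> D \<Longrightarrow> tab_measure F D lev A ! l = card (unsat F lev A l)"
  "tab_measure F D lev A ! Suc D = card (inds A)"
  "tab_measure F D lev A ! Suc (Suc D) = card (F \<times> inds A - conc_pairs A)"
  by (auto simp: tab_measure_def nth_append simp del: upt_Suc)

lemma length_tab_measure: "length (tab_measure F D lev A) = Suc (Suc (Suc D))"
  by (simp add: tab_measure_def)

text \<open>Covers the \<open>\<sqinter>\<close>-, \<open>\<squnion>\<close>- and choose-rule at
  once. More assertions can only satisfy more restrictions and the individuals stay the same, so the
  last entry, counting concept assertions still missing, decides.\<close>

lemma tab_measure_add_concepts:
  assumes F: "finite F" and A: "tab_inv F D lev A" and B: "B = A \<union> N" "\<not> N \<subseteq> A" "finite N"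
    and N: "\<And>a. a \<in> N \<Longrightarrow> \<exists>C x. a = CAssert C x \<and> C \<in> F \<and> x \<in> inds A \<and> depth C + lev x \<le> D"
  shows "tab_inv F D lev B \<and> (tab_measure F D lev B, tab_measure F D lev A) \<in> lex less_than"
proof
  have fin: "finite A" using A by (simp add: tab_inv_def)
  show "tab_inv F D lev B"
    using A B(3) N unfolding tab_inv_def B(1) by blast
  have inds: "inds B = inds A"
    using N unfolding B(1) inds_Un by (force simp: inds_def[of N])
  have le: "card (unsat F lev B l) \<le> card (unsat F lev A l)" for l
  proof (intro card_mono finite_unsat F fin)
    have "A \<subseteq> B" using B(1) by simp
    then show "unsat F lev B l \<subseteq> unsat F lev A l"
      using ge_sat_mono unfolding unsat_def inds by blast
  qed
  obtain C x where Cx: "CAssert C x \<in> N" "CAssert C x \<notin> A" "C \<in> F" "x \<in> inds A" using B(2) N by blast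
  have "card (F \<times> inds B - conc_pairs B) < card (F \<times> inds A - conc_pairs A)"
    unfolding inds
  proof (rule psubset_card_mono)
    show "finite (F \<times> inds A - conc_pairs A)" using F fin finite_inds by auto
    have "(C, x) \<in> F \<times> inds A - conc_pairs A" "(C, x) \<notin> F \<times> inds A - conc_pairs B"
      using Cx by (auto simp: conc_pairs_def B(1))
    then show "F \<times> inds A - conc_pairs B \<subset> F \<times> inds A - conc_pairs A"
      unfolding conc_pairs_def B(1) by auto
  qed
  then show "(tab_measure F D lev B, tab_measure F D lev A) \<in> lex less_than"
    using le inds
    by (intro lex_less_than[of _ _ "Suc (Suc D)"]) (auto simp: nth_tab_measure length_tab_measure less_Suc_eq)
qed

text \<open>The name \<open>y\<close> disappears, which lowers the number of individuals; the counts
  in front of it cannot grow because \<open>ge_sat_asubst\<close> transfers satisfied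
  restrictions.\<close>

lemma tab_measure_merge:
  assumes F: "finite F" and A: "tab_inv F D lev A"
    and yz: "y \<noteq> z" "lev y = lev z" "y \<in> inds A" "z \<in> inds A" "Neq y z \<notin> A" "Neq z y \<notin> A"
    and B: "B = asubst y z ` A"
  shows "tab_inv F D lev B \<and> (tab_measure F D lev B, tab_measure F D lev A) \<in> lex less_than"
proof
  have fin: "finite A" using A by (simp add: tab_inv_def)
  have lev: "lev (ren y z u) = lev u" for u using yz by (simp add: ren_def)
  show "tab_inv F D lev B"
    using A unfolding tab_inv_def B mem_asubst_image by (auto simp: lev)
  have inds: "inds B \<subseteq> inds A - {y}"
    unfolding B inds_asubst using yz by (auto simp: ren_def)
  have "unsat F lev B l \<subseteq> unsat F lev A l" for l
  proof
    fix p assume "p \<in> unsat F lev B l"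
    then obtain x n RR C where p: "p = (x, AtLeast n RR C)" "x \<in> inds B" "lev x = l" "AtLeast n RR C \<in> F"
      "\<not> ge_sat B x n RR C" by (auto simp: unsat_def)
    \<comment> \<open>An individual that survives the merge differs from \<open>y\<close>, so the
      renaming fixes it.\<close>
    then have "x \<in> inds A" "ren y z x = x" using inds by (auto simp: ren_def)
    then have "\<not> ge_sat A x n RR C"
      using p(5) ge_sat_asubst[OF yz(5,6), of x n RR C] B by auto
    then show "p \<in> unsat F lev A l" using p \<open>x \<in> inds A\<close> by (auto simp: unsat_def)
  qed
  then have le: "card (unsat F lev B l) \<le> card (unsat F lev A l)" for l
    by (intro card_mono finite_unsat F fin)
  have "inds B \<subset> inds A" using inds yz(3) by auto
  then have "card (inds B) < card (inds A)"
    using finite_inds[OF fin] by (rule psubset_card_mono[rotated])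
  then show "(tab_measure F D lev B, tab_measure F D lev A) \<in> lex less_than"
    using le by (intro lex_less_than[of _ _ "Suc D"]) (auto simp: nth_tab_measure length_tab_measure less_Suc_eq_le)
qed

text \<open>Reads off the position \<open>l\<close> on a new chain by inverting the naming scheme of \<open>chain_node\<close>.\<close>

definition fresh_level :: "nat \<Rightarrow> nat \<Rightarrow> nat \<Rightarrow> (nat \<Rightarrow> nat) \<Rightarrow> nat \<Rightarrow> nat" where
  "fresh_level N x m lev v = (if v < N then lev v
     else lev x + (case psnd (v - N) of 0 \<Rightarrow> m | Suc p \<Rightarrow> psnd p))"

lemma fresh_level_chain_node:
  "x < N \<Longrightarrow> l \<le> m \<Longrightarrow> fresh_level N x m lev (chain_node N x m k j l) = lev x + l"
  by (auto simp: fresh_level_def chain_node_def fresh_succ_def)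

lemma fresh_level_fresh_succ: "fresh_level N x m lev (fresh_succ N k) = lev x + m"
  by (auto simp: fresh_level_def fresh_succ_def)

lemma inj_fresh_succ: "fresh_succ N k = fresh_succ N k' \<longleftrightarrow> k = k'"
  by (auto simp: fresh_succ_def)

lemma new_succs_ge_sat:
  assumes wf: "wf_crole RR" and Ss: "length Ss = n" "set Ss \<subseteq> set RR"
  shows "ge_sat (A \<union> new_succs N x C Ss) x n RR C"
proof -
  let ?B = "A \<union> new_succs N x C Ss"
  let ?Y = "fresh_succ N ` {..<n}"
  have "fresh_succ N k \<in> csuccs ?B RR C x" if k: "k < n" for k
  proof -
    have S: "Ss ! k \<in> set RR" using Ss k by auto
    have "(x, fresh_succ N k) \<in> chain_rel (arole ?B) ch" if "ch \<in> set (Ss ! k)" for ch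
    proof -
      obtain j where j: "j < length (Ss ! k)" "ch = Ss ! k ! j" using \<open>ch \<in> set (Ss ! k)\<close> by (metis in_set_conv_nth)
      \<comment> \<open>Positive length matters: \<open>chain_node\<close> tests
        \<open>l = 0\<close> first, so a chain of length 0 would end in \<open>x\<close> instead of
        the new successor.\<close>
      have pos: "0 < length ch" using clen[OF wf S that] clen_pos[OF wf] by simp
      have "(chain_node N x (length ch) k j 0, chain_node N x (length ch) k j (length ch)) \<in> chain_rel (arole ?B) ch"
      proof (rule chain_rel_path)
        fix l assume "l < length ch"
        then have "RAssert (ch ! l) (chain_node N x (length ch) k j l) (chain_node N x (length ch) k j (Suc l)) \<in> new_succs N x C Ss"
          unfolding new_succs_def using j k Ss by blast
        then show "(chain_node N x (length ch) k j l, chain_node N x (length ch) k j (Suc l)) \<in> arole ?B (ch ! l)"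
          by simp
      qed
      then show ?thesis using pos by (simp add: chain_node_def)
    qed
    then have "fresh_succ N k \<in> succs ?B RR x"
      using S unfolding succs_def crole_rel_def by blast
    moreover have "CAssert C (fresh_succ N k) \<in> ?B"
      using k Ss by (auto simp: new_succs_def)
    ultimately show ?thesis by (simp add: csuccs_def)
  qed
  moreover have "card ?Y = n" by (simp add: card_image inj_on_def inj_fresh_succ)
  moreover have "pairwise_neq ?B ?Y"
    using Ss unfolding pairwise_neq_def new_succs_def by fastforce
  ultimately show ?thesis
    unfolding ge_sat_def by (intro exI[of _ ?Y]) auto
qed

lemma tab_measure_new_succs:
  assumes F: "finite F" "closed F" and A: "tab_inv F D lev A"
    and x: "CAssert (AtLeast n RR C) x \<in> A" "\<not> ge_sat A x n RR C" "length Ss = n" "set Ss \<subseteq> set RR"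
    and B: "B = A \<union> new_succs (fresh A) x C Ss"
  shows "\<exists>lev'. tab_inv F D lev' B \<and> (tab_measure F D lev' B, tab_measure F D lev A) \<in> lex less_than"
proof -
  let ?N = "fresh A"
  define m where "m = clen RR"
  \<comment> \<open>Agrees with \<open>lev\<close> below \<open>fresh A\<close>, hence on all old
    individuals, and places a new one at its distance from \<open>x\<close>.\<close>
  define lev' where "lev' = fresh_level ?N x m lev"
  have fin: "finite A" using A by (simp add: tab_inv_def)
  have inF: "AtLeast n RR C \<in> F" using A x by (auto simp: tab_inv_def)
  have wf: "wf_crole RR" and C: "C \<in> F" using closed_number[OF F(2)] inF by blast+
  have m: "0 < m" using clen_pos[OF wf] by (simp add: m_def)
  have len: "length (Ss ! k ! j) = m" if "k < length Ss" "j < length (Ss ! k)" for k j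
    using clen[OF wf subsetD[OF x(4) nth_mem[OF that(1)]] nth_mem[OF that(2)]] by (simp add: m_def)
  have xN: "x < ?N" using inds_less_fresh[OF fin] CAssert_inds[OF x(1)] by blast
  have lev: "lev' u = lev u" if "u \<in> inds A" for u
    using inds_less_fresh[OF fin that] by (simp add: lev'_def fresh_level_def)
  have node: "lev' (chain_node ?N x m k j l) = lev x + l" if "l \<le> m" for k j l
    using fresh_level_chain_node[OF xN that] by (simp add: lev'_def)
  have fsucc: "lev' (fresh_succ ?N k) = lev x + m" for k
    by (simp add: lev'_def fresh_level_fresh_succ)
  have new: "RAssert r u v \<in> new_succs ?N x C Ss \<Longrightarrow>
      \<exists>k j l. l < m \<and> u = chain_node ?N x m k j l \<and> v = chain_node ?N x m k j (Suc l)" for r u v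
    unfolding new_succs_def using len by fastforce
  have inv: "tab_inv F D lev' B"
    unfolding tab_inv_def
  proof (intro conjI allI impI)
    show "finite B" using fin finite_new_succs unfolding B by blast
    fix E u assume Eu: "CAssert E u \<in> B"
    then consider "CAssert E u \<in> A" | k where "E = C" "u = fresh_succ ?N k"
      unfolding B by (auto simp: new_succs_def)
    then have "E \<in> F \<and> depth E + lev' u \<le> D"
    proof cases
      case 1
      then show ?thesis using A lev[OF CAssert_inds[OF 1]] by (auto simp: tab_inv_def)
    next
      case 2
      \<comment> \<open>The restriction has depth \<open>clen RR + depth C\<close>; its first
        summand pays for asserting \<open>C\<close> exactly \<open>clen RR\<close> levels above
        \<open>x\<close>.\<close>
      have "depth (AtLeast n RR C) + lev x \<le> D" using A x(1) unfolding tab_inv_def by blast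
      then show ?thesis using 2 C by (simp add: fsucc m_def)
    qed
    then show "E \<in> F" "depth E + lev' u \<le> D" by auto
  next
    fix r u v assume "RAssert r u v \<in> B"
    then consider "RAssert r u v \<in> A" | "RAssert r u v \<in> new_succs ?N x C Ss"
      unfolding B by blast
    then show "lev' v = Suc (lev' u)"
    proof cases
      case 1
      then show ?thesis using A lev RAssert_inds[OF 1] by (auto simp: tab_inv_def)
    next
      case 2
      then show ?thesis using new[OF 2] node by auto
    qed
  qed
  have new_inds: "u \<in> inds A \<or> lev x < lev' u" if "u \<in> inds B" for u
  proof -
    have "u \<in> inds A \<or> u \<in> inds (new_succs ?N x C Ss)" using that by (simp add: B inds_Un)
    moreover have "u = x \<or> lev x < lev' u" if u: "u \<in> inds (new_succs ?N x C Ss)"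
    proof -
      obtain a where a: "a \<in> new_succs ?N x C Ss" "u \<in> ainds a" using u by (auto simp: inds_def)
      show ?thesis
      proof (cases a)
        case (CAssert E w)
        then show ?thesis using a fsucc m by (auto simp: new_succs_def)
      next
        case (RAssert r v w)
        then obtain k j l where l: "l < m" "v = chain_node ?N x m k j l" "w = chain_node ?N x m k j (Suc l)"
          using new a(1) by blast
        have "v = x \<or> lev x < lev' v"
          using node[of l k j] l by (cases "l = 0") (auto simp: chain_node_def)
        moreover have "lev x < lev' w" using node[of "Suc l" k j] l by auto
        ultimately show ?thesis using RAssert a(2) by auto
      next
        case (Neq v w)
        then show ?thesis using a fsucc m by (auto simp: new_succs_def)
      qed
    qed
    ultimately show ?thesis using CAssert_inds[OF x(1)] by blast
  qed
  have sub: "unsat F lev' B l \<subseteq> unsat F lev A l" if "l \<le> lev x" for l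
  proof
    fix p assume "p \<in> unsat F lev' B l"
    then obtain u n RR C where p: "p = (u, AtLeast n RR C)" "u \<in> inds B" "lev' u = l" "AtLeast n RR C \<in> F"
      "\<not> ge_sat B u n RR C" by (auto simp: unsat_def)
    have "u \<in> inds A" using new_inds[OF p(2)] p(3) that by auto
    then show "p \<in> unsat F lev A l"
      using p lev ge_sat_mono[of A B u n RR C] by (auto simp: unsat_def B)
  qed
  have "(x, AtLeast n RR C) \<in> unsat F lev A (lev x)"
    using inF x(2) CAssert_inds[OF x(1)] by (auto simp: unsat_def)
  moreover have "(x, AtLeast n RR C) \<notin> unsat F lev' B (lev x)"
    using new_succs_ge_sat[OF wf x(3,4), of A ?N x C] by (auto simp: unsat_def B)
  ultimately have "unsat F lev' B (lev x) \<subset> unsat F lev A (lev x)" using sub by blast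
  then have lt: "card (unsat F lev' B (lev x)) < card (unsat F lev A (lev x))"
    using finite_unsat[OF F(1) fin] by (rule psubset_card_mono[rotated])
  have le: "card (unsat F lev' B l) \<le> card (unsat F lev A l)" if "l < lev x" for l
    using sub[of l] that finite_unsat[OF F(1) fin] by (intro card_mono) auto
  \<comment> \<open>This puts the decreasing position \<open>lev x\<close> among the level counts 0
    to \<open>D\<close>.\<close>
  have "lev x \<le> D" using A x(1) unfolding tab_inv_def by (meson add_leD2)
  then have "(tab_measure F D lev' B, tab_measure F D lev A) \<in> lex less_than"
    using lt le by (intro lex_less_than[of _ _ "lev x"]) (auto simp: nth_tab_measure length_tab_measure)
  with inv show ?thesis by blast
qed

lemma tab_step_decreases:
  assumes F: "finite F" "closed F" and A: "tab_inv F D lev A" and step: "tab_step A B"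
  shows "\<exists>lev'. tab_inv F D lev' B \<and> (tab_measure F D lev' B, tab_measure F D lev A) \<in> lex less_than"
proof -
  have inA: "C \<in> F" "depth C + lev x \<le> D" "x \<in> inds A" if "CAssert C x \<in> A" for C x
    using A that CAssert_inds by (auto simp: tab_inv_def)
  have lev: "\<forall>r u v. RAssert r u v \<in> A \<longrightarrow> lev v = Suc (lev u)" using A by (auto simp: tab_inv_def)
  from step show ?thesis
  proof cases
    case (and_rule C D' x)
    then show ?thesis using closed_binary[OF F(2), of C D'] inA[OF and_rule(2)]
      by (intro exI[of _ lev] tab_measure_add_concepts[OF F(1) A, of _ "{CAssert C x, CAssert D' x}"]) auto
  next
    case (or_rule C D' x E)
    then show ?thesis using closed_binary[OF F(2), of C D'] inA[OF or_rule(2)]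
      by (intro exI[of _ lev] tab_measure_add_concepts[OF F(1) A, of _ "{CAssert E x}"]) auto
  next
    case (ge_rule n RR C x Ss)
    show ?thesis
      by (rule tab_measure_new_succs[OF F A ge_rule(2) _ ge_rule(4,5,1)]) (use ge_rule(3) in \<open>simp add: ge_sat_def\<close>)
  next
    case (le_rule n RR C x y z)
    have wf: "wf_crole RR" using closed_number[OF F(2)] inA(1)[OF le_rule(2)] by blast
    have yz: "y \<in> succs A RR x" "z \<in> succs A RR x" using le_rule(4,5) by (auto simp: csuccs_def)
    have "lev y = lev z" using succs_level[OF lev wf yz(1)] succs_level[OF lev wf yz(2)] by simp
    then show ?thesis
      using succs_inds[OF wf yz(1)] succs_inds[OF wf yz(2)] le_rule
      by (intro exI[of _ lev] tab_measure_merge[OF F(1) A, of y z]) auto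
  next
    case (choose_rule n RR C x y E)
    have inF: "AtLeast n RR C \<in> F \<or> AtMost n RR C \<in> F" and d: "clen RR + depth C + lev x \<le> D"
      using choose_rule(2) inA(1) inA(2)[of "AtLeast n RR C" x] inA(2)[of "AtMost n RR C" x] by auto
    have wf: "wf_crole RR" and "C \<in> F" "compl C \<in> F" using closed_number[OF F(2) inF] by blast+
    moreover have "lev y = lev x + clen RR" using succs_level[OF lev wf choose_rule(3)] .
    ultimately show ?thesis
      using succs_inds[OF wf choose_rule(3)] choose_rule d depth_nnf[of False C]
      by (intro exI[of _ lev] tab_measure_add_concepts[OF F(1) A, of _ "{CAssert E y}"]) auto
  qed
qed

text \<open>Accessibility rather than the absence of infinite runs: it is an induction principle
  along rule applications, used again for completeness of the tableau and for decidability.\<close>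

abbreviation terminating :: "abox \<Rightarrow> bool" where
  "terminating \<equiv> Wellfounded.accp (\<lambda>B A. tab_step A B)"

lemma terminating_if_tab_inv:
  assumes F: "finite F" "closed F"
  shows "tab_inv F D lev A \<Longrightarrow> terminating A"
proof (induction "tab_measure F D lev A" arbitrary: lev A rule: wf_induct_rule[OF wf_lex[OF wf_less_than]])
  case (1 lev A)
  show ?case
  proof (rule accpI)
    fix B assume "tab_step A B"
    then obtain lev' where "tab_inv F D lev' B" "(tab_measure F D lev' B, tab_measure F D lev A) \<in> lex less_than"
      using tab_step_decreases[OF F 1(2)] by blast
    then show "terminating B" using 1(1) by blast
  qed
qed

lemma terminating_init: "wf_concept C \<Longrightarrow> terminating (init_abox C)"
proof -
  assume "wf_concept C"
  then obtain F where F: "finite F" "closed F" "nnf True C \<in> F"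
    using ex_closed[OF wf_concept_nnf is_nnf_nnf] by blast
  then have "tab_inv F (depth (nnf True C)) (\<lambda>_. 0) (init_abox C)"
    by (auto simp: tab_inv_def init_abox_def)
  then show ?thesis using terminating_if_tab_inv F by blast
qed

lemma tableau_terminates: "wf_concept C \<Longrightarrow> tableau_terminates C"
proof -
  have "\<not> (\<exists>f. f 0 = A \<and> (\<forall>i. tab_step (f i) (f (Suc i))))" if "terminating A" for A
    using that
  proof (induction rule: accp.induct)
    case (accI A)
    show ?case
    proof
      assume "\<exists>f. f 0 = A \<and> (\<forall>i. tab_step (f i) (f (Suc i)))"
      then obtain f where f: "f 0 = A" "\<And>i. tab_step (f i) (f (Suc i))" by blast
      then have "\<exists>g. g 0 = f 1 \<and> (\<forall>i. tab_step (g i) (g (Suc i)))"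
        by (intro exI[of _ "\<lambda>i. f (Suc i)"]) auto
      then show False using accI.IH[of "f 1"] f(2)[of 0] f(1) by auto
    qed
  qed
  then show "wf_concept C \<Longrightarrow> tableau_terminates C"
    using terminating_init unfolding tableau_terminates_def by blast
qed

section \<open>Correctness of the tableau\<close>

lemma cext_subset: "is_interp I \<Longrightarrow> cext I C \<subseteq> univ I"
  by (induction C) (auto simp: is_interp_def)

lemma chain_rel_univ:
  assumes "is_interp I" "(x, y) \<in> chain_rel (role I) ch" "ch \<noteq> []"
  shows "y \<in> univ I"
  using assms(2,3)
proof (induction ch arbitrary: x)
  case (Cons r ch)
  then show ?case using assms(1) by (cases ch) (auto simp: is_interp_def)
qed simp

lemma crole_rel_univ:
  assumes "is_interp I" "wf_crole RR" "(x, y) \<in> crole_rel (role I) RR"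
  shows "y \<in> univ I"
proof -
  obtain S where S: "S \<in> set RR" "\<forall>ch\<in>set S. (x, y) \<in> chain_rel (role I) ch"
    using assms(3) by (auto simp: crole_rel_def)
  obtain ch where "ch \<in> set S" using wf_crole_nonempty(1)[OF assms(2) S(1)] by (metis list.set_sel(1))
  then show ?thesis
    using S(2) chain_rel_univ[OF assms(1), of x y ch] wf_crole_nonempty(2)[OF assms(2) S(1)] by blast
qed

lemma crole_rel_atomic: "crole_rel \<rho> [[[r]]] = \<rho> r"
  by (simp add: crole_rel_def)

lemma card_ge_1_iff: "infinite X \<or> Suc 0 \<le> card X \<longleftrightarrow> X \<noteq> {}"
  by (cases "finite X") (auto simp: Suc_le_eq card_gt_0_iff)

lemma card_le_0_iff: "finite X \<and> card X \<le> 0 \<longleftrightarrow> X = {}"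
  by auto

lemma cext_atomic:
  "cext I (AtLeast 1 [[[r]]] C) = {x \<in> univ I. \<exists>y. (x, y) \<in> role I r \<and> y \<in> cext I C}"
  "cext I (AtMost 0 [[[r]]] C) = {x \<in> univ I. \<not> (\<exists>y. (x, y) \<in> role I r \<and> y \<in> cext I C)}"
  unfolding cext.simps crole_rel_atomic One_nat_def card_ge_1_iff card_le_0_iff by blast+

text \<open>At-least admits infinite successor sets and at-most demands finiteness, so the two are
  exact complements although \<open>card\<close> of an infinite set is 0. The negation of at-least 0
  has no at-most counterpart and becomes \<open>Bot\<close>.\<close>

lemma cext_nnf:
  assumes I: "is_interp I"
  shows "wf_concept C \<Longrightarrow> cext I (nnf p C) = (if p then cext I C else univ I - cext I C)"
proof (induction C arbitrary: p)
  case (ExR r C)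
  then have IH: "cext I (nnf True C) = cext I C" by simp
  show ?case
    unfolding nnf.simps by (cases p; simp only: if_True if_False cext_atomic IH cext.simps(7,8); blast)
next
  case (AllR r C)
  then have IH: "cext I (nnf False C) = univ I - cext I C" by simp
  have "role I r \<subseteq> univ I \<times> univ I" using I by (simp add: is_interp_def)
  then show ?case
    unfolding nnf.simps by (cases p; simp only: if_True if_False cext_atomic IH cext.simps(7,8); blast)
next
  case (AtLeast n RR C)
  then have IH: "cext I (nnf True C) = cext I C" by simp
  show ?case by (cases p; cases n) (auto simp: IH not_le less_Suc_eq_le Suc_le_eq)
next
  case (AtMost n RR C)
  then have IH: "cext I (nnf True C) = cext I C" by simp
  show ?case by (cases p) (auto simp: IH not_le Suc_le_eq)
qed (use cext_subset[OF I] in \<open>auto split: if_splits\<close>)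

section \<open>Completeness: following a model through the rules\<close>

definition models :: "'d interp \<Rightarrow> (nat \<Rightarrow> 'd) \<Rightarrow> abox \<Rightarrow> bool" where
  "models I \<pi> A \<longleftrightarrow> (\<forall>C x. CAssert C x \<in> A \<longrightarrow> \<pi> x \<in> cext I C) \<and>
     (\<forall>r u v. RAssert r u v \<in> A \<longrightarrow> (\<pi> u, \<pi> v) \<in> role I r) \<and>
     (\<forall>u v. Neq u v \<in> A \<longrightarrow> \<pi> u \<noteq> \<pi> v)"

lemma models_succs: "models I \<pi> A \<Longrightarrow> y \<in> succs A RR x \<Longrightarrow> (\<pi> x, \<pi> y) \<in> crole_rel (role I) RR"
  by (rule crole_rel_hom[of "arole A"]) (auto simp: models_def succs_def)

lemma models_csuccs: "models I \<pi> A \<Longrightarrow> y \<in> csuccs A RR C x \<Longrightarrow>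
    \<pi> y \<in> {y. (\<pi> x, y) \<in> crole_rel (role I) RR \<and> y \<in> cext I C}"
  using models_succs[of I \<pi> A y RR x] by (auto simp: csuccs_def models_def)

lemma wf_abox_number:
  assumes "wf_abox A" "CAssert (AtLeast n RR C) x \<in> A \<or> CAssert (AtMost n RR C) x \<in> A"
  shows "wf_crole RR" "wf_concept C"
proof -
  have "wf_concept (AtLeast n RR C) \<or> wf_concept (AtMost n RR C)"
    using assms unfolding wf_abox_def by blast
  then show "wf_crole RR" "wf_concept C" by auto
qed

lemma wf_abox_step: "wf_abox A \<Longrightarrow> tab_step A B \<Longrightarrow> wf_abox B"
proof -
  assume A: "wf_abox A" and step: "tab_step A B"
  have wf: "wf_concept C" if "CAssert C x \<in> A" for C x using A that by (auto simp: wf_abox_def)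
  from step show "wf_abox B"
  proof cases
    case (and_rule C D x)
    then show ?thesis using A wf[of "And C D" x] by (auto simp: wf_abox_def)
  next
    case (or_rule C D x E)
    then show ?thesis using A wf[of "Or C D" x] by (auto simp: wf_abox_def)
  next
    case (ge_rule n RR C x Ss)
    then show ?thesis using A wf_abox_number(2)[OF A, of n RR C x] finite_new_succs
      by (auto simp: wf_abox_def new_succs_def)
  next
    case (le_rule n RR C x y z)
    then show ?thesis using A by (auto simp: wf_abox_def mem_asubst_image)
  next
    case (choose_rule n RR C x y E)
    then show ?thesis using A wf_abox_number(2)[OF A choose_rule(2)] wf_concept_nnf[of C False]
      by (auto simp: wf_abox_def)
  qed
qed

text \<open>The model supplies \<open>n\<close> distinct witnesses, a disjunct through which each is
  reached and, for every chain of that disjunct, a path. The disjuncts are the nondeterministic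
  choice of the rule; the paths interpret the fresh inner individuals.\<close>

lemma models_new_succs:
  assumes I: "is_interp I" and A: "models I \<pi> A" "wf_abox A" and x: "CAssert (AtLeast n RR C) x \<in> A"
  shows "\<exists>Ss \<pi>'. length Ss = n \<and> set Ss \<subseteq> set RR \<and> models I \<pi>' (A \<union> new_succs (fresh A) x C Ss)"
proof -
  let ?N = "fresh A"
  let ?Z = "{y. (\<pi> x, y) \<in> crole_rel (role I) RR \<and> y \<in> cext I C}"
  have wf: "wf_crole RR" using wf_abox_number[OF A(2)] x by blast
  have fin: "finite A" using A by (simp add: wf_abox_def)
  have "\<pi> x \<in> cext I (AtLeast n RR C)" using A(1) x by (auto simp: models_def simp del: cext.simps)
  then have "infinite ?Z \<or> n \<le> card ?Z" by simp
  then have "\<exists>Z. Z \<subseteq> ?Z \<and> finite Z \<and> card Z = n"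
  proof
    assume "infinite ?Z"
    then show ?thesis using infinite_arbitrarily_large[of ?Z n] by blast
  next
    assume "n \<le> card ?Z"
    then show ?thesis using obtain_subset_with_card_n[of n ?Z] by metis
  qed
  then obtain Z where Z: "Z \<subseteq> ?Z" "finite Z" "card Z = n" by blast
  then obtain z where z: "bij_betw z {0..<n} Z" using ex_bij_betw_nat_finite by blast
  have zZ: "z k \<in> ?Z" if "k < n" for k
  proof -
    have "z k \<in> Z" using z that by (auto simp: bij_betw_def)
    then show ?thesis using Z(1) by blast
  qed
  then have "\<exists>S\<in>set RR. \<forall>ch\<in>set S. (\<pi> x, z k) \<in> chain_rel (role I) ch" if "k < n" for k
    using that by (auto simp: crole_rel_def)
  then obtain S where S: "\<And>k. k < n \<Longrightarrow> S k \<in> set RR \<and> (\<forall>ch\<in>set (S k). (\<pi> x, z k) \<in> chain_rel (role I) ch)"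
    by metis
  \<comment> \<open>Paths for different chains are chosen independently; this is sound because the
    chains in \<open>new_succs\<close> share only their end points.\<close>
  have "\<exists>f. k < n \<longrightarrow> ch \<in> set (S k) \<longrightarrow> f 0 = \<pi> x \<and> f (length ch) = z k \<and>
      (\<forall>l<length ch. (f l, f (Suc l)) \<in> role I (ch ! l))" for k ch
    using S chain_rel_pathE by metis
  then obtain f where f: "\<And>k ch. k < n \<Longrightarrow> ch \<in> set (S k) \<Longrightarrow> f k ch 0 = \<pi> x \<and> f k ch (length ch) = z k \<and>
      (\<forall>l<length ch. (f k ch l, f k ch (Suc l)) \<in> role I (ch ! l))"
    by metis
  define Ss where "Ss = map S [0..<n]"
  \<comment> \<open>Inverts the naming scheme: a second component 0 marks the end point of the
    chains for \<open>k\<close>, and \<open>Suc p\<close> an inner individual with chain and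
    position coded in \<open>p\<close>.\<close>
  define \<pi>' where "\<pi>' v = (if v < ?N then \<pi> v else case prod_decode (v - ?N) of
      (k, 0) \<Rightarrow> z k | (k, Suc p) \<Rightarrow> (case prod_decode p of (j, l) \<Rightarrow> f k (S k ! j) l))" for v
  have old: "\<pi>' u = \<pi> u" if "u \<in> inds A" for u
    using inds_less_fresh[OF fin that] by (simp add: \<pi>'_def)
  have xA: "x \<in> inds A" using CAssert_inds[OF x] .
  have fsucc: "\<pi>' (fresh_succ ?N k) = z k" for k
    by (simp add: \<pi>'_def fresh_succ_def)
  have node: "\<pi>' (chain_node ?N x (length (S k ! j)) k j l) = f k (S k ! j) l"
    if "k < n" "j < length (S k)" "l \<le> length (S k ! j)" for k j l
    using f[OF that(1), of "S k ! j"] that old[OF xA] fsucc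
    by (auto simp: chain_node_def) (simp add: \<pi>'_def)
  have "models I \<pi>' (A \<union> new_succs ?N x C Ss)"
    unfolding models_def
  proof (intro conjI allI impI)
    fix E u assume "CAssert E u \<in> A \<union> new_succs ?N x C Ss"
    then consider "CAssert E u \<in> A" | k where "E = C" "k < n" "u = fresh_succ ?N k"
      by (auto simp: new_succs_def Ss_def)
    then show "\<pi>' u \<in> cext I E"
    proof cases
      case 1
      then show ?thesis using A(1) old[OF CAssert_inds[OF 1]] by (auto simp: models_def)
    next
      case 2
      then show ?thesis using zZ fsucc by auto
    qed
  next
    fix r u v assume "RAssert r u v \<in> A \<union> new_succs ?N x C Ss"
    then consider "RAssert r u v \<in> A" | k j l where "k < n" "j < length (S k)" "l < length (S k ! j)"
      "r = S k ! j ! l" "u = chain_node ?N x (length (S k ! j)) k j l" "v = chain_node ?N x (length (S k ! j)) k j (Suc l)"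
      by (auto simp: new_succs_def Ss_def)
    then show "(\<pi>' u, \<pi>' v) \<in> role I r"
    proof cases
      case 1
      then show ?thesis using A(1) old RAssert_inds[OF 1] by (auto simp: models_def)
    next
      case (2 k j l)
      then show ?thesis using f[of k "S k ! j"] node[of k j l] node[of k j "Suc l"] by auto
    qed
  next
    fix u v assume "Neq u v \<in> A \<union> new_succs ?N x C Ss"
    then consider "Neq u v \<in> A" | k k' where "k < n" "k' < n" "k \<noteq> k'" "u = fresh_succ ?N k" "v = fresh_succ ?N k'"
      by (auto simp: new_succs_def Ss_def)
    then show "\<pi>' u \<noteq> \<pi>' v"
    proof cases
      case 1
      then have "u \<in> inds A" "v \<in> inds A" unfolding inds_def by force+
      then show ?thesis using A(1) old 1 by (auto simp: models_def)
    next
      case (2 k k')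
      then show ?thesis
        using inj_on_eq_iff[OF bij_betw_imp_inj_on[OF z], of k k'] by (simp add: fsucc)
    qed
  qed
  then show ?thesis
    using S by (intro exI[of _ Ss] exI[of _ \<pi>']) (auto simp: Ss_def)
qed

text \<open>\<open>B0\<close> merely shows that some rule applies. The same rule is then applied
  with the choice that the model dictates, which may lead to a different ABox.\<close>

lemma models_step:
  assumes I: "is_interp I" and A: "models I \<pi> A" "wf_abox A" and step: "tab_step A B0"
  shows "\<exists>B \<pi>'. tab_step A B \<and> models I \<pi>' B"
  using step
proof cases
  case (and_rule C D x)
  then have "\<pi> x \<in> cext I (And C D)" using A(1) by (auto simp: models_def simp del: cext.simps)
  then have "models I \<pi> B0" using A(1) and_rule(1) by (auto simp: models_def)
  then show ?thesis using step by blast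
next
  case (or_rule C D x E)
  then have "\<pi> x \<in> cext I (Or C D)" using A(1) by (auto simp: models_def simp del: cext.simps)
  then obtain E' where E': "E' \<in> {C, D}" "\<pi> x \<in> cext I E'" by auto
  then have "models I \<pi> (A \<union> {CAssert E' x})" using A(1) by (auto simp: models_def)
  then show ?thesis using tab_step.or_rule[OF or_rule(2,3) E'(1)] by blast
next
  case (ge_rule n RR C x Ss)
  obtain Ss' \<pi>' where "length Ss' = n" "set Ss' \<subseteq> set RR" "models I \<pi>' (A \<union> new_succs (fresh A) x C Ss')"
    using models_new_succs[OF I A ge_rule(2)] by blast
  then show ?thesis using tab_step.ge_rule[OF ge_rule(2,3)] by blast
next
  case (le_rule n RR C x y z)
  let ?Z = "{y. (\<pi> x, y) \<in> crole_rel (role I) RR \<and> y \<in> cext I C}"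
  have "\<pi> x \<in> cext I (AtMost n RR C)" using A(1) le_rule(2) by (auto simp: models_def simp del: cext.simps)
  then have Z: "finite ?Z" "card ?Z \<le> n" by auto
  have "\<pi> ` csuccs A RR C x \<subseteq> ?Z" using models_csuccs[OF A(1)] by blast
  then have "card (\<pi> ` csuccs A RR C x) \<le> n" using card_mono[OF Z(1)] Z(2) le_trans by blast
  \<comment> \<open>Pigeonhole: more than \<open>n\<close> successors are mapped into a set of at
    most \<open>n\<close> elements. Two that coincide in the model are merged in place of the given
    \<open>y\<close> and \<open>z\<close>; being equal there, they cannot be declared
    distinct.\<close>
  then have "\<not> inj_on \<pi> (csuccs A RR C x)" using le_rule(3) card_image[of \<pi> "csuccs A RR C x"] by linarith
  then obtain y' z' where yz: "y' \<in> csuccs A RR C x" "z' \<in> csuccs A RR C x" "y' \<noteq> z'" "\<pi> y' = \<pi> z'"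
    by (auto simp: inj_on_def)
  have "Neq y' z' \<notin> A" "Neq z' y' \<notin> A" using A(1) yz(4) unfolding models_def by metis+
  then have "tab_step A (asubst y' z' ` A)" by (rule tab_step.le_rule[OF le_rule(2,3) yz(1-3)])
  moreover have "\<pi> (ren y' z' u) = \<pi> u" for u using yz(4) by (simp add: ren_def)
  then have "models I \<pi> (asubst y' z' ` A)" using A(1) by (auto simp: models_def mem_asubst_image)
  ultimately show ?thesis by blast
next
  case (choose_rule n RR C x y E)
  have wf: "wf_crole RR" "wf_concept C" using wf_abox_number[OF A(2) choose_rule(2)] .
  \<comment> \<open>Once \<open>y\<close> denotes a domain element, excluded middle selects
    \<open>C\<close> or its complement.\<close>
  have "\<pi> y \<in> univ I" using crole_rel_univ[OF I wf(1) models_succs[OF A(1) choose_rule(3)]] .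
  then obtain E' where E': "E' \<in> {C, compl C}" "\<pi> y \<in> cext I E'"
    using cext_nnf[OF I wf(2), of False] by auto
  then have "models I \<pi> (A \<union> {CAssert E' y})" using A(1) by (auto simp: models_def)
  then show ?thesis using tab_step.choose_rule[OF choose_rule(2-4) E'(1)] by blast
qed

text \<open>Following the model gets stuck only at a complete ABox, and accessibility rules out that
  it goes on forever.\<close>

lemma models_complete:
  assumes "is_interp I" "terminating A" "models I \<pi> A" "wf_abox A"
  shows "\<exists>B \<pi>'. tab_step\<^sup>*\<^sup>* A B \<and> complete B \<and> models I \<pi>' B"
  using assms(2-)
proof (induction arbitrary: \<pi> rule: accp.induct)
  case (accI A)
  show ?case
  proof (cases "complete A")
    case True
    then show ?thesis using accI.prems by blast
  next
    case False
    then obtain B0 where "tab_step A B0" by (auto simp: complete_def)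
    then obtain B \<pi>' where B: "tab_step A B" "models I \<pi>' B"
      using models_step[OF assms(1) accI.prems] by blast
    then show ?thesis
      using accI.IH[OF B] wf_abox_step[OF accI.prems(2) B(1)] by (meson converse_rtranclp_into_rtranclp)
  qed
qed

lemma models_no_clash:
  assumes "is_interp I" "models I \<pi> A"
  shows "\<not> clash A"
proof
  have mod: "\<pi> x \<in> cext I C" if "CAssert C x \<in> A" for C x using assms(2) that by (auto simp: models_def)
  assume "clash A"
  then consider x where "CAssert Bot x \<in> A"
    | a x where "CAssert (Atom a) x \<in> A" "CAssert (Neg (Atom a)) x \<in> A"
    | n RR C x Y where "CAssert (AtMost n RR C) x \<in> A" "Y \<subseteq> csuccs A RR C x" "finite Y" "card Y > n" "pairwise_neq A Y"
    unfolding clash_def by blast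
  then show False
  proof cases
    case 1
    then show False using mod by fastforce
  next
    case 2
    then show False using mod[OF 2(1)] mod[OF 2(2)] by simp
  next
    case (3 n RR C x Y)
    let ?Z = "{y. (\<pi> x, y) \<in> crole_rel (role I) RR \<and> y \<in> cext I C}"
    have Z: "finite ?Z" "card ?Z \<le> n" using mod[OF 3(1)] by auto
    have "inj_on \<pi> Y" using 3(5) assms(2) unfolding inj_on_def pairwise_neq_def models_def by metis
    moreover have "\<pi> ` Y \<subseteq> ?Z" using 3(2) models_csuccs[OF assms(2)] by blast
    ultimately have "card Y \<le> card ?Z" using card_inj_on_le Z(1) by blast
    then show False using 3(4) Z(2) by simp
  qed
qed

lemma wf_init_abox: "wf_concept C \<Longrightarrow> wf_abox (init_abox C)"
  by (auto simp: wf_abox_def init_abox_def wf_concept_nnf)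

lemma tableau_complete:
  assumes "wf_concept C" "satisfiable TYPE('d) C"
  shows "tableau_satisfiable C"
proof -
  obtain I :: "'d interp" and d where I: "is_interp I" "d \<in> cext I C"
    using assms(2) by (auto simp: satisfiable_def)
  have "models I (\<lambda>_. d) (init_abox C)"
    using I cext_nnf[OF I(1) assms(1), of True] by (auto simp: models_def init_abox_def)
  then obtain B \<pi> where "tab_step\<^sup>*\<^sup>* (init_abox C) B" "complete B" "models I \<pi> B"
    using models_complete[OF I(1) terminating_init[OF assms(1)]] wf_init_abox[OF assms(1)] by blast
  then show ?thesis
    unfolding tableau_satisfiable_def using models_no_clash[OF I(1)] by blast
qed

text \<open>Symmetry of \<open>Neq\<close> is kept because the \<open>\<le>\<close>-rule is blocked
  by either orientation, whereas \<open>pairwise_neq\<close> asks for both. The individual carrying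
  \<open>C0\<close> is not named, so merging needs no bookkeeping.\<close>

definition sound_inv :: "concept \<Rightarrow> abox \<Rightarrow> bool" where
  "sound_inv C0 A \<longleftrightarrow> wf_abox A \<and> (\<forall>C x. CAssert C x \<in> A \<longrightarrow> is_nnf C) \<and>
     (\<forall>u v. Neq u v \<in> A \<longrightarrow> Neq v u \<in> A) \<and> (\<exists>x. CAssert C0 x \<in> A)"

lemma sound_inv_step:
  assumes A: "sound_inv C0 A" and step: "tab_step A B"
  shows "sound_inv C0 B"
proof -
  have wf: "wf_abox B" using wf_abox_step[OF _ step] A by (auto simp: sound_inv_def)
  have nnf: "is_nnf C" if "CAssert C x \<in> A" for C x using A that by (auto simp: sound_inv_def)
  from step show ?thesis
  proof cases
    case (and_rule C D x)
    then show ?thesis using A wf nnf[of "And C D" x] by (auto simp: sound_inv_def)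
  next
    case (or_rule C D x E)
    then show ?thesis using A wf nnf[of "Or C D" x] by (auto simp: sound_inv_def)
  next
    case (ge_rule n RR C x Ss)
    then show ?thesis using A wf nnf[of "AtLeast n RR C" x] by (auto simp: sound_inv_def new_succs_def)
  next
    case (le_rule n RR C x y z)
    then show ?thesis using A wf by (auto simp: sound_inv_def mem_asubst_image) blast
  next
    case (choose_rule n RR C x y E)
    have "is_nnf C" using choose_rule(2) nnf[of "AtLeast n RR C" x] nnf[of "AtMost n RR C" x] by auto
    then show ?thesis using A wf choose_rule(1,5) is_nnf_nnf[of False C] by (auto simp: sound_inv_def)
  qed
qed

section \<open>Soundness: the canonical model\<close>

definition canon :: "(nat \<Rightarrow> 'd) \<Rightarrow> abox \<Rightarrow> 'd interp" where
  "canon h A = \<lparr>univ = h ` inds A, conc = (\<lambda>a. h ` {x. CAssert (Atom a) x \<in> A}),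
     role = (\<lambda>r. {(h u, h v) | u v. RAssert r u v \<in> A})\<rparr>"

lemma canon_chain_rel:
  assumes "inj h"
  shows "(h x, y') \<in> chain_rel (role (canon h A)) ch \<longleftrightarrow> (\<exists>y. y' = h y \<and> (x, y) \<in> chain_rel (arole A) ch)"
proof (induction ch arbitrary: x)
  case (Cons r ch)
  have "(h x, y') \<in> chain_rel (role (canon h A)) (r # ch) \<longleftrightarrow>
      (\<exists>z. RAssert r x z \<in> A \<and> (h z, y') \<in> chain_rel (role (canon h A)) ch)"
    using injD[OF assms] by (fastforce simp: canon_def)
  then show ?case unfolding Cons.IH by auto
qed auto

text \<open>Injectivity of \<open>h\<close> matters for intersections: chains that meet in the same
  point \<open>h y\<close> meet in the same individual \<open>y\<close>. Nonemptiness of the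
  intersection guarantees that the point is such an image at all.\<close>

lemma canon_crole_rel:
  assumes "inj h" "wf_crole RR"
  shows "{y'. (h x, y') \<in> crole_rel (role (canon h A)) RR} = h ` succs A RR x"
proof (intro equalityI subsetI)
  fix y' assume "y' \<in> {y'. (h x, y') \<in> crole_rel (role (canon h A)) RR}"
  then obtain S where S: "S \<in> set RR" "\<forall>ch\<in>set S. (h x, y') \<in> chain_rel (role (canon h A)) ch"
    by (auto simp: crole_rel_def)
  obtain ch where "ch \<in> set S" using wf_crole_nonempty(1)[OF assms(2) S(1)] by (metis list.set_sel(1))
  then obtain y where y: "y' = h y" using S(2) canon_chain_rel[OF assms(1)] by blast
  have "\<forall>ch\<in>set S. (x, y) \<in> chain_rel (arole A) ch"
    using S(2) unfolding canon_chain_rel[OF assms(1)] y by (simp add: inj_eq[OF assms(1)])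
  then show "y' \<in> h ` succs A RR x"
    using S(1) y by (auto simp: succs_def crole_rel_def)
next
  fix y' assume "y' \<in> h ` succs A RR x"
  then obtain y S where y: "y' = h y" "S \<in> set RR" "\<forall>ch\<in>set S. (x, y) \<in> chain_rel (arole A) ch"
    by (auto simp: succs_def crole_rel_def)
  then have "\<forall>ch\<in>set S. (h x, y') \<in> chain_rel (role (canon h A)) ch"
    unfolding canon_chain_rel[OF assms(1)] by blast
  then show "y' \<in> {y'. (h x, y') \<in> crole_rel (role (canon h A)) RR}"
    using y(2) by (auto simp: crole_rel_def)
qed

lemma is_interp_canon: "CAssert C x \<in> A \<Longrightarrow> is_interp (canon h A)"
  using CAssert_inds RAssert_inds by (fastforce simp: is_interp_def canon_def)

lemma complete_ge_sat:
  assumes "complete A" "CAssert (AtLeast n RR C) x \<in> A" "wf_crole RR"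
  shows "ge_sat A x n RR C"
proof (rule ccontr)
  assume "\<not> ge_sat A x n RR C"
  \<comment> \<open>Any choice of disjuncts would do; since \<open>RR\<close> is nonempty, the
    \<open>\<ge>\<close>-rule can always fire on an unsatisfied restriction.\<close>
  moreover have "length (replicate n (hd RR)) = n" "set (replicate n (hd RR)) \<subseteq> set RR"
    using assms(3) by (auto simp: wf_crole_def)
  ultimately have "tab_step A (A \<union> new_succs (fresh A) x C (replicate n (hd RR)))"
    using tab_step.ge_rule[OF assms(2)] unfolding ge_sat_def by blast
  then show False using assms(1) by (auto simp: complete_def)
qed

text \<open>With too many successors, completeness leaves no pair to merge, so all of them are
  declared distinct, and that is a clash.\<close>

lemma complete_card_csuccs:
  assumes "complete A" "\<not> clash A" "CAssert (AtMost n RR C) x \<in> A" "\<forall>u v. Neq u v \<in> A \<longrightarrow> Neq v u \<in> A"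
  shows "card (csuccs A RR C x) \<le> n"
proof (rule ccontr)
  assume gt: "\<not> card (csuccs A RR C x) \<le> n"
  have "pairwise_neq A (csuccs A RR C x)"
    unfolding pairwise_neq_def
  proof (intro ballI impI)
    fix y z assume yz: "y \<in> csuccs A RR C x" "z \<in> csuccs A RR C x" "y \<noteq> z"
    have "Neq y z \<in> A \<or> Neq z y \<in> A"
    proof (rule ccontr)
      assume "\<not> (Neq y z \<in> A \<or> Neq z y \<in> A)"
      then have "tab_step A (asubst y z ` A)"
        using tab_step.le_rule[OF assms(3) _ yz] gt by auto
      then show False using assms(1) by (auto simp: complete_def)
    qed
    then show "Neq y z \<in> A" using assms(4) by blast
  qed
  moreover have "finite (csuccs A RR C x)" using gt card.infinite by fastforce
  ultimately have "clash A" using assms(3) gt unfolding clash_def by (meson not_le subset_refl)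
  then show False using assms(2) by simp
qed

text \<open>The induction is on the size because the at-most case also needs the claim for
  \<open>compl D\<close>. That case must exclude successors satisfying \<open>D\<close> without an
  assertion to that effect, and this is the purpose of the choose-rule.\<close>

lemma canon_cext:
  fixes h :: "nat \<Rightarrow> 'd"
  assumes h: "inj h" and A: "sound_inv C0 A" and compl: "complete A" and noclash: "\<not> clash A"
  shows "CAssert C x \<in> A \<Longrightarrow> h x \<in> cext (canon h A) C"
proof (induction "csize C" arbitrary: C x rule: less_induct)
  case less
  let ?I = "canon h A"
  have wfA: "wf_abox A" using A by (simp add: sound_inv_def)
  have nnf: "is_nnf C" using A less.prems by (auto simp: sound_inv_def)
  have I: "is_interp ?I" using is_interp_canon[OF less.prems] .
  have x: "h x \<in> univ ?I" using CAssert_inds[OF less.prems] by (simp add: canon_def)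
  show ?case
  proof (cases C)
    case Bot
    then show ?thesis using less.prems noclash by (auto simp: clash_def)
  next
    case (Atom a)
    then show ?thesis using less.prems by (auto simp: canon_def)
  next
    case (Neg D)
    then obtain a where a: "C = Neg (Atom a)" using nnf by auto
    then have "CAssert (Atom a) x \<notin> A" using less.prems noclash by (auto simp: clash_def)
    then show ?thesis using a x injD[OF h] by (auto simp: canon_def)
  next
    case (And D E)
    have "{CAssert D x, CAssert E x} \<subseteq> A"
      using compl less.prems tab_step.and_rule[of D E x A] And unfolding complete_def by blast
    then show ?thesis using less.hyps[of D x] less.hyps[of E x] And by auto
  next
    case (Or D E)
    have "CAssert D x \<in> A \<or> CAssert E x \<in> A"
      using compl less.prems tab_step.or_rule[of D E x A D] Or unfolding complete_def by blast
    then show ?thesis using less.hyps[of D x] less.hyps[of E x] Or by auto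
  next
    case (AtLeast n RR D)
    have wf: "wf_crole RR" using wf_abox_number[OF wfA] less.prems AtLeast by blast
    have "ge_sat A x n RR D" using complete_ge_sat[OF compl _ wf] less.prems AtLeast by blast
    then obtain Y where Y: "Y \<subseteq> csuccs A RR D x" "finite Y" "card Y = n" unfolding ge_sat_def by blast
    let ?Z = "{y. (h x, y) \<in> crole_rel (role ?I) RR \<and> y \<in> cext ?I D}"
    have "h ` Y \<subseteq> ?Z"
      using Y(1) canon_crole_rel[OF h wf, of x A] less.hyps[of D] AtLeast by (auto simp: csuccs_def)
    moreover have "card (h ` Y) = n" using Y(3) card_image inj_on_subset[OF h] by blast
    ultimately have "infinite ?Z \<or> n \<le> card ?Z" using card_mono by metis
    then show ?thesis using AtLeast x by simp
  next
    case (AtMost n RR D)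
    have wf: "wf_crole RR" "wf_concept D" using wf_abox_number[OF wfA] less.prems AtMost by blast+
    let ?Z = "{y. (h x, y) \<in> crole_rel (role ?I) RR \<and> y \<in> cext ?I D}"
    \<comment> \<open>Completeness under the choose-rule labels every successor with
      \<open>D\<close> or \<open>compl D\<close>; the induction hypothesis for
      \<open>compl D\<close> refutes the second label for a point in the extension of
      \<open>D\<close>.\<close>
    have sub: "?Z \<subseteq> h ` csuccs A RR D x"
    proof
      fix y' assume y': "y' \<in> ?Z"
      then obtain y where y: "y' = h y" "y \<in> succs A RR x" using canon_crole_rel[OF h wf(1), of x A] by blast
      have "CAssert D y \<in> A \<or> CAssert (compl D) y \<in> A"
        using compl tab_step.choose_rule[of n RR D x A y D] y(2) less.prems AtMost unfolding complete_def by blast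
      moreover have "CAssert (compl D) y \<notin> A"
      proof
        assume *: "CAssert (compl D) y \<in> A"
        have "csize (compl D) < csize C" using csize_nnf[of False D] AtMost by simp
        then have "h y \<in> cext ?I (compl D)" using less.hyps * by blast
        then show False using cext_nnf[OF I wf(2), of False] y' y by auto
      qed
      ultimately show "y' \<in> h ` csuccs A RR D x" using y by (auto simp: csuccs_def)
    qed
    have "csuccs A RR D x \<subseteq> inds A" using CAssert_inds by (auto simp: csuccs_def)
    then have fin: "finite (csuccs A RR D x)"
      using wfA finite_inds finite_subset unfolding wf_abox_def by blast
    have "card ?Z \<le> card (h ` csuccs A RR D x)" using card_mono[OF _ sub] fin by blast
    also have "\<dots> \<le> card (csuccs A RR D x)" using card_image_le[OF fin] .
    also have "\<dots> \<le> n"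
      using complete_card_csuccs[OF compl noclash] less.prems AtMost A unfolding sound_inv_def by blast
    finally have "card ?Z \<le> n" .
    moreover have "finite ?Z" using finite_subset[OF sub] fin by blast
    ultimately show ?thesis using AtMost x by simp
  qed (use x nnf in auto)
qed

text \<open>An infinite type receives an injection from the names of individuals, along which the
  canonical model is transported whatever its size.\<close>

lemma tableau_sound:
  assumes "infinite (UNIV :: 'd set)" "wf_concept C" "tableau_satisfiable C"
  shows "satisfiable TYPE('d) C"
proof -
  obtain h :: "nat \<Rightarrow> 'd" where h: "inj h" using infinite_countable_subset[OF assms(1)] by blast
  obtain B where B: "tab_step\<^sup>*\<^sup>* (init_abox C) B" "complete B" "\<not> clash B"
    using assms(3) by (auto simp: tableau_satisfiable_def)
  have "sound_inv (nnf True C) (init_abox C)"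
    using wf_init_abox[OF assms(2)] by (auto simp: sound_inv_def init_abox_def is_nnf_nnf)
  with B(1) have inv: "sound_inv (nnf True C) B"
    by (induction rule: rtranclp_induct) (auto intro: sound_inv_step)
  then obtain x where x: "CAssert (nnf True C) x \<in> B" by (auto simp: sound_inv_def)
  have I: "is_interp (canon h B)" using is_interp_canon[OF x] .
  have "h x \<in> cext (canon h B) C"
    using canon_cext[OF h inv B(2,3) x] cext_nnf[OF I assms(2), of True] by simp
  then show ?thesis using I by (auto simp: satisfiable_def)
qed

lemma subsumed_iff: "subsumed TYPE('d) C D \<longleftrightarrow> \<not> satisfiable TYPE('d) (And C (Neg D))"
  using cext_subset by (fastforce simp: subsumed_def satisfiable_def)

section \<open>Decidability\<close>

definition accepts :: "abox \<Rightarrow> bool" where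
  "accepts A \<longleftrightarrow> (\<exists>B. tab_step\<^sup>*\<^sup>* A B \<and> complete B \<and> \<not> clash B)"

lemma accepts_unfold: "accepts A \<longleftrightarrow> (complete A \<and> \<not> clash A) \<or> (\<exists>B. tab_step A B \<and> accepts B)"
  unfolding accepts_def by (metis converse_rtranclpE converse_rtranclp_into_rtranclp rtranclp.rtrancl_refl)

text \<open>A single premise: acceptance follows one branch of the nondeterministic choices.\<close>

definition accept_rule :: "assertion list \<Rightarrow> assertion list list \<Rightarrow> bool" where
  "accept_rule L ps \<longleftrightarrow> (steps L = [] \<and> clash_list L = False) \<or> (\<exists>L'. L' \<in> set (steps L) \<and> ps = [L'])"

text \<open>Premises for all outcomes at once; this is possible because \<open>steps L\<close> is a
  finite list. Only complete ABoxes are judged by their clashes.\<close>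

definition reject_rule :: "assertion list \<Rightarrow> assertion list list \<Rightarrow> bool" where
  "reject_rule L ps \<longleftrightarrow> (steps L = [] \<and> clash_list L = True) \<or> (0 < length (steps L) \<and> ps = steps L)"

lemma re_accept: "re (deriv accept_rule)"
  by (rule re_deriv) (unfold accept_rule_def, intro re_intro re_mem compf_intro)

lemma re_reject: "re (deriv reject_rule)"
  by (rule re_deriv) (unfold reject_rule_def, intro re_intro re_bool[OF compf_less] compf_intro)

lemma ex_wf_list: "wf_abox A \<Longrightarrow> \<exists>L. A = set L \<and> wf_list L"
  unfolding wf_list_iff using finite_list[of A] by (auto simp: wf_abox_def)

lemma complete_steps: "wf_list L \<Longrightarrow> complete (set L) \<longleftrightarrow> steps L = []"
  using tab_step_steps[of L] unfolding complete_def by (cases "steps L") auto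

lemma wf_list_steps: "wf_list L \<Longrightarrow> L' \<in> set (steps L) \<Longrightarrow> wf_list L'"
  using wf_abox_step[of "set L" "set L'"] tab_step_steps[of L "set L'"] unfolding wf_list_iff by blast

lemma accepts_if_deriv: "deriv accept_rule L \<Longrightarrow> wf_list L \<Longrightarrow> accepts (set L)"
proof (induction rule: deriv.induct)
  case (derivI L ps)
  show ?case
  proof (cases "steps L = []")
    case True
    then have "complete (set L) \<and> \<not> clash (set L)"
      using derivI.hyps derivI.prems complete_steps clash_list_iff by (auto simp: accept_rule_def)
    then show ?thesis using accepts_unfold by blast
  next
    case False
    then obtain L' where L': "L' \<in> set (steps L)" "ps = [L']" using derivI.hyps by (auto simp: accept_rule_def)
    then have "tab_step (set L) (set L')" using tab_step_steps[OF derivI.prems] by blast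
    moreover have "accepts (set L')" using derivI.IH L' wf_list_steps[OF derivI.prems L'(1)] by simp
    ultimately show ?thesis using accepts_unfold by blast
  qed
qed

lemma rejects_if_deriv: "deriv reject_rule L \<Longrightarrow> wf_list L \<Longrightarrow> \<not> accepts (set L)"
proof (induction rule: deriv.induct)
  case (derivI L ps)
  show ?case
  proof (cases "steps L = []")
    case True
    then have "complete (set L) \<and> clash (set L)"
      using derivI.hyps derivI.prems complete_steps clash_list_iff by (auto simp: reject_rule_def)
    then show ?thesis using accepts_unfold[of "set L"] unfolding complete_def by blast
  next
    case False
    then have ps: "ps = steps L" using derivI.hyps by (auto simp: reject_rule_def)
    have "\<not> accepts B" if "tab_step (set L) B" for B
      using that derivI.IH wf_list_steps[OF derivI.prems] tab_step_steps[OF derivI.prems] by (auto simp: ps)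
    moreover have "\<not> complete (set L)" using False complete_steps derivI.prems by blast
    ultimately show ?thesis using accepts_unfold[of "set L"] by blast
  qed
qed

text \<open>The derivations are sound for every well-formed list. Termination enters here, where
  each ABox must receive one of the two verdicts.\<close>

lemma deriv_if_terminating:
  "terminating A \<Longrightarrow> A = set L \<Longrightarrow> wf_list L \<Longrightarrow>
   (accepts A \<longrightarrow> deriv accept_rule L) \<and> (\<not> accepts A \<longrightarrow> deriv reject_rule L)"
proof (induction arbitrary: L rule: accp.induct)
  case (accI A)
  have IH: "(accepts (set L') \<longrightarrow> deriv accept_rule L') \<and> (\<not> accepts (set L') \<longrightarrow> deriv reject_rule L')"
    if "L' \<in> set (steps L)" for L'
    using accI.IH[of "set L'" L'] accI.prems that wf_list_steps tab_step_steps by blast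
  show ?case
  proof (cases "steps L = []")
    case True
    then have "accepts A \<longleftrightarrow> \<not> clash_list L"
      using accepts_unfold[of A] complete_steps[OF accI.prems(2)] clash_list_iff[OF accI.prems(2)] accI.prems(1)
      unfolding complete_def by blast
    then show ?thesis
      using True by (auto simp: accept_rule_def reject_rule_def intro: derivI[of _ _ "[]"])
  next
    case False
    then have "\<not> complete A" using complete_steps[OF accI.prems(2)] accI.prems(1) by simp
    then have "accepts A \<longleftrightarrow> (\<exists>B. tab_step (set L) B \<and> accepts B)"
      using accepts_unfold[of A] accI.prems(1) by simp
    also have "\<dots> \<longleftrightarrow> (\<exists>L'\<in>set (steps L). accepts (set L'))"
      unfolding tab_step_steps[OF accI.prems(2)] by blast
    finally have "accepts A \<longleftrightarrow> (\<exists>L'\<in>set (steps L). accepts (set L'))" .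
    moreover have "deriv accept_rule L" if "L' \<in> set (steps L)" "accepts (set L')" for L'
      using IH that by (intro derivI[of _ _ "[L']"]) (auto simp: accept_rule_def)
    moreover have "deriv reject_rule L" if "\<forall>L'\<in>set (steps L). \<not> accepts (set L')"
      using IH that False by (intro derivI[of _ _ "steps L"]) (auto simp: reject_rule_def)
    ultimately show ?thesis by blast
  qed
qed

lemma tableau_satisfiable_deriv:
  assumes "wf_concept C"
  shows "tableau_satisfiable C \<longleftrightarrow> deriv accept_rule [CAssert (nnf True C) 0]"
    and "\<not> tableau_satisfiable C \<longleftrightarrow> deriv reject_rule [CAssert (nnf True C) 0]"
proof -
  have init: "init_abox C = set [CAssert (nnf True C) 0]" by (simp add: init_abox_def)
  have sat: "tableau_satisfiable C \<longleftrightarrow> accepts (set [CAssert (nnf True C) 0])"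
    by (simp add: tableau_satisfiable_def accepts_def init_abox_def)
  have wf: "wf_list [CAssert (nnf True C) 0]"
    using wf_init_abox[OF assms] by (simp add: wf_list_iff init_abox_def)
  note * = deriv_if_terminating[OF terminating_init[OF assms] init wf]
    accepts_if_deriv[OF _ wf] rejects_if_deriv[OF _ wf]
  show "tableau_satisfiable C \<longleftrightarrow> deriv accept_rule [CAssert (nnf True C) 0]"
    and "\<not> tableau_satisfiable C \<longleftrightarrow> deriv reject_rule [CAssert (nnf True C) 0]"
    using * unfolding sat init by blast+
qed

lemma compf_tableau_satisfiable: "compf (\<lambda>C. wf_concept C \<and> tableau_satisfiable C)"
proof (rule compf_boolI)
  have "(\<lambda>C. wf_concept C \<and> tableau_satisfiable C) = (\<lambda>C. wf_concept C \<and> deriv accept_rule [CAssert (nnf True C) 0])"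
    using tableau_satisfiable_deriv(1) by auto
  moreover have "re (\<lambda>C. wf_concept C \<and> deriv accept_rule [CAssert (nnf True C) 0])"
    by (intro re_conj re_bool[OF compf_wf_concept] re_subst[OF re_accept] compf_intro)
  ultimately show "re (\<lambda>C. wf_concept C \<and> tableau_satisfiable C)" by simp
  have "(\<lambda>C. \<not> (wf_concept C \<and> tableau_satisfiable C)) = (\<lambda>C. \<not> wf_concept C \<or> deriv reject_rule [CAssert (nnf True C) 0])"
    using tableau_satisfiable_deriv(2) by auto
  moreover have "re (\<lambda>C. \<not> wf_concept C \<or> deriv reject_rule [CAssert (nnf True C) 0])"
    by (intro re_disj re_not_bool[OF compf_wf_concept] re_subst[OF re_reject] compf_intro)
  ultimately show "re (\<lambda>C. \<not> (wf_concept C \<and> tableau_satisfiable C))" by simp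
qed

lemma decidable_satisfiable: "decidable (code_concept ` {C. wf_concept C \<and> tableau_satisfiable C})"
  using decidable_enc_image[OF compf_tableau_satisfiable] by (simp add: enc_concept_def)

lemma decidable_subsumed:
  "decidable (code_pair ` {(C, D). wf_concept C \<and> wf_concept D \<and> \<not> tableau_satisfiable (And C (Neg D))})"
proof -
  have "compf (\<lambda>p. wf_concept (fst p) \<and> wf_concept (snd p) \<and>
      \<not> (wf_concept (And (fst p) (Neg (snd p))) \<and> tableau_satisfiable (And (fst p) (Neg (snd p)))))"
    by (intro compf_conj compf_not compf_comp[OF compf_tableau_satisfiable] compf_wf_concept compf_concept
        compf_fst compf_snd compf_id)
  from decidable_enc_image[OF this]
  have "decidable (enc ` {p. wf_concept (fst p) \<and> wf_concept (snd p) \<and> \<not> tableau_satisfiable (And (fst p) (Neg (snd p)))})"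
    by (simp cong: conj_cong)
  moreover have "enc = code_pair"
    by (auto simp: fun_eq_iff enc_prod_def enc_concept_def code_pair_def)
  moreover have "{p. wf_concept (fst p) \<and> wf_concept (snd p) \<and> \<not> tableau_satisfiable (And (fst p) (Neg (snd p)))} =
      {(C, D). wf_concept C \<and> wf_concept D \<and> \<not> tableau_satisfiable (And C (Neg D))}"
    by auto
  ultimately show ?thesis by simp
qed

section \<open>Effectiveness on codes of ABoxes\<close>

definition abox_code :: "assertion list \<Rightarrow> nat" where
  "abox_code L = set_encode (set (map (\<lambda>a. enc a) L))"

lemma abox_code: "abox_code L = code_abox (set L)"
  by (simp add: abox_code_def code_abox_def enc_assertion_def)

lemma compf_abox_code [compf_intro]: "compf f \<Longrightarrow> compf (\<lambda>x. abox_code (f x))"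
  unfolding abox_code_def by (intro compf_intro)

lemma abox_code_inject: "abox_code L = abox_code L' \<longleftrightarrow> set L = set L'"
  using inj_on_code_abox by (auto simp: abox_code inj_on_def)

text \<open>Every number is the \<open>set_encode\<close> of a finite set of naturals, so the only
  obstruction is an element that codes no assertion.\<close>

definition non_abox_code :: "nat \<Rightarrow> bool" where
  "non_abox_code n \<longleftrightarrow> (\<exists>l. n = set_encode (set l) \<and> (\<exists>a. a \<in> set l \<and> a \<notin> codes TYPE(assertion)))"

lemma non_abox_code_iff: "non_abox_code n \<longleftrightarrow> (\<nexists>L. n = abox_code L)"
proof
  assume "non_abox_code n"
  then obtain l where l: "n = set_encode (set l)" "\<not> set l \<subseteq> codes TYPE(assertion)"
    unfolding non_abox_code_def by blast
  show "\<nexists>L. n = abox_code L"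
  proof
    assume "\<exists>L. n = abox_code L"
    then obtain L where "set l = set (map (\<lambda>a. enc a) (L :: assertion list))"
      using l(1) by (auto simp: abox_code_def set_encode_eq)
    then show False using l(2) by auto
  qed
next
  assume no: "\<nexists>L. n = abox_code L"
  obtain l where l: "set_decode n = set l" using finite_list[OF finite_set_decode] by metis
  then have n: "n = set_encode (set l)" by (metis set_decode_inverse)
  show "non_abox_code n"
  proof (rule ccontr)
    assume "\<not> non_abox_code n"
    then have "\<forall>a\<in>set l. \<exists>b :: assertion. a = enc b" using n unfolding non_abox_code_def by blast
    then obtain L :: "assertion list" where "l = map enc L" using ex_map_conv[of l enc] by blast
    then have "n = abox_code L" using n by (simp add: abox_code_def)
    then show False using no by blast
  qed
qed

lemma re_non_abox_code: "compf f \<Longrightarrow> re (\<lambda>x. non_abox_code (f x))"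
  by (rule re_subst[where P = non_abox_code])
     (unfold non_abox_code_def, intro re_intro re_mem re_not_range compf_intro)

lemma decidable_clash: "decidable (code_abox ` {A. wf_abox A \<and> clash A})"
proof -
  let ?S = "code_abox ` {A. wf_abox A \<and> clash A}"
  have 1: "n \<in> ?S \<longleftrightarrow> (\<exists>L. n = abox_code L \<and> wf_list L \<and> clash_list L)" for n
  proof
    assume "n \<in> ?S"
    then obtain A where A: "n = code_abox A" "wf_abox A" "clash A" by blast
    moreover obtain L where "A = set L" "wf_list L" using ex_wf_list[OF A(2)] by blast
    ultimately show "\<exists>L. n = abox_code L \<and> wf_list L \<and> clash_list L"
      using clash_list_iff[of L] abox_code[of L] by (intro exI[of _ L]) simp
  next
    assume "\<exists>L. n = abox_code L \<and> wf_list L \<and> clash_list L"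
    then show "n \<in> ?S"
      using wf_list_iff clash_list_iff abox_code by blast
  qed
  \<comment> \<open>Lists with the same code represent the same ABox and get the same verdict, so
    one list with a negative verdict refutes membership.\<close>
  have 2: "n \<notin> ?S \<longleftrightarrow>
      non_abox_code n \<or> (\<exists>L. n = abox_code L \<and> \<not> (wf_list L \<and> clash_list L))" for n
  proof -
    have "(wf_list L \<and> clash_list L) = (wf_list L' \<and> clash_list L')" if "abox_code L = abox_code L'" for L L'
      using that clash_list_iff[of L] clash_list_iff[of L'] by (auto simp: abox_code_inject wf_list_iff)
    then show ?thesis unfolding 1 non_abox_code_iff by blast
  qed
  show ?thesis
  proof (rule decidableI)
    show "re (\<lambda>n. n \<in> ?S)"
      unfolding 1 by (intro re_ex re_conj re_eq re_bool[OF compf_wf_list] re_bool[OF compf_clash_list] compf_intro)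
    show "re (\<lambda>n. n \<notin> ?S)"
      unfolding 2 by (intro re_disj re_ex re_conj re_eq re_non_abox_code re_not_bool compf_intro)
  qed
qed

lemma tab_steps_list: "wf_list L \<Longrightarrow> {B. tab_step (set L) B} = set ` set (steps L)"
  using tab_step_steps by blast

definition step_code :: "assertion list \<Rightarrow> nat" where
  "step_code L = set_encode (set (map (\<lambda>B. abox_code B) (steps L)))"

lemma step_code: "wf_list L \<Longrightarrow> step_code L = set_encode (code_abox ` {B. tab_step (set L) B})"
  by (simp add: step_code_def tab_steps_list image_image abox_code)

text \<open>\<open>step_code\<close> depends only on the set that a list represents, so the chosen
  representative is irrelevant and the graph can quantify over all of them. To make \<open>f\<close>
  total, every other input gets the value 0, and those inputs have to be enumerated too: numbers
  coding no ABox and codes of ill-formed ones.\<close>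

lemma computable_steps:
  "\<exists>f. computable f \<and> (\<forall>A. wf_abox A \<longrightarrow> f (code_abox A) = set_encode (code_abox ` {B. tab_step A B}))"
proof -
  define f where "f n = (if \<exists>L. wf_list L \<and> n = abox_code L then step_code (SOME L. wf_list L \<and> n = abox_code L) else 0)" for n
  have f: "f (abox_code L) = step_code L" if "wf_list L" for L
  proof -
    let ?L = "SOME L'. wf_list L' \<and> abox_code L = abox_code L'"
    have "wf_list ?L \<and> abox_code L = abox_code ?L" by (rule someI[of _ L]) (simp add: that)
    then have "step_code ?L = step_code L" using that by (simp add: abox_code_inject step_code)
    then show ?thesis using that by (auto simp: f_def)
  qed
  have graph: "y = f n \<longleftrightarrow> (\<exists>L. wf_list L \<and> n = abox_code L \<and> y = step_code L) \<or>
      ((non_abox_code n \<or> (\<exists>L. n = abox_code L \<and> \<not> wf_list L)) \<and> y = 0)" for y n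
  proof (cases "\<exists>L. wf_list L \<and> n = abox_code L")
    case True
    then obtain L where L: "wf_list L" "n = abox_code L" by blast
    have wf: "wf_list L'" if "n = abox_code L'" for L'
      using that L by (simp add: abox_code_inject wf_list_iff)
    have "\<not> non_abox_code n" using L(2) non_abox_code_iff[of n] by blast
    moreover have "\<not> (\<exists>L. n = abox_code L \<and> \<not> wf_list L)" using wf by blast
    moreover have "(\<exists>L. wf_list L \<and> n = abox_code L \<and> y = step_code L) \<longleftrightarrow> y = f n"
      using L f by metis
    ultimately show ?thesis by (simp only: simp_thms)
  next
    case False
    then have "f n = 0" unfolding f_def by (rule if_not_P)
    moreover have "non_abox_code n \<or> (\<exists>L. n = abox_code L \<and> \<not> wf_list L)"
      using False non_abox_code_iff[of n] by blast
    moreover have "\<not> (\<exists>L. wf_list L \<and> n = abox_code L \<and> y = step_code L)"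
      using False by blast
    ultimately show ?thesis by (simp only: simp_thms)
  qed
  have "compf f"
    unfolding compf_def graph step_code_def
    by (intro re_disj re_conj re_ex re_eq re_bool[OF compf_wf_list] re_not_bool[OF compf_wf_list] re_non_abox_code compf_intro)
  moreover have "f (code_abox A) = set_encode (code_abox ` {B. tab_step A B})" if "wf_abox A" for A
  proof -
    obtain L where "A = set L" "wf_list L" using ex_wf_list[OF \<open>wf_abox A\<close>] by blast
    then show ?thesis using f[of L] step_code[of L] by (simp add: abox_code)
  qed
  ultimately show ?thesis using computable_if_compf by blast
qed

lemma effective_tableau: effective_tableau
proof -
  have "finite {B. tab_step A B}" if "wf_abox A" for A
  proof -
    obtain L where "A = set L" "wf_list L" using ex_wf_list[OF \<open>wf_abox A\<close>] by blast
    then show ?thesis using tab_steps_list[of L] by simp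
  qed
  then show ?thesis
    unfolding effective_tableau_def using wf_abox_step computable_steps decidable_clash by blast
qed

theorem theorem2:
  assumes "infinite (UNIV :: 'd set)"
  shows
    "decidable (code_concept ` {C. wf_concept C \<and> satisfiable TYPE('d) C}) \<and>
     decidable (code_pair ` {(C, D). wf_concept C \<and> wf_concept D \<and> subsumed TYPE('d) C D}) \<and>
     effective_tableau \<and>
     (\<forall>C. wf_concept C \<longrightarrow>
        tableau_terminates C \<and> (tableau_satisfiable C \<longleftrightarrow> satisfiable TYPE('d) C)) \<and>
     (\<forall>C D. wf_concept C \<and> wf_concept D \<longrightarrow>
        (subsumed TYPE('d) C D \<longleftrightarrow> \<not> tableau_satisfiable (And C (Neg D))))"
proof -
  have sat: "tableau_satisfiable C \<longleftrightarrow> satisfiable TYPE('d) C" if "wf_concept C" for C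
    using tableau_sound[OF assms that] tableau_complete[OF that] by blast
  have sub: "subsumed TYPE('d) C D \<longleftrightarrow> \<not> tableau_satisfiable (And C (Neg D))"
    if "wf_concept C" "wf_concept D" for C D
    using sat[of "And C (Neg D)"] that by (simp add: subsumed_iff)
  have "{C. wf_concept C \<and> satisfiable TYPE('d) C} = {C. wf_concept C \<and> tableau_satisfiable C}"
    using sat by blast
  moreover have "{(C, D). wf_concept C \<and> wf_concept D \<and> subsumed TYPE('d) C D} =
      {(C, D). wf_concept C \<and> wf_concept D \<and> \<not> tableau_satisfiable (And C (Neg D))}"
    using sub by blast
  ultimately show ?thesis
    using decidable_satisfiable decidable_subsumed effective_tableau tableau_terminates sat sub by simp
qed

end
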